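(* Consider the control-affine system $\dot{x}=f(x)+g(x)u$ with state $x\in\mathbb{R}^n$, unconstrained input $u\in\mathbb{R}^m$, and polynomial data $f\in\mathbb{R}^n[x]$, $g\in\mathbb{R}^{n\times m}[x]$. Let $b\in\mathbb{R}[x]$ be a single candidate control barrier function (CBF), with safe set $\mathcal{B}=\{x\in\mathbb{R}^n\mid b(x)\geq 0\}$. Let $S=\{b,L_gb\}$, regarded as a set of equality constraints, with associated set $K=\{x\in\mathbb{R}^n\mid b(x)=0,\ L_gb(x)=0\}$. Then $b$ is a CBF and the system is verified forward invariant to $\mathcal{B}$ if and only if there exist an integer $a\geq 0$, sums-of-squares polynomials $s_1,s_2\in\Sigma[x]$, polynomials $p_{10},p_{20}\in\mathbb{R}[x]$, and polynomial vectors $p_1,p_2\in\mathbb{R}^m[x]$ such that $$h_1(x)L_fb(x)-h_2(x)-(L_fb(x))^{2a}=0$$ holds identically as a polynomial in $x$, where $h_1,h_2\in M_S$ are of the form $$h_i(x)=s_i(x)+b(x)p_{i0}(x)+L_gb(x)p_i(x),\qquad i=1,2.$$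
   Context: $\mathbb{R}[x]$ is the ring of real polynomials in $x=(x_1,\dots,x_n)$; $\mathbb{R}^{m\times n}[x]$ denotes $m\times n$ matrices with entries in $\mathbb{R}[x]$, and $\mathbb{R}^m[x]=\mathbb{R}^{m\times 1}[x]$. $\Sigma[x]\subseteq\mathbb{R}[x]$ is the set of finite sums $\sum_i p_i^2$ with $p_i\in\mathbb{R}[x]$. Lie derivatives: $L_fb(x)=\frac{\partial b(x)}{\partial x}f(x)\in\mathbb{R}[x]$ and $L_gb(x)=\frac{\partial b(x)}{\partial x}g(x)$, a vector of $m$ polynomials, treated as a row in products $L_gb(x)u$ and $L_gb(x)p_i(x)$. Quadratic module: for a set $S=\{f_1,\dots,f_r;g_1,\dots,g_s\}$ of inequality polynomials $f_i$ (constraints $f_i\ge 0$) and equality polynomials $g_j$ (constraints $g_j=0$), $M_S$ is the set of polynomials $s_0+\sum_{i=1}^r s_if_i+\sum_{j=1}^s p_jg_j$ with $s_i\in\Sigma[x]$, $p_j\in\mathbb{R}[x]$. Here there are no inequality polynomials ($r=0$), and the equality polynomials are $b$ and the components of $L_gb$. CBF: $b$ is a CBF if there is an extended class-$\mathcal{K}$ function $\kappa$ such that $\sup_u\{L_fb(x)+L_gb(x)u+\kappa(b(x))\}\geq 0$ for all $x\in\mathbb{R}^n$; the corresponding constraint on the input is $L_gb(x)u\geq-\kappa(b(x))-L_fb(x)$. The set $\mathcal{B}$ is forward invariant if $x(0)\in\mathcal{B}$ implies $x(t)\in\mathcal{B}$ for all $t\geq 0$; "the system is verified forward invariant to $\mathcal{B}$"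 means that an input satisfying this constraint exists, so that $\mathcal{B}$ can be rendered forward invariant. Inputs are unbounded throughout, and the following criterion from the literature is adopted as the standing characterization: a candidate $b$ satisfies the CBF input constraint (i.e. is a CBF) if and only if there is no $x\in\mathbb{R}^n$ with $b(x)=0$, $L_gb(x)=0$ and $L_fb(x)<0$.
   Formalization: The equivalence is stated for data satisfying the adopted criterion (b is a CBF iff no x has b=0, L_gb=0, L_fb<0), which fails for e.g. f=0, g=0, b=-1; that this no-such-x condition is equivalent to the certificate is stated for all data. *)

theory Defs
  imports "HOL-Analysis.Analysis" "HOL-Library.Poly_Mapping"
begin

text \<open>Real polynomials in the variables \<open>x $ i\<close>, \<open>i :: 'n\<close>, as formal objects: finitely
  supported maps from exponent vectors to coefficients. The ring structure (convolution
  product) is the one of \<^theory>\<open>HOL-Library.Poly_Mapping\<close>.\<close>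

type_synonym 'n rpoly = "('n \<Rightarrow>\<^sub>0 nat) \<Rightarrow>\<^sub>0 real"

definition peval :: "('n::finite) rpoly \<Rightarrow> real ^ 'n \<Rightarrow> real" where
  "peval p x =
     (\<Sum>m\<in>Poly_Mapping.keys p. Poly_Mapping.lookup p m * (\<Prod>i\<in>UNIV. (x $ i) ^ Poly_Mapping.lookup m i))"

definition peval_vec :: "('n::finite) rpoly ^ 'k \<Rightarrow> real ^ 'n \<Rightarrow> real ^ ('k::finite)" where
  "peval_vec v x = (\<chi> j. peval (v $ j) x)"

definition peval_mat :: "('n::finite) rpoly ^ 'm ^ 'k \<Rightarrow> real ^ 'n \<Rightarrow> real ^ ('m::finite) ^ ('k::finite)" where
  "peval_mat A x = (\<chi> i j. peval (A $ i $ j) x)"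

text \<open>Subtraction of exponents is truncated, but whenever truncation takes place the
  coefficient is multiplied by the exponent 0.\<close>

definition pdiff :: "'n \<Rightarrow> ('n::finite) rpoly \<Rightarrow> 'n rpoly" where
  "pdiff i p =
     (\<Sum>m\<in>Poly_Mapping.keys p.
        Poly_Mapping.single (m - Poly_Mapping.single i 1)
          (real (Poly_Mapping.lookup m i) * Poly_Mapping.lookup p m))"

definition lie_f :: "('n::finite) rpoly ^ 'n \<Rightarrow> 'n rpoly \<Rightarrow> 'n rpoly" where
  "lie_f f b = (\<Sum>i\<in>UNIV. pdiff i b * f $ i)"

text \<open>\<open>'n rpoly ^ 'm ^ 'n\<close> is the type of matrices with rows indexed by \<open>'n\<close> and columns
  indexed by \<open>'m\<close>.\<close>

definition lie_g :: "('n::finite) rpoly ^ ('m::finite) ^ 'n \<Rightarrow> 'n rpoly \<Rightarrow> 'n rpoly ^ 'm" where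
  "lie_g g b = (\<chi> j. \<Sum>i\<in>UNIV. pdiff i b * g $ i $ j)"

definition row_times :: "('n::finite) rpoly ^ ('m::finite) \<Rightarrow> 'n rpoly ^ 'm \<Rightarrow> 'n rpoly" where
  "row_times v p = (\<Sum>j\<in>UNIV. v $ j * p $ j)"

definition SOS :: "('n::finite) rpoly set" where
  "SOS = {p. \<exists>qs. p = (\<Sum>q\<leftarrow>qs. q ^ 2)}"

text \<open>\<open>F\<close>: inequality polynomials, \<open>G\<close>: equality polynomials (both meant to be finite).\<close>

definition quadratic_module :: "('n::finite) rpoly set \<Rightarrow> 'n rpoly set \<Rightarrow> 'n rpoly set" where
  "quadratic_module F G =
     {s0 + (\<Sum>q\<in>F. s q * q) + (\<Sum>q\<in>G. p q * q) | s0 s p. s0 \<in> SOS \<and> (\<forall>q\<in>F. s q \<in> SOS)}"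

definition equality_set :: "('n::finite) rpoly ^ ('m::finite) ^ 'n \<Rightarrow> 'n rpoly \<Rightarrow> 'n rpoly set" where
  "equality_set g b = insert b (range (\<lambda>j. lie_g g b $ j))"

definition assoc_set :: "('n::finite) rpoly ^ ('m::finite) ^ 'n \<Rightarrow> 'n rpoly \<Rightarrow> (real ^ 'n) set" where
  "assoc_set g b = {x. peval b x = 0 \<and> peval_vec (lie_g g b) x = 0}"

definition extended_class_K :: "(real \<Rightarrow> real) \<Rightarrow> bool" where
  "extended_class_K \<kappa> \<longleftrightarrow> continuous_on UNIV \<kappa> \<and> strict_mono \<kappa> \<and> \<kappa> 0 = 0"

text \<open>The supremum over the unbounded input is taken in the extended reals, since it is
  infinite wherever \<open>lie_g g b\<close> does not vanish.\<close>

definition is_CBF ::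
  "('n::finite) rpoly ^ 'n \<Rightarrow> 'n rpoly ^ ('m::finite) ^ 'n \<Rightarrow> 'n rpoly \<Rightarrow> bool" where
  "is_CBF f g b \<longleftrightarrow>
     (\<exists>\<kappa>. extended_class_K \<kappa> \<and>
        (\<forall>x. (SUP u. ereal (peval (lie_f f b) x + peval_vec (lie_g g b) x \<bullet> u + \<kappa> (peval b x))) \<ge> 0))"

definition input_constraint ::
  "('n::finite) rpoly ^ 'n \<Rightarrow> 'n rpoly ^ ('m::finite) ^ 'n \<Rightarrow> 'n rpoly
    \<Rightarrow> (real \<Rightarrow> real) \<Rightarrow> real ^ 'n \<Rightarrow> real ^ 'm \<Rightarrow> bool" where
  "input_constraint f g b \<kappa> x u \<longleftrightarrow>
     peval_vec (lie_g g b) x \<bullet> u \<ge> - \<kappa> (peval b x) - peval (lie_f f b) x"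

definition safe_set :: "('n::finite) rpoly \<Rightarrow> (real ^ 'n) set" where
  "safe_set b = {x. peval b x \<ge> 0}"

text \<open>Solutions are considered on arbitrary compact intervals \<open>[0, T]\<close>, so that solutions
  with finite escape time are covered as well.\<close>

definition forward_invariant :: "(real ^ 'n \<Rightarrow> real ^ 'n) \<Rightarrow> (real ^ ('n::finite)) set \<Rightarrow> bool" where
  "forward_invariant F B \<longleftrightarrow>
     (\<forall>T x. (\<forall>t\<in>{0..T}. (x has_vector_derivative F (x t)) (at t within {0..T})) \<and> x 0 \<in> B
        \<longrightarrow> (\<forall>t\<in>{0..T}. x t \<in> B))"

definition verified_forward_invariant ::
  "('n::finite) rpoly ^ 'n \<Rightarrow> 'n rpoly ^ ('m::finite) ^ 'n \<Rightarrow> 'n rpoly \<Rightarrow> bool" where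
  "verified_forward_invariant f g b \<longleftrightarrow>
     (\<exists>\<kappa> k. extended_class_K \<kappa> \<and> (\<forall>x. input_constraint f g b \<kappa> x (k x)) \<and>
        forward_invariant (\<lambda>x. peval_vec f x + peval_mat g x *v k x) (safe_set b))"

text \<open>The pointwise criterion which the theory of polynomial CBFs adopts as a characterization
  of \<open>is_CBF\<close>. It is kept apart from \<open>is_CBF\<close> because the two are not equivalent for
  all data: the criterion only concerns the set \<open>b = 0\<close>, whereas \<open>is_CBF\<close> also
  constrains points off it (take \<open>f = 0\<close>, \<open>g = 0\<close>, \<open>b = -1\<close>).\<close>

definition CBF_criterion ::
  "('n::finite) rpoly ^ 'n \<Rightarrow> 'n rpoly ^ ('m::finite) ^ 'n \<Rightarrow> 'n rpoly \<Rightarrow> bool" where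
  "CBF_criterion f g b \<longleftrightarrow> \<not> (\<exists>x\<in>assoc_set g b. peval (lie_f f b) x < 0)"

definition has_certificate ::
  "('n::finite) rpoly ^ 'n \<Rightarrow> 'n rpoly ^ ('m::finite) ^ 'n \<Rightarrow> 'n rpoly \<Rightarrow> bool" where
  "has_certificate f g b \<longleftrightarrow>
     (\<exists>(a::nat) s1 s2 p10 p20 p1 p2 h1 h2.
        s1 \<in> SOS \<and> s2 \<in> SOS \<and>
        h1 \<in> quadratic_module {} (equality_set g b) \<and>
        h2 \<in> quadratic_module {} (equality_set g b) \<and>
        h1 = s1 + b * p10 + row_times (lie_g g b) p1 \<and>
        h2 = s2 + b * p20 + row_times (lie_g g b) p2 \<and>
        h1 * lie_f f b - h2 - (lie_f f b) ^ (2 * a) = 0)"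

end

theory Submission
  imports Defs "HOL-Algebra.Algebraic_Closure_Type"
begin

hide_const (open) module.smult up_ring.coeff up_ring.monom Polynomials.lead_coeff
  Polynomials.degree Poly_Mapping.degree Coset.order
no_notation var ("X\<index>")

text \<open>Forward invariance is elementary: where \<open>b < 0\<close>, the input constraint makes \<open>b\<close>
  strictly increasing along solutions. The certificate is the Krivine--Stengle Positivstellensatz for
  \<open>b = 0\<close>, \<open>L\<^sub>gb = 0\<close>, \<open>L\<^sub>fb < 0\<close>. If there is none, Zorn's lemma gives an ordering of the
  polynomial ring, modulo a prime ideal, that satisfies this system, and one has to find a real point
  satisfying it (Artin--Lang). Let \<open>R\<close> be the real closure of the corresponding ordered field, and
  let \<open>A\<close> be a maximal subfield of \<open>R\<close> all of whose finite subsets embed into the reals up to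
  arithmetic and sign. An element \<open>y\<close> outside \<open>A\<close>, of minimal degree over \<open>A\<close> if
  algebraic, lies in an interval with end points in \<open>A\<close> that is free of roots of any given finitely
  many polynomials (with their derivatives) of smaller degree; their specializations then have constant
  sign on the real interval, where \<open>y\<close> is imitated by a root of the specialized minimal polynomial or,
  if \<open>y\<close> is transcendental, by the midpoint. This contradicts maximality, so \<open>A = R\<close>.\<close>

section \<open>Prime cones\<close>

text \<open>The ordering found may have elements that are infinitely large or infinitesimal over the
  reals, so \<open>R\<close> need not admit any order-preserving ring homomorphism to the reals.
  This is why only finite fragments of its arithmetic are transported, and why the laws of a
  homomorphism appear as statements that hold eventually along a filter of partial maps. The real
  closure is a maximal ordered subfield of an algebraic closure. It has the intermediate value
  property because a sign change of a polynomial yields a prime cone of the univariate polynomial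
  ring, hence an ordering of a root field. The even powers in the certificate come from strictness:
  a prime cone containing \<open>- l\<close> only says that \<open>l\<close> is nonpositive, whereas
  avoiding all \<open>- (l ^ (2 * a))\<close> makes \<open>l\<close> negative. The equivalence of
  \<open>is_CBF\<close> with the pointwise criterion is false for some data, so it enters the final
  statement as a hypothesis.\<close>

definition precone :: "'a::comm_ring_1 set \<Rightarrow> bool" where
  "precone T \<longleftrightarrow> (\<forall>x\<in>T. \<forall>y\<in>T. x + y \<in> T \<and> x * y \<in> T) \<and> (\<forall>x. x * x \<in> T)"

text \<open>A point of the real spectrum: the elements lying in \<open>P\<close> together with their
  negatives form a prime ideal, the support, and \<open>P\<close> totally orders the quotient by
  it.\<close>

definition prime_cone :: "'a::comm_ring_1 set \<Rightarrow> bool" where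
  "prime_cone P \<longleftrightarrow> precone P \<and> -1 \<notin> P \<and> (\<forall>x. x \<in> P \<or> -x \<in> P) \<and>
     (\<forall>x y. x * y \<in> P \<and> - (x * y) \<in> P \<longrightarrow> x \<in> P \<and> -x \<in> P \<or> y \<in> P \<and> -y \<in> P)"

lemma cone_add: "precone T \<Longrightarrow> x \<in> T \<Longrightarrow> y \<in> T \<Longrightarrow> x + y \<in> T"
  and cone_mult: "precone T \<Longrightarrow> x \<in> T \<Longrightarrow> y \<in> T \<Longrightarrow> x * y \<in> T"
  and cone_square: "precone T \<Longrightarrow> x * x \<in> T"
  by (auto simp: precone_def)

lemma cone_0: "precone T \<Longrightarrow> 0 \<in> T" and cone_1: "precone T \<Longrightarrow> 1 \<in> T"
  using cone_square[of T 0] cone_square[of T 1] by auto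

lemma cone_adjoin:
  assumes "precone T"
  shows "precone {s + x * t | s t. s \<in> T \<and> t \<in> T}"
  unfolding precone_def
proof (intro conjI ballI allI)
  fix y z assume "y \<in> {s + x * t | s t. s \<in> T \<and> t \<in> T}" "z \<in> {s + x * t | s t. s \<in> T \<and> t \<in> T}"
  then obtain s t s' t' where h: "s \<in> T" "t \<in> T" "s' \<in> T" "t' \<in> T" "y = s + x * t" "z = s' + x * t'"
    by auto
  have "y + z = (s + s') + x * (t + t')" by (simp add: h algebra_simps)
  then show "y + z \<in> {s + x * t | s t. s \<in> T \<and> t \<in> T}" using h cone_add[OF assms] by blast
  have "y * z = (s * s' + x * x * (t * t')) + x * (s * t' + s' * t)" by (simp add: h algebra_simps)
  moreover have "s * s' + x * x * (t * t') \<in> T" "s * t' + s' * t \<in> T"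
    by (intro cone_add cone_mult assms cone_square h)+
  ultimately show "y * z \<in> {s + x * t | s t. s \<in> T \<and> t \<in> T}" by blast
next
  fix y show "y * y \<in> {s + x * t | s t. s \<in> T \<and> t \<in> T}"
    using cone_square[OF assms, of y] cone_0[OF assms] by force
qed

text \<open>A precone maximal among those that contain \<open>T\<close> and avoid the negatives of
  \<open>M\<close> is prime: if two elements cannot be adjoined, multiplying the two resulting
  relations puts the negative of an element of \<open>M\<close> into it. As \<open>M\<close> lies in
  \<open>T\<close>, its elements become strictly positive in the ordering given by
  \<open>P\<close>.\<close>

lemma prime_cone_extend:
  fixes T M :: "'a::comm_ring_1 set"
  assumes T: "precone T" and M: "M \<subseteq> T" "1 \<in> M" "\<And>m n. m \<in> M \<Longrightarrow> n \<in> M \<Longrightarrow> m * n \<in> M"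
    and TM: "\<And>m. m \<in> M \<Longrightarrow> -m \<notin> T"
  obtains P where "prime_cone P" "T \<subseteq> P" "\<And>m. m \<in> M \<Longrightarrow> -m \<notin> P"
proof -
  define S where "S = {P. precone P \<and> T \<subseteq> P \<and> (\<forall>m\<in>M. -m \<notin> P)}"
  have "\<exists>P\<in>S. \<forall>Y\<in>S. P \<subseteq> Y \<longrightarrow> Y = P"
  proof (rule subset_Zorn_nonempty)
    show "S \<noteq> {}" using T TM by (auto simp: S_def)
    fix C assume C: "C \<noteq> {}" "subset.chain S C"
    have "precone (\<Union>C)" unfolding precone_def
    proof (intro conjI ballI allI)
      fix x y assume "x \<in> \<Union>C" "y \<in> \<Union>C"
      then obtain Y where "Y \<in> C" "x \<in> Y" "y \<in> Y"
        using C(2) unfolding subset_chain_def by (metis UnionE subsetD)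
      moreover have "precone Y" using C \<open>Y \<in> C\<close> by (auto simp: S_def subset_chain_def)
      ultimately show "x + y \<in> \<Union>C" "x * y \<in> \<Union>C" using cone_add cone_mult by blast+
    next
      fix x
      obtain Y where "Y \<in> C" "precone Y" using C by (auto simp: S_def subset_chain_def)
      then show "x * x \<in> \<Union>C" using cone_square by blast
    qed
    then show "\<Union>C \<in> S" using C by (auto simp: S_def subset_chain_def)
  qed
  then obtain P where PS: "P \<in> S" and maxS: "\<And>Y. Y \<in> S \<Longrightarrow> P \<subseteq> Y \<Longrightarrow> Y = P" by metis
  have P: "precone P" "T \<subseteq> P" "\<And>m. m \<in> M \<Longrightarrow> -m \<notin> P"
    using PS unfolding S_def by auto
  have max: "\<exists>m\<in>M. -m \<in> Y" if "precone Y" "P \<subseteq> Y" "Y \<noteq> P" for Y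
    using maxS[of Y] that P(2) unfolding S_def by auto
  \<comment> \<open>By maximality, adjoining \<open>x\<close> puts some \<open>- m\<close> into the
    cone; the relation \<open>- m = s + x * t\<close> is rewritten with the terms from
    \<open>P\<close> on the left.\<close>
  have key: "\<exists>m\<in>M. \<exists>s\<in>P. \<exists>t\<in>P. m + s = - (x * t)" if "x \<notin> P" for x
  proof -
    let ?Y = "{s + x * t | s t. s \<in> P \<and> t \<in> P}"
    have sub: "P \<subseteq> ?Y" using cone_0[OF P(1)] by force
    have "x = 0 + x * 1" by simp
    then have "x \<in> ?Y" using cone_0[OF P(1)] cone_1[OF P(1)] by blast
    then have "?Y \<noteq> P" using that by metis
    then obtain m where "m \<in> M" "-m \<in> ?Y" using max[OF cone_adjoin[OF P(1)]] sub by blast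
    then obtain s t where "m \<in> M" "s \<in> P" "t \<in> P" "-m = s + x * t" by blast
    then have "m = - (s + x * t)" by (metis add.inverse_inverse)
    then have "m + s = - (x * t)" by simp
    then show ?thesis using \<open>m \<in> M\<close> \<open>s \<in> P\<close> \<open>t \<in> P\<close> by blast
  qed
  have total: "x \<in> P \<or> -x \<in> P" for x
  proof (rule ccontr)
    assume neg: "\<not> ?thesis"
    then obtain m s t n u v where h: "m \<in> M" "s \<in> P" "t \<in> P" "m + s = - (x * t)"
       "n \<in> M" "u \<in> P" "v \<in> P" "n + u = - (- x * v)"
      using key[of x] key[of "-x"] by blast
    have hM: "m \<in> P" "n \<in> P" using h(1,5) M(1) P(2) by auto
    have "(m + s) * (n + u) = - (x * x * (t * v))" unfolding h by (simp add: algebra_simps)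
    moreover have "- (m * n) = (m * u + s * n + s * u) - (m + s) * (n + u)" by (simp add: algebra_simps)
    ultimately have eq: "- (m * n) = (m * u + s * n + s * u) + x * x * (t * v)" by simp
    have "(m * u + s * n + s * u) + x * x * (t * v) \<in> P"
      using h(2,3,6,7) hM cone_square[OF P(1), of x] by (simp add: cone_add[OF P(1)] cone_mult[OF P(1)])
    then show False using P(3)[OF M(3)[OF h(1) h(5)]] eq by simp
  qed
  have prime: "x \<in> P \<and> -x \<in> P \<or> y \<in> P \<and> -y \<in> P" if xy: "x * y \<in> P" "- (x * y) \<in> P" for x y
  proof (rule ccontr)
    assume "\<not> ?thesis"
    \<comment> \<open>The signs are chosen so that both factors lie outside \<open>P\<close>. Either
      choice leaves \<open>- (x' * y')\<close> in \<open>P\<close>, since both signs of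
      \<open>x * y\<close> are there.\<close>
    then obtain x' y' where x': "x' = x \<or> x' = -x" "x' \<notin> P" and y': "y' = y \<or> y' = -y" "y' \<notin> P"
      by blast
    then obtain m s t n u v where h: "m \<in> M" "s \<in> P" "t \<in> P" "m + s = - (x' * t)"
       "n \<in> M" "u \<in> P" "v \<in> P" "n + u = - (y' * v)"
      using key[of x'] key[of y'] by blast
    have hM: "m \<in> P" "n \<in> P" using h(1,5) M(1) P(2) by auto
    have "(m + s) * (n + u) = (x' * y') * (t * v)" unfolding h by (simp add: algebra_simps)
    moreover have "- (m * n) = (m * u + s * n + s * u) - (m + s) * (n + u)" by (simp add: algebra_simps)
    ultimately have eq: "- (m * n) = (m * u + s * n + s * u) + - (x' * y') * (t * v)" by simp
    have "- (x' * y') \<in> P" using x' y' xy by auto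
    then have "(m * u + s * n + s * u) + - (x' * y') * (t * v) \<in> P"
      using h(2,3,6,7) hM by (intro cone_add cone_mult P(1)) auto
    then show False using P(3)[OF M(3)[OF h(1) h(5)]] eq by simp
  qed
  have "prime_cone P" unfolding prime_cone_def using P M(2) total prime by blast
  then show ?thesis using that P by blast
qed

text \<open>Nonnegative constants of an ordered field need not be squares. The weights
  \<open>c\<close> ensure that the cones obtained from these sums extend the order of the
  coefficient field.\<close>

inductive_set weighted_squares :: "'a::linordered_field poly set" where
  zero: "0 \<in> weighted_squares"
| step: "s \<in> weighted_squares \<Longrightarrow> c \<ge> 0 \<Longrightarrow> smult c (f * f) + s \<in> weighted_squares"

lemma weighted_squares_add: "s \<in> weighted_squares \<Longrightarrow> t \<in> weighted_squares \<Longrightarrow> s + t \<in> weighted_squares"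
  by (induction rule: weighted_squares.induct) (auto simp: add.assoc intro: weighted_squares.step)

lemma weighted_squares_single: "c \<ge> 0 \<Longrightarrow> smult c (f * f) \<in> weighted_squares"
  using weighted_squares.step[OF weighted_squares.zero] by fastforce

lemma weighted_squares_mult:
  assumes "s \<in> weighted_squares" "t \<in> weighted_squares" shows "s * t \<in> weighted_squares"
proof -
  have *: "smult c (f * f) * t \<in> weighted_squares" if "c \<ge> 0" "t \<in> weighted_squares" for c f and t :: "'a poly"
    using that(2)
  proof (induction)
    case zero then show ?case by (simp add: weighted_squares.zero)
  next
    case (step s d g)
    have "smult c (f * f) * (smult d (g * g) + s) = smult (c * d) ((f * g) * (f * g)) + smult c (f * f) * s"
      by (simp add: algebra_simps smult_add_right)
    then show ?case using step \<open>c \<ge> 0\<close> by (auto intro: weighted_squares.step)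
  qed
  show ?thesis using assms(1)
    proof induction
    case (step s c f)
    then show ?case using weighted_squares_add[OF *[OF step(2) assms(2)]] by (simp add: ring_distribs)
  qed (simp add: weighted_squares.zero)
qed

lemma weighted_squares_nonneg: "s \<in> weighted_squares \<Longrightarrow> poly s x \<ge> 0"
  by (induction rule: weighted_squares.induct) auto

text \<open>Each \<open>f\<close> is reduced modulo \<open>p\<close>, which changes the sum by a
  multiple of \<open>p\<close>. The degree bound drives the descent in
  \<open>weighted_squares_sign_change\<close>.\<close>

lemma weighted_squares_mod:
  assumes "s \<in> weighted_squares" "degree p > 0"
  shows "\<exists>t\<in>weighted_squares. p dvd s - t \<and> degree t \<le> 2 * (degree p - 1)"
  using assms(1)
proof induction
  case zero
  show ?case by (rule bexI[of _ 0]) (auto simp: weighted_squares.zero)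
next
  case (step s c f)
  then obtain t where t: "t \<in> weighted_squares" "p dvd s - t" "degree t \<le> 2 * (degree p - 1)" by blast
  let ?g = "f mod p"
  have "degree ?g \<le> degree p - 1" using degree_mod_less'[of p f] assms(2)
    by (cases "?g = 0") (auto, fastforce)
  then have "degree (smult c (?g * ?g)) \<le> 2 * (degree p - 1)"
    using degree_mult_le[of ?g ?g] degree_smult_le[of c "?g * ?g"] by linarith
  then have "degree (smult c (?g * ?g) + t) \<le> 2 * (degree p - 1)"
    using t by (intro degree_add_le) auto
  moreover have "p dvd smult c (f * f) + s - (smult c (?g * ?g) + t)"
  proof -
    have "smult c (f * f) + s - (smult c (?g * ?g) + t) = smult c ((f - ?g) * (f + ?g)) + (s - t)"
      by (simp add: algebra_simps smult_diff_right smult_add_right)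
    moreover have "p dvd f - ?g" by (simp add: minus_mod_eq_mult_div)
    ultimately show ?thesis using t by (metis dvd_add dvd_mult2 dvd_smult)
  qed
  ultimately show ?case using t step by (meson weighted_squares.step)
qed

text \<open>Descent on the degree: after reducing \<open>s\<close> modulo \<open>p\<close> one has
  \<open>p * q = -1 - t\<close>, which is negative at every point. So \<open>q\<close> takes
  opposite signs at \<open>a\<close> and \<open>b\<close> just as \<open>p\<close> does, has smaller
  degree, and satisfies an identity of the same form with \<open>p\<close> as the cofactor.\<close>

lemma weighted_squares_sign_change:
  assumes "poly p a * poly p b < 0" "s \<in> weighted_squares"
  shows "s + p * h \<noteq> -1"
  using assms
proof (induction "degree p" arbitrary: p s h rule: less_induct)
  case less
  show ?case
  proof
    assume eq: "s + p * h = -1"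
    have dp: "degree p > 0"
    proof (rule ccontr)
      assume "\<not> degree p > 0"
      then obtain c where "p = [:c:]" by (auto elim: degree_eq_zeroE)
      then show False using less.prems(1) by (simp add: not_square_less_zero)
    qed
    obtain t where t: "t \<in> weighted_squares" "p dvd s - t" "degree t \<le> 2 * (degree p - 1)"
      using weighted_squares_mod[OF less.prems(2) dp] by blast
    then obtain k where "s - t = p * k" by (auto simp: dvd_def)
    then have eq': "t + p * (h + k) = -1" using eq by (simp add: algebra_simps)
    define q where "q = h + k"
    have pq: "p * q = -1 - t" using eq' unfolding q_def by (simp add: algebra_simps)
    have sgn: "poly p x * poly q x < 0" for x
      using weighted_squares_nonneg[OF t(1), of x] arg_cong[OF pq, of "\<lambda>u. poly u x"] by simp
    have "poly p a * poly q a * (poly p b * poly q b) > 0"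
      using sgn by (intro mult_neg_neg)
    then have "(poly p a * poly p b) * (poly q a * poly q b) > 0" by (simp add: algebra_simps)
    then have qab: "poly q a * poly q b < 0" using less.prems(1) zero_less_mult_iff by (metis less_asym)
    have "degree (p * q) \<le> 2 * (degree p - 1)" unfolding pq using t(3) by (intro degree_diff_le) auto
    moreover have "degree (p * q) = degree p + degree q"
      using dp qab by (intro degree_mult_eq) auto
    ultimately have "degree q < degree p" using dp by linarith
    then show False using less.hyps[OF _ qab t(1), of p] eq' by (simp add: q_def mult.commute)
  qed
qed

text \<open>The support of \<open>P\<close> is a prime ideal containing \<open>p\<close>, so
  \<open>P\<close> orders the field generated by a root of an irreducible factor of
  \<open>p\<close>, compatibly with the order of the coefficients.\<close>

lemma prime_cone_root:
  fixes p :: "'a::linordered_field poly"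
  assumes "poly p a * poly p b < 0"
  obtains P where "prime_cone P" "p \<in> P" "-p \<in> P" "\<And>c. c \<ge> 0 \<Longrightarrow> [:c:] \<in> P"
proof -
  define T where "T = {s + p * h | s h. s \<in> weighted_squares}"
  have "precone T" unfolding precone_def
  proof (intro conjI ballI allI)
    fix x y assume "x \<in> T" "y \<in> T"
    then obtain s h t k where h: "s \<in> weighted_squares" "t \<in> weighted_squares" "x = s + p * h" "y = t + p * k"
      unfolding T_def by auto
    have "x + y = (s + t) + p * (h + k)" by (simp add: h algebra_simps)
    then show "x + y \<in> T" using weighted_squares_add[OF h(1,2)] unfolding T_def by blast
    have "x * y = (s * t) + p * (h * t + s * k + p * h * k)" by (simp add: h algebra_simps)
    then show "x * y \<in> T" using weighted_squares_mult[OF h(1,2)] unfolding T_def by blast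
  next
    fix x
    have "x * x = smult 1 (x * x) + p * 0" by simp
    then show "x * x \<in> T" using weighted_squares_single[of 1 x] unfolding T_def by (metis (mono_tags, lifting) mem_Collect_eq zero_le_one)
  qed
  moreover have "-1 \<notin> T" unfolding T_def
  proof
    assume "-1 \<in> {s + p * h |s h. s \<in> weighted_squares}"
    then obtain s h where "s \<in> weighted_squares" "s + p * h = -1" by fastforce
    then show False using weighted_squares_sign_change[OF assms] by blast
  qed
  ultimately obtain P where P: "prime_cone P" "T \<subseteq> P"
    by (rule_tac prime_cone_extend[of T "{1}"]) (auto simp: cone_1)
  have "0 + p * 1 \<in> T" "0 + p * (-1) \<in> T" unfolding T_def using weighted_squares.zero by blast+
  moreover have "[:c:] \<in> T" if "c \<ge> 0" for c
  proof -
    have "[:c:] = smult c (1 * 1) + p * 0" by simp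
    then show ?thesis using weighted_squares_single[OF that, of 1] unfolding T_def by (metis (mono_tags, lifting) mem_Collect_eq)
  qed
  ultimately show ?thesis using P(2) by (intro that[OF P(1)]) auto
qed

section \<open>The real closure of an ordered field\<close>

text \<open>\<open>P\<close> is the set of nonnegative elements of the subfield formed by
  \<open>P\<close> and its negatives. Encoding field and order in a single set makes inclusion mean
  extension of ordered fields.\<close>

definition ordered_subfield :: "'a::linordered_field alg_closure set \<Rightarrow> bool" where
  "ordered_subfield P \<longleftrightarrow> (\<forall>c\<ge>0. to_ac c \<in> P) \<and>
     (\<forall>x\<in>P. \<forall>y\<in>P. x + y \<in> P \<and> x * y \<in> P \<and> (x - y \<in> P \<or> y - x \<in> P)) \<and>
     (\<forall>x\<in>P. inverse x \<in> P) \<and> (\<forall>x. x \<in> P \<and> - x \<in> P \<longrightarrow> x = 0)"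

lemma ordered_subfield_base: "ordered_subfield (to_ac ` {0..})"
  unfolding ordered_subfield_def
proof (intro conjI ballI allI impI)
  fix x y :: "'a alg_closure" assume "x \<in> to_ac ` {0..}" "y \<in> to_ac ` {0..}"
  then obtain c d where h: "x = to_ac c" "c \<ge> 0" "y = to_ac d" "d \<ge> 0" by auto
  then have e: "x + y = to_ac (c + d)" "x * y = to_ac (c * d)" "x - y = to_ac (c - d)" "y - x = to_ac (d - c)"
    by auto
  show "x + y \<in> to_ac ` {0..}" "x * y \<in> to_ac ` {0..}" using h unfolding e by (simp_all only: image_eqI atLeast_iff add_nonneg_nonneg mult_nonneg_nonneg)
  show "x - y \<in> to_ac ` {0..} \<or> y - x \<in> to_ac ` {0..}" using h unfolding e
    by (cases "d \<le> c") (auto simp del: to_ac_diff)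
next
  fix x :: "'a alg_closure" assume "x \<in> to_ac ` {0..}"
  then obtain c where "x = to_ac c" "c \<ge> 0" by auto
  then have "inverse x = to_ac (inverse c)" "inverse c \<ge> 0" by auto
  then show "inverse x \<in> to_ac ` {0..}" by (metis atLeast_iff image_eqI)
next
  fix x :: "'a alg_closure" assume "x \<in> to_ac ` {0..} \<and> - x \<in> to_ac ` {0..}"
  then obtain c d where "x = to_ac c" "c \<ge> 0" "- x = to_ac d" "d \<ge> 0" by auto
  then have "c + d = 0" by (metis add.right_inverse to_ac_add to_ac_eq_0_iff)
  then show "x = 0" using \<open>x = to_ac c\<close> \<open>c \<ge> 0\<close> \<open>d \<ge> 0\<close> by (simp add: add_nonneg_eq_0_iff)
qed auto

lemma ordered_subfieldD:
  assumes "ordered_subfield P"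
  shows "c \<ge> 0 \<Longrightarrow> to_ac c \<in> P" "x \<in> P \<Longrightarrow> y \<in> P \<Longrightarrow> x + y \<in> P" "x \<in> P \<Longrightarrow> y \<in> P \<Longrightarrow> x * y \<in> P"
    "x \<in> P \<Longrightarrow> y \<in> P \<Longrightarrow> x - y \<in> P \<or> y - x \<in> P" "x \<in> P \<Longrightarrow> inverse x \<in> P"
    "x \<in> P \<Longrightarrow> - x \<in> P \<Longrightarrow> x = 0"
  using assms by (simp_all add: ordered_subfield_def)

lemma ordered_subfield_maximal_exists:
  "\<exists>P. ordered_subfield P \<and> (\<forall>Q. ordered_subfield Q \<longrightarrow> P \<subseteq> Q \<longrightarrow> Q = P)"
proof -
  let ?S = "{P. ordered_subfield P}"
  have "\<exists>P\<in>?S. \<forall>Q\<in>?S. P \<subseteq> Q \<longrightarrow> Q = P"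
  proof (rule subset_Zorn_nonempty)
    show "?S \<noteq> {}" using ordered_subfield_base by blast
    fix C assume C: "C \<noteq> {}" "subset.chain ?S C"
    have os: "ordered_subfield P" if "P \<in> C" for P
      using subsetD[OF conjunct1[OF C(2)[unfolded subset_chain_def]] that] by simp
    have common: "\<exists>P\<in>C. x \<in> P \<and> y \<in> P" if xy: "x \<in> \<Union>C" "y \<in> \<Union>C" for x y
    proof -
      obtain P Q where PQ: "P \<in> C" "Q \<in> C" "x \<in> P" "y \<in> Q" using xy by blast
      then have "P \<subseteq> Q \<or> Q \<subseteq> P" using C(2) unfolding subset_chain_def by simp
      then show ?thesis using PQ by (meson subsetD)
    qed
    have "ordered_subfield (\<Union>C)" unfolding ordered_subfield_def
    proof (intro conjI ballI)
      fix x y assume "x \<in> \<Union>C" "y \<in> \<Union>C"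
      then obtain P where P: "P \<in> C" "x \<in> P" "y \<in> P" using common by blast
      show "x + y \<in> \<Union>C" "x * y \<in> \<Union>C" "x - y \<in> \<Union>C \<or> y - x \<in> \<Union>C"
        using ordered_subfieldD(2,3,4)[OF os[OF P(1)] P(2,3)] P(1) by blast+
    next
      obtain P where "P \<in> C" using C(1) by blast
      then show "\<forall>c\<ge>0. to_ac c \<in> \<Union>C" using ordered_subfieldD(1)[OF os] by blast
    next
      fix x assume "x \<in> \<Union>C"
      then show "inverse x \<in> \<Union>C" using ordered_subfieldD(5)[OF os] by blast
    next
      show "\<forall>x. x \<in> \<Union>C \<and> - x \<in> \<Union>C \<longrightarrow> x = 0"
        using ordered_subfieldD(6)[OF os] common by blast
    qed
    then show "\<Union>C \<in> ?S" by simp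
  qed
  then show ?thesis by auto
qed

text \<open>Fixed once and for all, so that a type can be built from it.\<close>

definition maximal_cone :: "'a::linordered_field alg_closure set" where
  "maximal_cone = (SOME P. ordered_subfield P \<and> (\<forall>Q. ordered_subfield Q \<longrightarrow> P \<subseteq> Q \<longrightarrow> Q = P))"

lemma maximal_cone: "ordered_subfield maximal_cone"
  unfolding maximal_cone_def by (rule conjunct1[OF someI_ex[OF ordered_subfield_maximal_exists]])

lemma maximal_cone_maximal: "ordered_subfield Q \<Longrightarrow> maximal_cone \<subseteq> Q \<Longrightarrow> Q = maximal_cone"
  unfolding maximal_cone_def by (rule conjunct2[OF someI_ex[OF ordered_subfield_maximal_exists], rule_format])

lemmas maximal_cone_to_ac = ordered_subfieldD(1)[OF maximal_cone]
  and maximal_cone_add = ordered_subfieldD(2)[OF maximal_cone]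
  and maximal_cone_mult = ordered_subfieldD(3)[OF maximal_cone]
  and maximal_cone_diff = ordered_subfieldD(4)[OF maximal_cone]
  and maximal_cone_inverse = ordered_subfieldD(5)[OF maximal_cone]
  and maximal_cone_antisym = ordered_subfieldD(6)[OF maximal_cone]

lemma maximal_cone_total_add:
  assumes "x \<in> maximal_cone \<or> - x \<in> maximal_cone" "y \<in> maximal_cone \<or> - y \<in> maximal_cone"
  shows "x + y \<in> maximal_cone \<or> - (x + y) \<in> maximal_cone"
  using assms maximal_cone_add[of x y] maximal_cone_add[of "-x" "-y"]
    maximal_cone_diff[of x "-y"] maximal_cone_diff[of "-x" y]
  by (auto simp: add.commute minus_diff_commute)

section \<open>The real closure as an ordered field\<close>

typedef (overloaded) 'a::linordered_field real_closure =
  "{x :: 'a alg_closure. x \<in> maximal_cone \<or> - x \<in> maximal_cone}"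
  using maximal_cone_to_ac[of "0::'a"] by (intro exI[of _ 0]) simp

setup_lifting type_definition_real_closure

instantiation real_closure :: (linordered_field) linordered_field
begin

lift_definition zero_real_closure :: "'a real_closure" is 0
  using maximal_cone_to_ac[of "0::'a"] by simp
lift_definition one_real_closure :: "'a real_closure" is 1
  using maximal_cone_to_ac[of "1::'a"] by simp
lift_definition uminus_real_closure :: "'a real_closure \<Rightarrow> 'a real_closure" is uminus by auto
lift_definition plus_real_closure :: "'a real_closure \<Rightarrow> 'a real_closure \<Rightarrow> 'a real_closure" is plus
  by (rule maximal_cone_total_add)
lift_definition minus_real_closure :: "'a real_closure \<Rightarrow> 'a real_closure \<Rightarrow> 'a real_closure" is minus
  subgoal for x y using maximal_cone_total_add[of x "- y"] by auto
  done
lift_definition times_real_closure :: "'a real_closure \<Rightarrow> 'a real_closure \<Rightarrow> 'a real_closure" is times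
  subgoal for x y
    using maximal_cone_mult[of x y] maximal_cone_mult[of "-x" "-y"] maximal_cone_mult[of x "-y"] maximal_cone_mult[of "-x" y]
    by auto
  done
lift_definition inverse_real_closure :: "'a real_closure \<Rightarrow> 'a real_closure" is inverse
  subgoal for x
    using maximal_cone_inverse[of x] maximal_cone_inverse[of "-x"] by auto
  done
definition divide_real_closure :: "'a real_closure \<Rightarrow> 'a real_closure \<Rightarrow> 'a real_closure" where
  "divide_real_closure x y = x * inverse y"
lift_definition less_eq_real_closure :: "'a real_closure \<Rightarrow> 'a real_closure \<Rightarrow> bool" is
  "\<lambda>x y. y - x \<in> maximal_cone" .
definition less_real_closure :: "'a real_closure \<Rightarrow> 'a real_closure \<Rightarrow> bool" where
  "less_real_closure x y \<longleftrightarrow> x \<le> y \<and> \<not> y \<le> x"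
definition abs_real_closure :: "'a real_closure \<Rightarrow> 'a real_closure" where
  "abs_real_closure x = (if x < 0 then - x else x)"
definition sgn_real_closure :: "'a real_closure \<Rightarrow> 'a real_closure" where
  "sgn_real_closure x = (if x = 0 then 0 else if 0 < x then 1 else - 1)"

lemma real_closure_antisym: "x = y" if "x \<le> y" "y \<le> x" for x y :: "'a real_closure" using that
proof transfer
  fix x y :: "'a alg_closure" assume "y - x \<in> maximal_cone" "x - y \<in> maximal_cone"
  then show "x = y" using maximal_cone_antisym[of "y - x"] by simp
qed

instance
proof
  fix x y z :: "'a real_closure"
  show "x + y + z = x + (y + z)" by transfer (rule add.assoc)
  show "x + y = y + x" by transfer (rule add.commute)
  show "0 + x = x" "- x + x = 0" "x - y = x + - y" "1 * x = x" "(0::'a real_closure) \<noteq> 1"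
    by (transfer; simp)+
  show "x + y - x = y" "0 * x = 0" "x * 0 = 0" by (transfer; simp)+
  show "x - y - z = x - (y + z)" by transfer (rule diff_diff_add)
  show "x * y * z = x * (y * z)" by transfer (rule mult.assoc)
  show "x * y = y * x" by transfer (rule mult.commute)
  show "(x + y) * z = x * z + y * z" by transfer (rule distrib_right)
  show "x \<noteq> 0 \<Longrightarrow> inverse x * x = 1" "inverse (0::'a real_closure) = 0" by (transfer; simp)+
  show "x div y = x * inverse y" by (rule divide_real_closure_def)
  show "x < y \<longleftrightarrow> x \<le> y \<and> \<not> y \<le> x" by (rule less_real_closure_def)
  show "x \<le> x" using maximal_cone_to_ac[of "0::'a"] by transfer simp
  show "x \<le> z" if "x \<le> y" "y \<le> z" using that
  proof transfer
    fix x y z :: "'a alg_closure" assume "y - x \<in> maximal_cone" "z - y \<in> maximal_cone"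
    then have "(y - x) + (z - y) \<in> maximal_cone" by (rule maximal_cone_add)
    then show "z - x \<in> maximal_cone" by simp
  qed
  show "x = y" if "x \<le> y" "y \<le> x" using that by (rule real_closure_antisym)
  show "x \<le> y \<or> y \<le> x"
  proof transfer
    fix x y :: "'a alg_closure"
    assume "x \<in> maximal_cone \<or> - x \<in> maximal_cone" "y \<in> maximal_cone \<or> - y \<in> maximal_cone"
    then show "y - x \<in> maximal_cone \<or> x - y \<in> maximal_cone"
      using maximal_cone_total_add[of y "- x"] by auto
  qed
  show "z + x \<le> z + y" if "x \<le> y" using that by transfer simp
  show "z * x < z * y" if "x < y" "0 < z"
  proof -
    have "x \<le> y" "0 \<le> z" "x \<noteq> y" "z \<noteq> 0" using that by (auto simp: less_real_closure_def)
    then have "z * x \<le> z * y \<and> z * x \<noteq> z * y"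
    proof transfer
      fix x y z :: "'a alg_closure" assume h: "y - x \<in> maximal_cone" "z - 0 \<in> maximal_cone" "x \<noteq> y" "z \<noteq> 0"
      then have "z * (y - x) \<in> maximal_cone" by (simp add: maximal_cone_mult)
      then show "z * y - z * x \<in> maximal_cone \<and> z * x \<noteq> z * y" using h by (simp add: right_diff_distrib)
    qed
    then show ?thesis unfolding less_real_closure_def using real_closure_antisym by blast
  qed
  show "\<bar>x\<bar> = (if x < 0 then - x else x)" by (rule abs_real_closure_def)
  show "sgn x = (if x = 0 then 0 else if 0 < x then 1 else - 1)" by (rule sgn_real_closure_def)
qed

end

lift_definition to_rc :: "'a::linordered_field \<Rightarrow> 'a real_closure" is to_ac
  subgoal for c using maximal_cone_to_ac[of c] maximal_cone_to_ac[of "- c"] by (cases "c \<ge> 0") auto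
  done

lemma to_rc_add: "to_rc (x + y) = to_rc x + to_rc y" by transfer simp
lemma to_rc_mult: "to_rc (x * y) = to_rc x * to_rc y" by transfer simp
lemma to_rc_1: "to_rc 1 = 1" by transfer simp
lemma to_rc_eq_iff: "to_rc x = to_rc y \<longleftrightarrow> x = y" by transfer simp
lemma to_rc_nonneg: "x \<ge> 0 \<Longrightarrow> to_rc x \<ge> 0" by transfer (simp add: maximal_cone_to_ac)

section \<open>Polynomials over the real closure, evaluated in the algebraic closure\<close>

lemma map_poly_hom_add:
  assumes "h 0 = 0" "\<And>x y. h (x + y) = h x + h y"
  shows "map_poly h (p + q) = map_poly h p + map_poly h q"
  using assms by (intro poly_eqI) (simp add: coeff_map_poly)

lemma map_poly_hom_mult:
  fixes h :: "'a::comm_semiring_0 \<Rightarrow> 'b::comm_semiring_0"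
  assumes "h 0 = 0" "\<And>x y. h (x + y) = h x + h y" "\<And>x y. h (x * y) = h x * h y"
  shows "map_poly h (p * q) = map_poly h p * map_poly h q"
proof -
  have "h (sum f A) = (\<Sum>x\<in>A. h (f x))" for f :: "nat \<Rightarrow> 'a" and A
    using assms by (induction A rule: infinite_finite_induct) auto
  then show ?thesis using assms by (intro poly_eqI) (simp add: coeff_map_poly coeff_mult)
qed

definition rc_eval :: "'a::linordered_field real_closure poly \<Rightarrow> 'a alg_closure \<Rightarrow> 'a alg_closure" where
  "rc_eval f w = poly (map_poly Rep_real_closure f) w"

lemma Rep_rc_0 [simp]: "Rep_real_closure 0 = 0" by (rule zero_real_closure.rep_eq)
lemma Rep_rc_1 [simp]: "Rep_real_closure 1 = 1" by (rule one_real_closure.rep_eq)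
lemma Rep_rc_eq_0_iff: "Rep_real_closure x = 0 \<longleftrightarrow> x = 0" by (metis Rep_real_closure_inject Rep_rc_0)

lemma rc_eval_add: "rc_eval (f + g) w = rc_eval f w + rc_eval g w"
  unfolding rc_eval_def by (subst map_poly_hom_add) (auto simp: plus_real_closure.rep_eq)

lemma rc_eval_mult: "rc_eval (f * g) w = rc_eval f w * rc_eval g w"
  unfolding rc_eval_def by (subst map_poly_hom_mult) (auto simp: plus_real_closure.rep_eq times_real_closure.rep_eq)

lemma rc_eval_const: "rc_eval [:c:] w = Rep_real_closure c"
  unfolding rc_eval_def by (cases "c = 0") (auto simp: map_poly_pCons)

lemma rc_eval_0: "rc_eval 0 w = 0" unfolding rc_eval_def by simp
lemma rc_eval_minus: "rc_eval (- f) w = - rc_eval f w"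
  using rc_eval_add[of f "-f" w] by (simp add: rc_eval_0 eq_neg_iff_add_eq_0 add.commute)
lemma rc_eval_diff: "rc_eval (f - g) w = rc_eval f w - rc_eval g w"
  using rc_eval_add[of f "-g" w] by (simp add: rc_eval_minus)
lemma rc_eval_x: "rc_eval [:0, 1:] w = w"
  unfolding rc_eval_def by (simp add: map_poly_pCons)

lemma rc_eval_Rep: "rc_eval f (Rep_real_closure x) = Rep_real_closure (poly f x)"
proof (induction f)
  case (pCons a f)
  have "rc_eval (pCons a f) y = Rep_real_closure a + y * rc_eval f y" for y
    unfolding rc_eval_def by (simp add: map_poly_pCons)
  then show ?case using pCons by (simp add: plus_real_closure.rep_eq times_real_closure.rep_eq)
qed (simp add: rc_eval_0)

text \<open>The field generated by an algebraic element is its ring of polynomial expressions: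
  run the Euclidean algorithm against the minimal polynomial.\<close>

lemma rc_eval_inverse:
  assumes m: "m \<noteq> 0" "rc_eval m w = 0" and min: "\<And>f. f \<noteq> 0 \<Longrightarrow> rc_eval f w = 0 \<Longrightarrow> degree m \<le> degree f"
    and "rc_eval f w \<noteq> 0"
  shows "\<exists>g. rc_eval g w = inverse (rc_eval f w)"
proof -
  have *: "\<exists>g. rc_eval g w = inverse (rc_eval f w)" if "rc_eval f w \<noteq> 0" "degree f < degree m" for f
    using that
  proof (induction "degree f" arbitrary: f rule: less_induct)
    case less
    have f0: "f \<noteq> 0" using less.prems rc_eval_0 by auto
    show ?case
    proof (cases "degree f = 0")
      case True
      then obtain c where "f = [:c:]" by (auto elim: degree_eq_zeroE)
      then have "rc_eval [:inverse c:] w = inverse (rc_eval f w)"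
        by (simp add: rc_eval_const inverse_real_closure.rep_eq)
      then show ?thesis by blast
    next
      case False
      define q r where "q = m div f" "r = m mod f"
      have eq: "m = q * f + r" by (simp add: q_r_def)
      then have ev: "rc_eval q w * rc_eval f w + rc_eval r w = 0" using m(2)
        by (metis rc_eval_add rc_eval_mult)
      \<comment> \<open>Otherwise \<open>f\<close> divides \<open>m\<close>, and the cofactor is a
        polynomial of smaller degree vanishing at \<open>w\<close>.\<close>
      have "r \<noteq> 0"
      proof
        assume "r = 0"
        then have mq: "m = q * f" "rc_eval q w = 0" using eq ev less.prems by (auto simp: rc_eval_0)
        then have "q \<noteq> 0" using m by auto
        then have "degree m = degree q + degree f" using f0 mq by (simp add: degree_mult_eq)
        then show False using min[OF \<open>q \<noteq> 0\<close> mq(2)] False by simp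
      qed
      then have dr: "degree r < degree f" using degree_mod_less'[OF f0] unfolding q_r_def by auto
      then have r: "rc_eval r w \<noteq> 0" using min[of r] \<open>r \<noteq> 0\<close> less.prems by fastforce
      then obtain g where g: "rc_eval g w = inverse (rc_eval r w)" using less.hyps[OF dr] dr less.prems by auto
      \<comment> \<open>At \<open>w\<close> the division says \<open>q * f = - r\<close>, so
        \<open>- q / r\<close> inverts \<open>f\<close>; the inverse of \<open>r\<close> comes from
        the induction hypothesis.\<close>
      have "rc_eval (- (q * g)) w * rc_eval f w = - (rc_eval q w * rc_eval f w) * inverse (rc_eval r w)"
        by (simp add: rc_eval_mult rc_eval_minus g)
      also have "\<dots> = rc_eval r w * inverse (rc_eval r w)"
        using ev by (metis add.commute eq_neg_iff_add_eq_0)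
      finally have "rc_eval (- (q * g)) w * rc_eval f w = 1" using r by simp
      then have "rc_eval (- (q * g)) w = inverse (rc_eval f w)" by (metis inverse_unique inverse_inverse_eq mult.commute)
      then show ?thesis by blast
    qed
  qed
  have "degree m > 0"
  proof (rule ccontr)
    assume "\<not> degree m > 0"
    then obtain c where "m = [:c:]" by (auto elim: degree_eq_zeroE)
    then show False using m by (simp add: rc_eval_const Rep_rc_eq_0_iff)
  qed
  then have "degree (f mod m) < degree m" using degree_mod_less[OF m(1), of f] by auto
  moreover have "rc_eval (f mod m) w = rc_eval f w"
    using rc_eval_add[of "f div m * m" "f mod m" w] m(2) by (simp add: rc_eval_mult)
  ultimately show ?thesis using *[of "f mod m"] assms(4) by simp
qed

text \<open>The cone from \<open>prime_cone_root\<close> orders a root field of \<open>p\<close>.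
  Realized inside the algebraic closure as a cone \<open>Q\<close>, this ordering extends
  \<open>maximal_cone\<close>, hence equals it by maximality, so the adjoined root already belongs
  to the real closure.\<close>

lemma real_closure_root:
  fixes p :: "'a::linordered_field real_closure poly"
  assumes "poly p a * poly p b < 0"
  shows "\<exists>w. poly p w = 0"
proof -
  obtain P where P: "prime_cone P" "p \<in> P" "-p \<in> P" "\<And>c. c \<ge> 0 \<Longrightarrow> [:c:] \<in> P"
    using prime_cone_root[OF assms] by blast
  have pc: "precone P" and m1: "-1 \<notin> P" and total: "\<And>f. f \<in> P \<or> -f \<in> P"
    using P(1) by (auto simp: prime_cone_def)
  define I where "I = {f. f \<in> P \<and> - f \<in> P}"
  have I_prime: "f \<in> I \<or> g \<in> I" if "f * g \<in> I" for f g
    using that P(1) by (auto simp: prime_cone_def I_def)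
  have I_add: "f + g \<in> I" if "f \<in> I" "g \<in> I" for f g
    using that cone_add[OF pc, of f g] cone_add[OF pc, of "-f" "-g"] by (auto simp: I_def)
  have I_mult: "f * g \<in> I" if "f \<in> I" for f g
    using that total[of g] cone_mult[OF pc, of f g] cone_mult[OF pc, of "-f" "-g"]
      cone_mult[OF pc, of f "-g"] cone_mult[OF pc, of "-f" "g"] by (auto simp: I_def)
  have p0: "p \<in> I" "p \<noteq> 0" using P assms by (auto simp: I_def)
  obtain p0 where p0: "p0 \<in> I" "p0 \<noteq> 0" and p0_min: "\<And>f. f \<in> I \<Longrightarrow> f \<noteq> 0 \<Longrightarrow> degree p0 \<le> degree f"
    using ex_has_least_nat[of "\<lambda>f. f \<in> I \<and> f \<noteq> 0" p degree] p0 by blast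
  have p0_dvd: "p0 dvd f" if "f \<in> I" for f
  proof (rule ccontr)
    assume "\<not> p0 dvd f"
    then have nz: "f mod p0 \<noteq> 0" by (simp add: dvd_eq_mod_eq_0)
    have "f mod p0 = f + p0 * (- (f div p0))" by (simp add: minus_mult_div_eq_mod [symmetric])
    then have "f mod p0 \<in> I" using I_add[OF that I_mult[OF p0(1)]] by metis
    then show False using p0_min nz degree_mod_less'[OF p0(2) nz] by fastforce
  qed
  have deg: "degree p0 > 0"
  proof (rule ccontr)
    assume "\<not> degree p0 > 0"
    then obtain c where "p0 = [:c:]" by (auto elim: degree_eq_zeroE)
    then have "p0 * [:inverse c:] = 1" using p0 by (simp add: one_pCons)
    then have "1 \<in> I" using I_mult[OF p0(1)] by metis
    then show False using m1 by (simp add: I_def)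
  qed
  have "degree (map_poly Rep_real_closure p0) = degree p0"
    by (intro degree_map_poly) (simp add: Rep_rc_eq_0_iff)
  then obtain w where w: "rc_eval p0 w = 0"
    using alg_closed_imp_poly_has_root[of "map_poly Rep_real_closure p0"] deg unfolding rc_eval_def by auto
  \<comment> \<open>\<open>m\<close> is a minimal polynomial of \<open>w\<close>. It turns out to
    generate \<open>I\<close> as well: it divides \<open>p0\<close>, and the cofactor has too small
    a degree to lie in the prime ideal \<open>I\<close>. So \<open>I\<close> is the kernel of
    evaluation at \<open>w\<close>.\<close>
  obtain m where m: "rc_eval m w = 0" "m \<noteq> 0"
    and m_min: "\<And>f. f \<noteq> 0 \<Longrightarrow> rc_eval f w = 0 \<Longrightarrow> degree m \<le> degree f"
    using ex_has_least_nat[of "\<lambda>f. rc_eval f w = 0 \<and> f \<noteq> 0" p0 degree] p0 w by blast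
  have m_dvd: "m dvd f" if "rc_eval f w = 0" for f
  proof (rule ccontr)
    assume "\<not> m dvd f"
    then have nz: "f mod m \<noteq> 0" by (simp add: dvd_eq_mod_eq_0)
    have "rc_eval (f mod m) w = 0"
      using that m(1) by (simp add: minus_mult_div_eq_mod [symmetric] rc_eval_diff rc_eval_mult)
    then show False using m_min[OF nz] degree_mod_less'[OF m(2) nz] by simp
  qed
  have mI: "m \<in> I"
  proof -
    obtain k where k: "p0 = m * k" using m_dvd[OF w] by (auto simp: dvd_def)
    then have "k \<noteq> 0" using p0 by auto
    have "k \<notin> I"
    proof
      assume "k \<in> I"
      then have "degree p0 \<le> degree k" using p0_min \<open>k \<noteq> 0\<close> by blast
      then have "degree m = 0" using k m(2) \<open>k \<noteq> 0\<close> by (simp add: degree_mult_eq)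
      then obtain c where "m = [:c:]" by (auto elim: degree_eq_zeroE)
      then show False using m by (simp add: rc_eval_const Rep_rc_eq_0_iff)
    qed
    then show ?thesis using I_prime p0(1) k by blast
  qed
  have I_iff: "f \<in> I \<longleftrightarrow> rc_eval f w = 0" for f
  proof
    assume "f \<in> I"
    then obtain k where "f = p0 * k" using p0_dvd unfolding dvd_def by blast
    then show "rc_eval f w = 0" using w by (simp add: rc_eval_mult)
  next
    assume "rc_eval f w = 0"
    then show "f \<in> I" using m_dvd I_mult[OF mI] by (auto simp: dvd_def)
  qed
  define Q where "Q = (\<lambda>f. rc_eval f w) ` P"
  have QI: "rc_eval f w \<in> Q" if "f \<in> P" for f using that by (auto simp: Q_def)
  have "ordered_subfield Q" unfolding ordered_subfield_def
  proof (intro conjI ballI allI impI)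
    fix c :: 'a assume "c \<ge> 0"
    then have "[:to_rc c:] \<in> P" by (intro P to_rc_nonneg)
    then have "rc_eval [:to_rc c:] w \<in> Q" by (rule QI)
    then show "to_ac c \<in> Q" by (simp add: rc_eval_const to_rc.rep_eq)
  next
    fix x y assume "x \<in> Q" "y \<in> Q"
    then obtain f g where h: "f \<in> P" "g \<in> P" "x = rc_eval f w" "y = rc_eval g w" by (auto simp: Q_def)
    show "x + y \<in> Q" "x * y \<in> Q"
      using QI[OF cone_add[OF pc h(1,2)]] QI[OF cone_mult[OF pc h(1,2)]]
      by (auto simp: h rc_eval_add rc_eval_mult)
    show "x - y \<in> Q \<or> y - x \<in> Q"
      using total[of "f - g"] QI[of "f - g"] QI[of "g - f"] by (auto simp: h rc_eval_diff)
  next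
    fix x assume "x \<in> Q"
    then obtain f where f: "f \<in> P" "x = rc_eval f w" by (auto simp: Q_def)
    show "inverse x \<in> Q"
    proof (cases "x = 0")
      case True then show ?thesis using \<open>x \<in> Q\<close> by simp
    next
      case False
      then obtain g where g: "rc_eval g w = inverse x"
        using rc_eval_inverse[OF m(2,1) m_min] f by blast
      \<comment> \<open>An inverse is the element times the square of its inverse, so it stays in
        the cone.\<close>
      have "f * (g * g) \<in> P" using f by (intro cone_mult[OF pc] cone_square[OF pc])
      then have "rc_eval (f * (g * g)) w \<in> Q" by (rule QI)
      moreover have "x * (inverse x * inverse x) = inverse x" using False by (simp flip: mult.assoc)
      ultimately show ?thesis by (simp add: rc_eval_mult g f(2)[symmetric])
    qed
  next
    fix x assume "x \<in> Q \<and> - x \<in> Q"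
    then obtain f g where h: "f \<in> P" "g \<in> P" "x = rc_eval f w" "- x = rc_eval g w" by (auto simp: Q_def)
    have "rc_eval (f + g) w = x + - x" by (simp only: rc_eval_add h(3)[symmetric] h(4)[symmetric])
    then have "f + g \<in> I" using I_iff by simp
    then have "- (f + g) \<in> P" unfolding I_def by blast
    \<comment> \<open>\<open>- f\<close> equals \<open>g - (f + g)\<close>, and \<open>f + g\<close>
      lies in the support.\<close>
    then have "g + - (f + g) \<in> P" using h cone_add[OF pc] by blast
    then have "f \<in> I" using h(1) by (simp add: I_def)
    then show "x = 0" using I_iff h(3) by simp
  qed
  moreover have "maximal_cone \<subseteq> Q"
  proof
    fix x :: "'a alg_closure" assume x: "x \<in> maximal_cone"
    define c where "c = Abs_real_closure x"
    have c: "Rep_real_closure c = x" unfolding c_def using x by (intro Abs_real_closure_inverse) simp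
    then have "c \<ge> 0" using x by (simp add: less_eq_real_closure.rep_eq)
    then show "x \<in> Q" using QI[OF P(4)[of c]] c by (simp add: rc_eval_const)
  qed
  ultimately have Q: "Q = maximal_cone" by (rule maximal_cone_maximal)
  \<comment> \<open>The variable or its negative lies in \<open>P\<close>, and its value is
    \<open>w\<close>.\<close>
  have "w \<in> maximal_cone \<or> - w \<in> maximal_cone"
    using total[of "[:0, 1:]"] QI[of "[:0, 1:]"] QI[of "- [:0, 1:]"] unfolding Q by (auto simp: rc_eval_x rc_eval_minus simp del: minus_pCons)
  then have rw: "Rep_real_closure (Abs_real_closure w) = w" by (intro Abs_real_closure_inverse) simp
  have "rc_eval p w = 0" using I_iff P by (auto simp: I_def)
  then have "poly p (Abs_real_closure w) = 0" using rc_eval_Rep[of p "Abs_real_closure w"] rw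
    by (simp add: Rep_rc_eq_0_iff)
  then show ?thesis by blast
qed

text \<open>The root found may lie outside the interval. Its linear factor then has the same sign at
  both end points, so the cofactor still changes sign and has smaller degree.\<close>

theorem real_closure_IVT:
  fixes p :: "'a::linordered_field real_closure poly"
  assumes "a < b" "poly p a * poly p b < 0"
  shows "\<exists>w. a < w \<and> w < b \<and> poly p w = 0"
  using assms(2)
proof (induction "degree p" arbitrary: p rule: less_induct)
  case less
  obtain w where w: "poly p w = 0" using real_closure_root[OF less.prems] by blast
  show ?case
  proof (cases "a < w \<and> w < b")
    case True then show ?thesis using w by blast
  next
    case False
    have "w \<noteq> a" "w \<noteq> b" using w less.prems by auto
    then have out: "(a - w) * (b - w) > 0" using False \<open>a < b\<close>
      by (cases "w < a") (auto intro: mult_pos_pos mult_neg_neg)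
    obtain q where q: "p = [:-w, 1:] * q" using w by (auto simp: poly_eq_0_iff_dvd dvd_def)
    then have "q \<noteq> 0" using less.prems by auto
    then have "degree q < degree p" unfolding q by (subst degree_mult_eq) auto
    moreover have "poly p a * poly p b = ((a - w) * (b - w)) * (poly q a * poly q b)"
      by (simp add: q algebra_simps)
    then have "poly q a * poly q b < 0" using less.prems out
      by (metis mult_less_0_iff less_asym)
    ultimately obtain v where "a < v" "v < b" "poly q v = 0" using less.hyps by blast
    then show ?thesis unfolding q by auto
  qed
qed

section \<open>Local homomorphisms from a real closed field to the reals\<close>

definition same_sign :: "real \<Rightarrow> 'r::linordered_field \<Rightarrow> bool" where
  "same_sign u x \<longleftrightarrow> (u > 0 \<longleftrightarrow> x > 0) \<and> (u < 0 \<longleftrightarrow> x < 0)"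

definition coeffs_in :: "'r::zero set \<Rightarrow> 'r poly \<Rightarrow> bool" where
  "coeffs_in A p \<longleftrightarrow> (\<forall>i. coeff p i \<in> A)"

text \<open>Intermediate values for polynomials express that the field is real closed. That
  \<open>\<iota>\<close> preserves the order is a consequence, as positive reals are
  squares.\<close>

locale real_closed_ext =
  fixes \<iota> :: "real \<Rightarrow> 'r::linordered_field"
  assumes \<iota>_add: "\<iota> (x + y) = \<iota> x + \<iota> y"
    and \<iota>_mult: "\<iota> (x * y) = \<iota> x * \<iota> y"
    and \<iota>_1: "\<iota> 1 = 1"
    and IVT: "a < b \<Longrightarrow> poly (p :: 'r poly) a * poly p b < 0 \<Longrightarrow> \<exists>w. a < w \<and> w < b \<and> poly p w = 0"
begin

lemma \<iota>_0: "\<iota> 0 = 0" using \<iota>_add[of 0 0] by simp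
lemma \<iota>_minus: "\<iota> (- x) = - \<iota> x" using \<iota>_add[of x "-x"] by (simp add: \<iota>_0 eq_neg_iff_add_eq_0 add.commute)
lemma \<iota>_inverse: "\<iota> (inverse x) = inverse (\<iota> x)"
proof (cases "x = 0")
  case False
  then have "\<iota> x * \<iota> (inverse x) = 1" using \<iota>_mult[of x "inverse x"] \<iota>_1 by simp
  then show ?thesis by (metis inverse_unique)
qed (simp add: \<iota>_0)
lemma \<iota>_of_nat: "\<iota> (of_nat n) = of_nat n"
  by (induction n) (simp_all add: \<iota>_0 \<iota>_add \<iota>_1)
lemma \<iota>_pos: "x > 0 \<Longrightarrow> \<iota> x > 0"
proof -
  assume "x > 0"
  then have "\<iota> x = \<iota> (sqrt x) * \<iota> (sqrt x)" "\<iota> x * \<iota> (inverse x) = 1"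
    by (simp_all add: \<iota>_1 flip: \<iota>_mult)
  then have "\<iota> x \<ge> 0" "\<iota> x \<noteq> 0" by (metis zero_le_square, metis mult_zero_left zero_neq_one)
  then show ?thesis by simp
qed
lemma inj_\<iota>: "inj \<iota>"
proof (rule injI)
  fix x y assume "\<iota> x = \<iota> y"
  then have "\<iota> (x - y) = 0" "\<iota> (y - x) = 0" using \<iota>_add[of x "-y"] \<iota>_add[of y "-x"] by (simp_all add: \<iota>_minus)
  then show "x = y" using \<iota>_pos[of "x - y"] \<iota>_pos[of "y - x"] by (cases x y rule: linorder_cases) auto
qed

definition sfield :: "'r set \<Rightarrow> bool" where
  "sfield A \<longleftrightarrow> range \<iota> \<subseteq> A \<and> (\<forall>x\<in>A. \<forall>y\<in>A. x + y \<in> A \<and> x * y \<in> A) \<and> (\<forall>x\<in>A. - x \<in> A \<and> inverse x \<in> A)"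

text \<open>\<open>E\<close> stands for a finite set that is not closed under arithmetic: the laws
  concern pairs from \<open>E\<close>, while their sums and products may lie outside it.\<close>

definition local_hom :: "'r set \<Rightarrow> ('r \<Rightarrow> real) \<Rightarrow> bool" where
  "local_hom E \<phi> \<longleftrightarrow> (\<forall>x\<in>E. \<forall>y\<in>E. \<phi> (x + y) = \<phi> x + \<phi> y \<and> \<phi> (x * y) = \<phi> x * \<phi> y) \<and>
     (\<forall>x\<in>E. x > 0 \<longrightarrow> \<phi> x > 0) \<and> (\<forall>r. \<iota> r \<in> E \<longrightarrow> \<phi> (\<iota> r) = r)"

definition good :: "'r set \<Rightarrow> bool" where
  "good A \<longleftrightarrow> sfield A \<and> (\<forall>E. finite E \<longrightarrow> E \<subseteq> A \<longrightarrow> (\<exists>\<phi>. local_hom E \<phi>))"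

text \<open>Along this filter a property holds if some finite subset of \<open>A\<close> suffices to
  enforce it. Any finite number of identities and inequalities valid in \<open>A\<close> therefore
  passes to \<open>\<phi>\<close>, although no single \<open>\<phi>\<close> need be a homomorphism
  on \<open>A\<close>.\<close>

definition near :: "'r set \<Rightarrow> ('r \<Rightarrow> real) filter" where
  "near A = (INF E\<in>{E. finite E \<and> E \<subseteq> A}. principal {\<phi>. local_hom E \<phi>})"

lemma local_hom_mono: "local_hom E \<phi> \<Longrightarrow> F \<subseteq> E \<Longrightarrow> local_hom F \<phi>"
  unfolding local_hom_def by blast

lemma eventually_near: "eventually P (near A) \<longleftrightarrow> (\<exists>E. finite E \<and> E \<subseteq> A \<and> (\<forall>\<phi>. local_hom E \<phi> \<longrightarrow> P \<phi>))"
proof -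
  have "eventually P (near A) \<longleftrightarrow> (\<exists>E\<in>{E. finite E \<and> E \<subseteq> A}. eventually P (principal {\<phi>. local_hom E \<phi>}))"
    unfolding near_def
  proof (rule eventually_INF_base)
    show "{E. finite E \<and> E \<subseteq> A} \<noteq> {}" by blast
    fix E F assume "E \<in> {E. finite E \<and> E \<subseteq> A}" "F \<in> {E. finite E \<and> E \<subseteq> A}"
    then show "\<exists>G\<in>{E. finite E \<and> E \<subseteq> A}. principal {\<phi>. local_hom G \<phi>} \<le> inf (principal {\<phi>. local_hom E \<phi>}) (principal {\<phi>. local_hom F \<phi>})"
      by (intro bexI[of _ "E \<union> F"]) (auto intro: local_hom_mono)
  qed
  then show ?thesis by (auto simp: eventually_principal)
qed

lemma good_near: "good A \<Longrightarrow> near A \<noteq> bot"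
  unfolding trivial_limit_def eventually_near good_def by blast

lemma sfieldD:
  assumes "sfield A"
  shows "\<iota> r \<in> A" "0 \<in> A" "1 \<in> A" "x \<in> A \<Longrightarrow> y \<in> A \<Longrightarrow> x + y \<in> A" "x \<in> A \<Longrightarrow> y \<in> A \<Longrightarrow> x * y \<in> A"
    "x \<in> A \<Longrightarrow> - x \<in> A" "x \<in> A \<Longrightarrow> inverse x \<in> A" "x \<in> A \<Longrightarrow> y \<in> A \<Longrightarrow> x - y \<in> A"
    "x \<in> A \<Longrightarrow> y \<in> A \<Longrightarrow> x / y \<in> A"
proof -
  have a: "range \<iota> \<subseteq> A" "\<And>x y. x \<in> A \<Longrightarrow> y \<in> A \<Longrightarrow> x + y \<in> A" "\<And>x y. x \<in> A \<Longrightarrow> y \<in> A \<Longrightarrow> x * y \<in> A"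
    "\<And>x. x \<in> A \<Longrightarrow> - x \<in> A" "\<And>x. x \<in> A \<Longrightarrow> inverse x \<in> A"
    using assms unfolding sfield_def by blast+
  show "\<iota> r \<in> A" "0 \<in> A" "1 \<in> A" using a(1) \<iota>_0 \<iota>_1 by (auto simp: image_subset_iff) (metis, metis)
  show "x \<in> A \<Longrightarrow> y \<in> A \<Longrightarrow> x + y \<in> A" "x \<in> A \<Longrightarrow> y \<in> A \<Longrightarrow> x * y \<in> A"
    "x \<in> A \<Longrightarrow> - x \<in> A" "x \<in> A \<Longrightarrow> inverse x \<in> A" using a by auto
  show "x \<in> A \<Longrightarrow> y \<in> A \<Longrightarrow> x - y \<in> A" using a(2)[of x "-y"] a(4) by simp
  show "x \<in> A \<Longrightarrow> y \<in> A \<Longrightarrow> x / y \<in> A" using a(3)[of x "inverse y"] a(5) by (simp add: divide_inverse)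
qed

lemma sfield_sum: "sfield A \<Longrightarrow> (\<And>i. i \<in> I \<Longrightarrow> f i \<in> A) \<Longrightarrow> sum f I \<in> A"
  by (induction I rule: infinite_finite_induct) (auto intro: sfieldD)

lemma sfield_of_nat: "sfield A \<Longrightarrow> of_nat n \<in> A"
  using sfieldD(1)[of A "of_nat n"] by (simp add: \<iota>_of_nat)

lemma coeffs_in_poly_ops:
  assumes "sfield A"
  shows "coeffs_in A 0" "coeffs_in A 1" "a \<in> A \<Longrightarrow> coeffs_in A [:a:]" "coeffs_in A [:0, 1:]"
    "coeffs_in A p \<Longrightarrow> coeffs_in A q \<Longrightarrow> coeffs_in A (p + q)"
    "coeffs_in A p \<Longrightarrow> coeffs_in A q \<Longrightarrow> coeffs_in A (p - q)"
    "coeffs_in A p \<Longrightarrow> coeffs_in A q \<Longrightarrow> coeffs_in A (p * q)"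
    "coeffs_in A p \<Longrightarrow> coeffs_in A (- p)"
    "coeffs_in A p \<Longrightarrow> coeffs_in A (pderiv p)"
    "coeffs_in A p \<Longrightarrow> coeffs_in A (reflect_poly p)"
    "a \<in> A \<Longrightarrow> coeffs_in A (monom a n)"
  unfolding coeffs_in_def
  by (auto simp: coeff_pCons coeff_1 coeff_mult coeff_pderiv coeff_reflect_poly coeff_monom simp del: of_nat_Suc split: nat.split
      intro!: sfieldD(2-)[OF assms] sfield_sum[OF assms] sfield_of_nat[OF assms])

lemma coeffs_in_poly:
  assumes "sfield A" "coeffs_in A p" "x \<in> A"
  shows "poly p x \<in> A"
  using assms(2)
proof (induction p)
  case (pCons a p)
  have "a \<in> A" "coeffs_in A p" using pCons.prems unfolding coeffs_in_def
    by (metis coeff_pCons_0, metis coeff_pCons_Suc)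
  then show ?case using pCons.IH assms(3) by (auto intro!: sfieldD[OF assms(1)])
qed (simp add: sfieldD[OF assms(1)])

text \<open>The leading terms are cancelled explicitly, so that quotient and remainder can be seen
  to keep their coefficients in the subfield \<open>A\<close>.\<close>

lemma coeffs_in_division:
  assumes A: "sfield A" and p: "coeffs_in A p" "p \<noteq> 0" and q: "coeffs_in A q"
  shows "\<exists>u r. coeffs_in A u \<and> coeffs_in A r \<and> q = u * p + r \<and> (r = 0 \<or> degree r < degree p)"
  using q
proof (induction "degree q" arbitrary: q rule: less_induct)
  case less
  show ?case
  proof (cases "q = 0 \<or> degree q < degree p")
    case True
    then show ?thesis using less.prems coeffs_in_poly_ops(1)[OF A] by (intro exI[of _ 0] exI[of _ q]) auto
  next
    case False
    define k where "k = monom (lead_coeff q / lead_coeff p) (degree q - degree p)"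
    have k: "coeffs_in A k" unfolding k_def using less.prems p
      by (intro coeffs_in_poly_ops[OF A] sfieldD[OF A]) (auto simp: coeffs_in_def)
    define q' where "q' = q - k * p"
    have q': "coeffs_in A q'" unfolding q'_def using k p less.prems by (intro coeffs_in_poly_ops[OF A])
    have dk: "degree (k * p) = degree q"
      using False p(2) unfolding k_def by (auto simp: degree_mult_eq degree_monom_eq monom_eq_0_iff)
    moreover have "lead_coeff (k * p) = lead_coeff q"
      using p(2) unfolding k_def lead_coeff_mult by (cases "q = 0") (auto simp: degree_monom_eq)
    ultimately have lc: "coeff (k * p) (degree q) = lead_coeff q" by metis
    \<comment> \<open>For a constant \<open>q\<close> the degree cannot drop further, and the
      cancellation leaves zero.\<close>
    have "q' = 0 \<or> degree q' < degree q"
    proof (cases "degree q = 0")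
      case True
      have "coeff q' i = 0" for i
        using True dk lc unfolding q'_def by (cases "i = 0") (auto simp: coeff_eq_0)
      then show ?thesis by (simp add: poly_eq_iff)
    next
      case nz: False
      have "degree q' \<le> degree q" unfolding q'_def using dk by (intro degree_diff_le) auto
      moreover have "coeff q' (degree q) = 0" unfolding q'_def using lc by simp
      ultimately show ?thesis by (metis le_neq_implies_less leading_coeff_0_iff)
    qed
    then consider "q' = 0" | "degree q' < degree q" by blast
    then obtain u r where ur: "coeffs_in A u" "coeffs_in A r" "q' = u * p + r" "r = 0 \<or> degree r < degree p"
    proof cases
      case 1
      then show ?thesis using that[of 0 0] coeffs_in_poly_ops(1)[OF A] by simp
    next
      case 2
      then show ?thesis using less.hyps[OF 2 q'] that by blast
    qed
    then have "q = (u + k) * p + r" by (simp add: q'_def algebra_simps)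
    then show ?thesis using ur k coeffs_in_poly_ops(5)[OF A] by blast
  qed
qed

section \<open>Arithmetic respected eventually along the filter\<close>

lemma ev_add: "x \<in> A \<Longrightarrow> y \<in> A \<Longrightarrow> \<forall>\<^sub>F \<phi> in near A. \<phi> (x + y) = \<phi> x + \<phi> y"
  and ev_mult: "x \<in> A \<Longrightarrow> y \<in> A \<Longrightarrow> \<forall>\<^sub>F \<phi> in near A. \<phi> (x * y) = \<phi> x * \<phi> y"
  unfolding eventually_near by (intro exI[of _ "{x, y}"]; simp add: local_hom_def)+

lemma ev_pos: "x \<in> A \<Longrightarrow> x > 0 \<Longrightarrow> \<forall>\<^sub>F \<phi> in near A. \<phi> x > 0"
  unfolding eventually_near by (intro exI[of _ "{x}"]) (simp add: local_hom_def)

lemma ev_\<iota>: "\<iota> r \<in> A \<Longrightarrow> \<forall>\<^sub>F \<phi> in near A. \<phi> (\<iota> r) = r"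
  unfolding eventually_near by (intro exI[of _ "{\<iota> r}"]) (auto simp: local_hom_def)

context
  fixes A assumes A: "sfield A"
begin

lemma ev_0: "\<forall>\<^sub>F \<phi> in near A. \<phi> 0 = 0" and ev_1: "\<forall>\<^sub>F \<phi> in near A. \<phi> 1 = 1"
  using ev_\<iota>[of 0 A] ev_\<iota>[of 1 A] sfieldD(1-3)[OF A] by (simp_all add: \<iota>_0 \<iota>_1)

lemma ev_minus: "x \<in> A \<Longrightarrow> \<forall>\<^sub>F \<phi> in near A. \<phi> (- x) = - \<phi> x"
  using eventually_conj[OF ev_add[of x A "-x"] ev_0] sfieldD(6)[OF A]
  by (auto elim!: eventually_mono)

lemma ev_diff: "x \<in> A \<Longrightarrow> y \<in> A \<Longrightarrow> \<forall>\<^sub>F \<phi> in near A. \<phi> (x - y) = \<phi> x - \<phi> y"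
  using eventually_conj[OF ev_add[of x A "-y"] ev_minus[of y]] sfieldD(6)[OF A]
  by (auto elim!: eventually_mono)

lemma ev_same_sign: 
  assumes "x \<in> A" shows "\<forall>\<^sub>F \<phi> in near A. same_sign (\<phi> x) x"
proof -
  consider "x > 0" | "x = 0" | "x < 0" by fastforce
  then show ?thesis
  proof cases
    case 1
    then show ?thesis using ev_pos[OF assms] by (auto simp: same_sign_def elim!: eventually_mono)
  next
    case 2
    then show ?thesis using ev_0 by (auto simp: same_sign_def elim!: eventually_mono)
  next
    case 3
    then have "\<forall>\<^sub>F \<phi> in near A. \<phi> (- x) > 0" using ev_pos[OF sfieldD(6)[OF A assms]] by simp
    then show ?thesis using ev_minus[OF assms]
      by eventually_elim (use 3 in \<open>auto simp: same_sign_def\<close>)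
  qed
qed

lemma ev_less: "x \<in> A \<Longrightarrow> y \<in> A \<Longrightarrow> x < y \<Longrightarrow> \<forall>\<^sub>F \<phi> in near A. \<phi> x < \<phi> y"
  using eventually_conj[OF ev_diff[of y x] ev_pos[of "y - x" A]] sfieldD(8)[OF A]
  by (auto elim!: eventually_mono)

lemma ev_sum:
  assumes "finite I" "\<And>i. i \<in> I \<Longrightarrow> f i \<in> A"
  shows "\<forall>\<^sub>F \<phi> in near A. \<phi> (sum f I) = (\<Sum>i\<in>I. \<phi> (f i))"
  using assms
proof (induction I)
  case empty then show ?case using ev_0 by simp
next
  case (insert i I)
  have "\<forall>\<^sub>F \<phi> in near A. \<phi> (f i + sum f I) = \<phi> (f i) + \<phi> (sum f I)"
    using insert by (intro ev_add sfield_sum[OF A]) auto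
  moreover have "\<forall>\<^sub>F \<phi> in near A. \<phi> (sum f I) = (\<Sum>i\<in>I. \<phi> (f i))" using insert by auto
  ultimately show ?case by eventually_elim (use insert(1,2) in simp)
qed

text \<open>Eventual statements combine only finitely many at a time, so the coefficients are
  compared up to a bound independent of \<open>\<phi>\<close>; beyond it both sides vanish.\<close>

lemma ev_map_poly_eq:
  assumes "\<And>i. \<forall>\<^sub>F \<phi> in near A. \<phi> (coeff p i) = coeff (F \<phi>) i"
    and "\<forall>\<^sub>F \<phi> in near A. \<forall>i>n. coeff (F \<phi>) i = 0"
  shows "\<forall>\<^sub>F \<phi> in near A. map_poly \<phi> p = F \<phi>"
proof -
  have "\<forall>\<^sub>F \<phi> in near A. \<forall>i\<in>{..n + degree p}. \<phi> (coeff p i) = coeff (F \<phi>) i"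
    using assms by (intro eventually_ball_finite) auto
  then show ?thesis using ev_0 assms(2)
  proof eventually_elim
    case (elim \<phi>)
    show ?case
    proof (rule poly_eqI)
      fix i
      show "coeff (map_poly \<phi> p) i = coeff (F \<phi>) i"
      proof (cases "i \<le> n + degree p")
        case True then show ?thesis using elim by (simp add: coeff_map_poly)
      next
        case False then show ?thesis using elim by (simp add: coeff_map_poly coeff_eq_0)
      qed
    qed
  qed
qed

lemma coeff_map_poly_big: "\<phi> 0 = 0 \<Longrightarrow> i > degree p \<Longrightarrow> coeff (map_poly \<phi> p) i = 0"
  by (simp add: coeff_map_poly coeff_eq_0)

lemma ev_map_poly_add:
  assumes "coeffs_in A p" "coeffs_in A q"
  shows "\<forall>\<^sub>F \<phi> in near A. map_poly \<phi> (p + q) = map_poly \<phi> p + map_poly \<phi> q"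
proof (rule ev_map_poly_eq)
  fix i
  show "\<forall>\<^sub>F \<phi> in near A. \<phi> (coeff (p + q) i) = coeff (map_poly \<phi> p + map_poly \<phi> q) i"
    using eventually_conj[OF ev_add[of "coeff p i" A "coeff q i"] ev_0] assms
    by (auto simp: coeffs_in_def coeff_map_poly elim!: eventually_mono)
  show "\<forall>\<^sub>F \<phi> in near A. \<forall>i>degree p + degree q. coeff (map_poly \<phi> p + map_poly \<phi> q) i = 0"
    using ev_0 by eventually_elim (simp add: coeff_map_poly_big)
qed

lemma ev_map_poly_minus:
  assumes "coeffs_in A p"
  shows "\<forall>\<^sub>F \<phi> in near A. map_poly \<phi> (- p) = - map_poly \<phi> p"
proof (rule ev_map_poly_eq)
  fix i
  show "\<forall>\<^sub>F \<phi> in near A. \<phi> (coeff (- p) i) = coeff (- map_poly \<phi> p) i"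
    using eventually_conj[OF ev_minus[of "coeff p i"] ev_0] assms
    by (auto simp: coeffs_in_def coeff_map_poly elim!: eventually_mono)
  show "\<forall>\<^sub>F \<phi> in near A. \<forall>i>degree p. coeff (- map_poly \<phi> p) i = 0"
    using ev_0 by eventually_elim (simp add: coeff_map_poly_big)
qed

lemma ev_map_poly_diff:
  assumes "coeffs_in A p" "coeffs_in A q"
  shows "\<forall>\<^sub>F \<phi> in near A. map_poly \<phi> (p - q) = map_poly \<phi> p - map_poly \<phi> q"
  using eventually_conj[OF ev_map_poly_add[of p "-q"] ev_map_poly_minus[of q]] coeffs_in_poly_ops(8)[OF A] assms
  by (auto elim!: eventually_mono)

lemma ev_map_poly_mult:
  assumes "coeffs_in A p" "coeffs_in A q"
  shows "\<forall>\<^sub>F \<phi> in near A. map_poly \<phi> (p * q) = map_poly \<phi> p * map_poly \<phi> q"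
proof (rule ev_map_poly_eq)
  fix i
  have "\<forall>\<^sub>F \<phi> in near A. \<phi> (coeff (p * q) i) = (\<Sum>j\<le>i. \<phi> (coeff p j * coeff q (i - j)))"
    unfolding coeff_mult using assms by (intro ev_sum sfieldD[OF A]) (auto simp: coeffs_in_def)
  moreover have "\<forall>\<^sub>F \<phi> in near A. \<forall>j\<in>{..i}. \<phi> (coeff p j * coeff q (i - j)) = \<phi> (coeff p j) * \<phi> (coeff q (i - j))"
    using assms by (intro eventually_ball_finite) (auto intro!: ev_mult simp: coeffs_in_def)
  ultimately show "\<forall>\<^sub>F \<phi> in near A. \<phi> (coeff (p * q) i) = coeff (map_poly \<phi> p * map_poly \<phi> q) i"
    using ev_0 by eventually_elim (simp add: coeff_mult coeff_map_poly)
  show "\<forall>\<^sub>F \<phi> in near A. \<forall>i>degree p + degree q. coeff (map_poly \<phi> p * map_poly \<phi> q) i = 0"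
    using ev_0
  proof eventually_elim
    case (elim \<phi>)
    have "degree (map_poly \<phi> p * map_poly \<phi> q) \<le> degree p + degree q"
      using degree_mult_le[of "map_poly \<phi> p" "map_poly \<phi> q"] map_poly_degree_leq[of \<phi> p] map_poly_degree_leq[of \<phi> q] elim by linarith
    then show ?case by (auto intro: coeff_eq_0)
  qed
qed

lemma ev_map_poly_pderiv:
  assumes "coeffs_in A p"
  shows "\<forall>\<^sub>F \<phi> in near A. map_poly \<phi> (pderiv p) = pderiv (map_poly \<phi> p)"
proof (rule ev_map_poly_eq)
  fix i
  have "\<forall>\<^sub>F \<phi> in near A. \<phi> (of_nat (Suc i) * coeff p (Suc i)) = \<phi> (of_nat (Suc i)) * \<phi> (coeff p (Suc i))"
    using assms by (intro ev_mult sfield_of_nat[OF A]) (auto simp: coeffs_in_def)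
  moreover have "\<forall>\<^sub>F \<phi> in near A. \<phi> (of_nat (Suc i)) = of_nat (Suc i)"
    using ev_\<iota>[of "of_nat (Suc i)" A, OF sfieldD(1)[OF A]] by (simp only: \<iota>_of_nat)
  ultimately show "\<forall>\<^sub>F \<phi> in near A. \<phi> (coeff (pderiv p) i) = coeff (pderiv (map_poly \<phi> p)) i"
    using ev_0 by eventually_elim (simp add: coeff_pderiv coeff_map_poly del: of_nat_Suc)
  show "\<forall>\<^sub>F \<phi> in near A. \<forall>i>degree p. coeff (pderiv (map_poly \<phi> p)) i = 0"
    using ev_0 by eventually_elim (simp add: coeff_pderiv coeff_map_poly_big del: of_nat_Suc)
qed

lemma ev_poly:
  assumes "coeffs_in A p" "x \<in> A"
  shows "\<forall>\<^sub>F \<phi> in near A. \<phi> (poly p x) = poly (map_poly \<phi> p) (\<phi> x)"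
  using assms(1)
proof (induction p)
  case 0 then show ?case using ev_0 by simp
next
  case (pCons a p)
  have a: "a \<in> A" "coeffs_in A p" using pCons.prems unfolding coeffs_in_def
    by (metis coeff_pCons_0, metis coeff_pCons_Suc)
  have "poly p x \<in> A" using coeffs_in_poly[OF A a(2) assms(2)] .
  then have "\<forall>\<^sub>F \<phi> in near A. \<phi> (a + x * poly p x) = \<phi> a + \<phi> (x * poly p x)"
     "\<forall>\<^sub>F \<phi> in near A. \<phi> (x * poly p x) = \<phi> x * \<phi> (poly p x)"
    using a assms(2) by (auto intro!: ev_add ev_mult sfieldD[OF A])
  then show ?case using pCons.IH[OF a(2)] ev_0 by eventually_elim (simp add: map_poly_pCons)
qed

lemma ev_poly_same_sign:
  assumes "coeffs_in A p" "x \<in> A"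
  shows "\<forall>\<^sub>F \<phi> in near A. same_sign (poly (map_poly \<phi> p) (\<phi> x)) (poly p x)"
  using ev_poly[OF assms] ev_same_sign[OF coeffs_in_poly[OF A assms]]
  by eventually_elim simp

end

end

section \<open>Sign changes and roots over a real closed field\<close>

lemma coeffs_in_pderiv_iter: 
  assumes "\<And>q. coeffs_in A q \<Longrightarrow> coeffs_in A (pderiv q)" "coeffs_in A q"
  shows "coeffs_in A ((pderiv ^^ k) q)"
  using assms by (induction k) auto

lemma pderiv_linear_mult:
  fixes g :: "'a::idom poly"
  shows "pderiv ([:-z, 1:] * g) = g + [:-z, 1:] * pderiv g"
  by (subst pderiv_mult) (simp add: pderiv_pCons)

context real_closed_ext begin

text \<open>The end points may themselves be roots, hence the weak inequalities.\<close>

lemma same_sign_between: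
  fixes q :: "'r poly"
  assumes "\<And>t. c < t \<Longrightarrow> t < d \<Longrightarrow> poly q t \<noteq> 0" "c < y" "y < d"
  shows "poly q y > 0 \<Longrightarrow> poly q c \<ge> 0 \<and> poly q d \<ge> 0" "poly q y < 0 \<Longrightarrow> poly q c \<le> 0 \<and> poly q d \<le> 0"
proof -
  have "\<not> poly q c * poly q y < 0"
  proof
    assume "poly q c * poly q y < 0"
    then obtain w where "c < w" "w < y" "poly q w = 0" using IVT[OF assms(2)] by blast
    then show False using assms(1)[of w] assms(3) by simp
  qed
  moreover have "\<not> poly q y * poly q d < 0"
  proof
    assume "poly q y * poly q d < 0"
    then obtain w where "y < w" "w < d" "poly q w = 0" using IVT[OF assms(3)] by blast
    then show False using assms(1)[of w] assms(2) by simp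
  qed
  ultimately show "poly q y > 0 \<Longrightarrow> poly q c \<ge> 0 \<and> poly q d \<ge> 0" "poly q y < 0 \<Longrightarrow> poly q c \<le> 0 \<and> poly q d \<le> 0"
    by (auto simp: mult_less_0_iff not_less)
qed

text \<open>For neighbouring roots \<open>a\<close> and \<open>m\<close> write \<open>p\<close> as
  \<open>(X - a) * (X - m) * g\<close>. The derivative is \<open>(a - m) * poly g a\<close> at
  \<open>a\<close> and \<open>(m - a) * poly g m\<close> at \<open>m\<close>, and \<open>g\<close>
  does not change sign between them, so the derivative either vanishes at one of the two roots or
  changes sign. The first case forces the closed interval.\<close>

lemma Rolle_closed:
  fixes p :: "'r poly"
  assumes "a < b" "poly p a = 0" "poly p b = 0" "p \<noteq> 0"
  shows "\<exists>t. a \<le> t \<and> t \<le> b \<and> poly (pderiv p) t = 0"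
proof -
  define Z where "Z = {t. poly p t = 0 \<and> a < t \<and> t \<le> b}"
  have fin: "finite Z" unfolding Z_def by (rule finite_subset[OF _ poly_roots_finite[OF assms(4)]]) auto
  have ne: "Z \<noteq> {}" using assms by (auto simp: Z_def)
  define m where "m = Min Z"
  have m: "poly p m = 0" "a < m" "m \<le> b" using Min_in[OF fin ne] by (auto simp: m_def Z_def)
  have no: "poly p t \<noteq> 0" if "a < t" "t < m" for t
  proof
    assume "poly p t = 0"
    then have "t \<in> Z" using that m by (auto simp: Z_def)
    then have "m \<le> t" unfolding m_def by (rule Min_le[OF fin])
    then show False using that by simp
  qed
  obtain g1 where g1: "p = [:-a, 1:] * g1" using assms(2) by (auto simp: poly_eq_0_iff_dvd dvd_def)
  then have "poly g1 m = 0" using m by auto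
  then obtain g where g: "g1 = [:-m, 1:] * g" by (auto simp: poly_eq_0_iff_dvd dvd_def)
  have p: "p = [:-a, 1:] * ([:-m, 1:] * g)" using g1 g by simp
  have dp: "poly (pderiv p) a = (a - m) * poly g a" "poly (pderiv p) m = (m - a) * poly g m"
    unfolding p pderiv_linear_mult by (simp_all add: algebra_simps)
  show ?thesis
  proof (cases "poly g a = 0 \<or> poly g m = 0")
    case True
    then show ?thesis using dp m \<open>a < b\<close> by (metis less_imp_le mult_zero_right order_refl)
  next
    case False
    have "\<not> poly g a * poly g m < 0"
    proof
      assume "poly g a * poly g m < 0"
      then obtain w where "a < w" "w < m" "poly g w = 0" using IVT[OF m(2)] by blast
      then show False using no[of w] by (simp add: p)
    qed
    then have "poly g a * poly g m > 0" using False by (simp add: not_less le_less)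
    moreover have "poly (pderiv p) a * poly (pderiv p) m = - ((m - a) * (m - a) * (poly g a * poly g m))"
      by (simp add: dp algebra_simps)
    ultimately have "poly (pderiv p) a * poly (pderiv p) m < 0" using m by simp
    then obtain w where "a < w" "w < m" "poly (pderiv p) w = 0" using IVT[OF m(2)] by blast
    then show ?thesis using m by (intro exI[of _ w]) auto
  qed
qed

text \<open>As the derivative does not vanish, \<open>z\<close> is a simple root. If
  \<open>p\<close> had the same sign at both ends, the cofactor \<open>g\<close> would change sign
  and give a second root, and Rolle would produce a zero of the derivative between the two.\<close>

lemma sign_change_at_root:
  fixes p :: "'r poly"
  assumes "c < z" "z < d" "poly p z = 0" "poly p c \<noteq> 0" "poly p d \<noteq> 0"
    and der: "\<And>t. c < t \<Longrightarrow> t < d \<Longrightarrow> poly (pderiv p) t \<noteq> 0"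
  shows "poly p c * poly p d < 0"
proof (rule ccontr)
  assume "\<not> ?thesis"
  then have pos: "poly p c * poly p d > 0" using assms by (simp add: not_less le_less)
  have "p \<noteq> 0" using assms by auto
  obtain g where g: "p = [:-z, 1:] * g" using assms(3) by (auto simp: poly_eq_0_iff_dvd dvd_def)
  have "poly (pderiv p) z = poly g z" unfolding g pderiv_linear_mult by simp
  then have gz: "poly g z \<noteq> 0" using der[OF assms(1,2)] by simp
  have "poly p c * poly p d = ((c - z) * (d - z)) * (poly g c * poly g d)"
    by (simp add: g algebra_simps)
  moreover have "(c - z) * (d - z) < 0" using assms by (simp add: mult_less_0_iff)
  ultimately have "poly g c * poly g d < 0" using pos by (metis mult_neg_pos mult_nonpos_nonneg not_less zero_less_mult_iff less_asym)
  then obtain v where v: "c < v" "v < d" "poly g v = 0" using IVT assms(1,2) less_trans by blast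
  then have "v \<noteq> z" "poly p v = 0" using gz by (auto simp: g)
  then have "\<exists>t. min v z \<le> t \<and> t \<le> max v z \<and> poly (pderiv p) t = 0"
    using Rolle_closed[of v z p] Rolle_closed[of z v p] assms(3) \<open>p \<noteq> 0\<close>
    by (cases v z rule: linorder_cases) (auto simp: min_def max_def)
  then obtain t where "min v z \<le> t" "t \<le> max v z" "poly (pderiv p) t = 0" by blast
  then show False using der[of t] v assms(1,2) by (auto simp: min_def max_def split: if_splits)
qed

text \<open>If no derivative of \<open>q\<close> vanishes between \<open>c\<close> and \<open>d\<close>, then the real specializations of
  \<open>q\<close> are monotone there (by induction their derivatives do not vanish), and their sign is
  determined by the endpoints.\<close>

lemma specialization_sign:
  assumes A: "sfield A" and "coeffs_in A q" and cd: "c \<in> A" "d \<in> A" "c < y" "y < d"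
    and "\<And>k t. (pderiv ^^ k) q \<noteq> 0 \<Longrightarrow> c < t \<Longrightarrow> t < d \<Longrightarrow> poly ((pderiv ^^ k) q) t \<noteq> 0"
  shows "\<forall>\<^sub>F \<phi> in near A. \<forall>t. \<phi> c < t \<longrightarrow> t < \<phi> d \<longrightarrow> same_sign (poly (map_poly \<phi> q) t) (poly q y)"
  using assms(2,7)
proof (induction "degree q" arbitrary: q rule: less_induct)
  case less
  show ?case
  proof (cases "degree q = 0")
    case True
    then obtain a where a: "q = [:a:]" by (auto elim: degree_eq_zeroE)
    then have "a \<in> A" using less.prems(1) unfolding coeffs_in_def by (metis coeff_pCons_0)
    from ev_same_sign[OF A this] ev_0[OF A] show ?thesis
      by eventually_elim (simp add: a map_poly_pCons)
  next
    case False
    define q' where "q' = pderiv q"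
    have q0: "q \<noteq> 0" and q'0: "q' \<noteq> 0" using False by (auto simp: q'_def pderiv_eq_0_iff)
    have q'A: "coeffs_in A q'" unfolding q'_def using less.prems(1) by (intro coeffs_in_poly_ops[OF A])
    have "degree q' < degree q" using False by (simp add: q'_def degree_pderiv)
    moreover have "poly ((pderiv ^^ k) q') t \<noteq> 0" if "(pderiv ^^ k) q' \<noteq> 0" "c < t" "t < d" for k t
      using less.prems(2)[of "Suc k" t] that unfolding q'_def by (simp add: funpow_swap1)
    ultimately have IH: "\<forall>\<^sub>F \<phi> in near A. \<forall>t. \<phi> c < t \<longrightarrow> t < \<phi> d \<longrightarrow> same_sign (poly (map_poly \<phi> q') t) (poly q' y)"
      using less.hyps q'A by blast
    have nz: "poly q t \<noteq> 0" "poly q' t \<noteq> 0" if "c < t" "t < d" for t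
      using less.prems(2)[of 0 t] less.prems(2)[of 1 t] that q0 q'0 by (auto simp: q'_def)
    have y: "poly q y \<noteq> 0" "poly q' y \<noteq> 0" using nz cd by auto
    note between = same_sign_between[of c d q y, OF nz(1) cd(3,4)]
    from IH ev_map_poly_pderiv[OF A less.prems(1)] ev_poly_same_sign[OF A less.prems(1) cd(1)]
      ev_poly_same_sign[OF A less.prems(1) cd(2)]
    show ?thesis
    proof eventually_elim
      case (elim \<phi>)
      define Q where "Q = map_poly \<phi> q"
      have der: "same_sign (poly (pderiv Q) t) (poly q' y)" if "\<phi> c < t" "t < \<phi> d" for t
        using elim(1,2) that by (simp add: Q_def q'_def)
      have s: "same_sign (poly Q (\<phi> c)) (poly q c)" "same_sign (poly Q (\<phi> d)) (poly q d)"
        using elim by (simp_all add: Q_def)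
      show ?case
      proof (intro allI impI)
        fix t :: real assume t: "\<phi> c < t" "t < \<phi> d"
        obtain \<xi> where \<xi>: "\<phi> c < \<xi>" "\<xi> < t" "poly Q t - poly Q (\<phi> c) = (t - \<phi> c) * poly (pderiv Q) \<xi>"
          using poly_MVT[OF t(1)] by blast
        obtain \<eta> where \<eta>: "t < \<eta>" "\<eta> < \<phi> d" "poly Q (\<phi> d) - poly Q t = (\<phi> d - t) * poly (pderiv Q) \<eta>"
          using poly_MVT[OF t(2)] by blast
        have d\<xi>: "same_sign (poly (pderiv Q) \<xi>) (poly q' y)" and d\<eta>: "same_sign (poly (pderiv Q) \<eta>) (poly q' y)"
          using der t \<xi> \<eta> by auto
        \<comment> \<open>At the end points only weak signs are available; strict monotonicity
          between them makes the sign at \<open>t\<close> strict.\<close>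
        have ends: "poly q y > 0 \<and> poly Q (\<phi> c) \<ge> 0 \<and> poly Q (\<phi> d) \<ge> 0 \<or>
            poly q y < 0 \<and> poly Q (\<phi> c) \<le> 0 \<and> poly Q (\<phi> d) \<le> 0"
        proof (cases "poly q y > 0")
          case True
          then show ?thesis using between(1) s by (auto simp: same_sign_def not_less[symmetric])
        next
          case False
          then have "poly q y < 0" using y(1) by simp
          then show ?thesis using between(2) s by (auto simp: same_sign_def not_less[symmetric])
        qed
        have "same_sign (poly Q t) (poly q y)"
        proof (cases "poly q' y > 0")
          case True
          then have "(t - \<phi> c) * poly (pderiv Q) \<xi> > 0" "(\<phi> d - t) * poly (pderiv Q) \<eta> > 0"
            using d\<xi> d\<eta> t unfolding same_sign_def by simp_all
          then have "poly Q t > poly Q (\<phi> c)" "poly Q t < poly Q (\<phi> d)" using \<xi>(3) \<eta>(3) by linarith+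
          then show ?thesis using ends unfolding same_sign_def by linarith
        next
          case False
          then have "poly q' y < 0" using y by simp
          then have "(t - \<phi> c) * poly (pderiv Q) \<xi> < 0" "(\<phi> d - t) * poly (pderiv Q) \<eta> < 0"
            using d\<xi> d\<eta> t unfolding same_sign_def by (simp_all add: mult_pos_neg)
          then have "poly Q t < poly Q (\<phi> c)" "poly Q t > poly Q (\<phi> d)" using \<xi>(3) \<eta>(3) by linarith+
          then show ?thesis using ends unfolding same_sign_def by linarith
        qed
        then show "same_sign (poly (map_poly \<phi> q) t) (poly q y)" by (simp add: Q_def)
      qed
    qed
  qed
qed

text \<open>The end points are the roots nearest to \<open>y\<close> on either side, unless
  \<open>a\<close> or \<open>b\<close> is nearer. All roots lie in \<open>A\<close>, so
  \<open>y\<close> is not one of them.\<close>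

lemma root_free_interval:
  fixes y :: 'r
  assumes "finite D" "0 \<notin> D" "\<And>q t. q \<in> D \<Longrightarrow> poly q t = 0 \<Longrightarrow> t \<in> A"
    and y: "y \<notin> A" "a \<in> A" "b \<in> A" "a < y" "y < b"
  shows "\<exists>c\<in>A. \<exists>d\<in>A. c < y \<and> y < d \<and> (\<forall>q\<in>D. \<forall>t. c < t \<longrightarrow> t < d \<longrightarrow> poly q t \<noteq> 0)"
proof -
  define Z where "Z = (\<Union>q\<in>D. {t. poly q t = 0})"
  have fin: "finite Z" unfolding Z_def
  proof (rule finite_UN_I[OF assms(1)])
    fix q assume "q \<in> D"
    then have "q \<noteq> 0" using assms(2) by blast
    then show "finite {t. poly q t = 0}" by (rule poly_roots_finite)
  qed
  have ZA: "Z \<subseteq> A" unfolding Z_def using assms(3) by auto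
  define c where "c = Max (insert a {t\<in>Z. t < y})"
  define d where "d = Min (insert b {t\<in>Z. y < t})"
  have f: "finite (insert a {t\<in>Z. t < y})" "finite (insert b {t\<in>Z. y < t})" using fin by auto
  have c: "c \<in> insert a {t\<in>Z. t < y}" unfolding c_def using f by (intro Max_in) auto
  have d: "d \<in> insert b {t\<in>Z. y < t}" unfolding d_def using f by (intro Min_in) auto
  have "poly q t \<noteq> 0" if "q \<in> D" "c < t" "t < d" for q t
  proof
    assume "poly q t = 0"
    then have tZ: "t \<in> Z" using that by (auto simp: Z_def)
    then have "t \<noteq> y" using ZA y by auto
    then consider "t < y" | "y < t" by fastforce
    then show False
    proof cases
      case 1
      then have "t \<le> c" unfolding c_def using tZ f by (intro Max_ge) auto
      then show False using that by simp
    next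
      case 2
      then have "d \<le> t" unfolding d_def using tZ f by (intro Min_le) auto
      then show False using that by simp
    qed
  qed
  moreover have "c \<in> A" "d \<in> A" "c < y" "y < d" using c d ZA y by auto
  ultimately show ?thesis by blast
qed

text \<open>An element that \<open>A\<close> does not bound on both sides exceeds 1 in absolute
  value, so its inverse lies between -1 and 1; both generate the same extension.\<close>

lemma bounded_or_inverse_bounded:
  assumes A: "sfield A" and y: "y \<notin> A"
  obtains z where "z = y \<or> z = inverse y" "z \<notin> A" "\<exists>a\<in>A. a < z" "\<exists>b\<in>A. z < b"
proof (cases "(\<exists>a\<in>A. a < y) \<and> (\<exists>b\<in>A. y < b)")
  case True then show ?thesis using that y by blast
next
  case False
  have iv: "inverse y \<notin> A" using sfieldD(7)[OF A, of "inverse y"] y by auto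
  have "(\<forall>a\<in>A. y < a) \<or> (\<forall>a\<in>A. a < y)" using False y by (metis linorder_neqE)
  then have "y < -1 \<or> y > 1" using sfieldD(3)[OF A] sfieldD(6)[OF A, of 1] by blast
  then have "-1 < inverse y \<and> inverse y < 1"
  proof
    assume "y < -1"
    then have "1 < - y" by simp
    then have "inverse (- y) < 1" "0 < inverse (- y)"
      using inverse_less_1_iff[of "- y"] positive_imp_inverse_positive[of "- y"] by linarith+
    then have "- inverse y < 1" "inverse y < 0" by (simp_all only: inverse_minus_eq neg_0_less_iff_less)
    then show ?thesis by linarith
  next
    assume "y > 1"
    then have "inverse y < 1" "0 < inverse y" by (simp_all add: inverse_less_1_iff)
    then show ?thesis using less_trans[of "-1" 0 "inverse y"] by simp
  qed
  then show ?thesis using that[of "inverse y"] iv sfieldD(3)[OF A] sfieldD(6)[OF A, of 1] by blast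
qed

end

section \<open>Simple extensions and maximal good subfields\<close>

lemma same_sign_eq_0_iff: "same_sign u x \<Longrightarrow> u = 0 \<longleftrightarrow> x = 0"
  unfolding same_sign_def by (metis linorder_neqE less_irrefl)

text \<open>The last hypothesis is additivity with denominators cleared, in the shape in which
  \<open>sA\<close> supplies it in \<open>good_simple_ext\<close>.\<close>

lemma fraction_add:
  fixes d1 d2 d3 :: real
  assumes "d1 \<noteq> 0" "d2 \<noteq> 0" "d3 \<noteq> 0" "n1 * d2 * d3 + n2 * d1 * d3 - n3 * d1 * d2 = 0"
  shows "n3 / d3 = n1 / d1 + n2 / d2"
proof -
  have "n3 * (d1 * d2) = (n1 * d2 + n2 * d1) * d3" using assms(4) by (simp add: algebra_simps)
  then show ?thesis using assms(1-3) by (simp add: add_frac_eq frac_eq_eq)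
qed

lemma fraction_mult:
  fixes d1 d2 d3 :: real
  assumes "d1 \<noteq> 0" "d2 \<noteq> 0" "d3 \<noteq> 0" "n1 * n2 * d3 - n3 * d1 * d2 = 0"
  shows "n3 / d3 = n1 / d1 * (n2 / d2)"
proof -
  have "n3 * (d1 * d2) = (n1 * n2) * d3" using assms(4) by (simp add: algebra_simps)
  then show ?thesis using assms(1-3) by (simp add: frac_eq_eq)
qed

context real_closed_ext begin

text \<open>Zero counts as a sign here, so the real point \<open>t\<close>, which may vary with
  \<open>\<phi>\<close>, also has to satisfy the algebraic relations of \<open>y\<close> that occur
  in \<open>S\<close>.\<close>

definition specializable :: "'r set \<Rightarrow> 'r \<Rightarrow> bool" where
  "specializable A y \<longleftrightarrow> (\<forall>S. finite S \<longrightarrow> (\<forall>q\<in>S. coeffs_in A q) \<longrightarrow>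
     (\<forall>\<^sub>F \<phi> in near A. \<exists>t. \<forall>q\<in>S. same_sign (poly (map_poly \<phi> q) t) (poly q y)))"

definition simple_ext :: "'r set \<Rightarrow> 'r \<Rightarrow> 'r set" where
  "simple_ext A y = {poly p y / poly q y | p q. coeffs_in A p \<and> coeffs_in A q \<and> poly q y \<noteq> 0}"

lemma simple_extI: "coeffs_in A p \<Longrightarrow> coeffs_in A q \<Longrightarrow> poly q y \<noteq> 0 \<Longrightarrow> e = poly p y / poly q y \<Longrightarrow> e \<in> simple_ext A y"
  unfolding simple_ext_def by blast

lemma simple_ext_superset: "sfield A \<Longrightarrow> A \<subseteq> simple_ext A y" "sfield A \<Longrightarrow> y \<in> simple_ext A y"
  by (auto intro: simple_extI[of _ "[:a:]" 1 for a] simple_extI[of _ "[:0, 1:]" 1] coeffs_in_poly_ops)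

lemma sfield_simple_ext:
  assumes A: "sfield A"
  shows "sfield (simple_ext A y)"
  unfolding sfield_def
proof (intro conjI ballI)
  show "range \<iota> \<subseteq> simple_ext A y"
    using simple_ext_superset(1)[OF A, of y] sfieldD(1)[OF A] by blast
next
  fix e e' assume "e \<in> simple_ext A y" "e' \<in> simple_ext A y"
  then obtain p q p' q' where h: "coeffs_in A p" "coeffs_in A q" "poly q y \<noteq> 0" "e = poly p y / poly q y"
    "coeffs_in A p'" "coeffs_in A q'" "poly q' y \<noteq> 0" "e' = poly p' y / poly q' y"
    unfolding simple_ext_def by blast
  show "e + e' \<in> simple_ext A y"
    by (rule simple_extI[of _ "p * q' + p' * q" "q * q'"])
      (use h in \<open>simp_all add: coeffs_in_poly_ops[OF A] add_frac_eq\<close>)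
  show "e * e' \<in> simple_ext A y"
    by (rule simple_extI[of _ "p * p'" "q * q'"])
      (use h in \<open>simp_all add: coeffs_in_poly_ops[OF A]\<close>)
next
  fix e assume "e \<in> simple_ext A y"
  then obtain p q where h: "coeffs_in A p" "coeffs_in A q" "poly q y \<noteq> 0" "e = poly p y / poly q y"
    unfolding simple_ext_def by blast
  show "- e \<in> simple_ext A y"
    by (rule simple_extI[of _ "- p" q]) (use h in \<open>auto intro!: coeffs_in_poly_ops[OF A]\<close>)
  show "inverse e \<in> simple_ext A y"
  proof (cases "poly p y = 0")
    case True
    then have "inverse e = 0" using h by simp
    then show ?thesis using simple_ext_superset(1)[OF A] sfieldD(2)[OF A] by auto
  next
    case False
    then show ?thesis by (intro simple_extI[of _ q p]) (use h in auto)
  qed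
qed

text \<open>The fraction \<open>N e / D e\<close> at \<open>y\<close> is sent to the fraction of the
  polynomials specialized by \<open>\<phi>\<close>, evaluated at \<open>t\<close>. Fractions are
  picked separately for each element, so additivity and multiplicativity are not automatic; each
  instance is a polynomial relation at \<open>y\<close> that is put among the sign conditions
  imposed on \<open>t\<close>.\<close>

lemma good_simple_ext:
  assumes good: "good A" and y: "specializable A y"
  shows "good (simple_ext A y)"
  unfolding good_def
proof (intro conjI allI impI)
  have A: "sfield A" using good by (simp add: good_def)
  show B: "sfield (simple_ext A y)" by (rule sfield_simple_ext[OF A])
  fix E assume E: "finite E" "E \<subseteq> simple_ext A y"
  have "\<forall>e. \<exists>p q. e \<in> simple_ext A y \<longrightarrow> coeffs_in A p \<and> coeffs_in A q \<and> poly q y \<noteq> 0 \<and> e = poly p y / poly q y"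
    unfolding simple_ext_def by blast
  then obtain N D where ND: "\<And>e. e \<in> simple_ext A y \<Longrightarrow> coeffs_in A (N e) \<and> coeffs_in A (D e) \<and> poly (D e) y \<noteq> 0 \<and> e = poly (N e) y / poly (D e) y"
    by metis
  have cN: "coeffs_in A (N e)" and cD: "coeffs_in A (D e)" and D0: "poly (D e) y \<noteq> 0"
    and val: "poly (N e) y = e * poly (D e) y" if "e \<in> simple_ext A y" for e
    using ND[OF that] by (blast, blast, blast, metis nonzero_eq_divide_eq)
  \<comment> \<open>\<open>local_hom\<close> on \<open>E\<close> also speaks about the values at
    sums and products, so these need denominators that survive specialization.\<close>
  define E2 where "E2 = E \<union> (\<lambda>(e, e'). e + e') ` (E \<times> E) \<union> (\<lambda>(e, e'). e * e') ` (E \<times> E)"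
  have EB: "e \<in> simple_ext A y" if "e \<in> E" for e using that E by blast
  have E2: "finite E2" "E2 \<subseteq> simple_ext A y" "E \<subseteq> E2"
    "\<And>e e'. e \<in> E \<Longrightarrow> e' \<in> E \<Longrightarrow> e + e' \<in> E2" "\<And>e e'. e \<in> E \<Longrightarrow> e' \<in> E \<Longrightarrow> e * e' \<in> E2"
    using E(1) sfieldD(4,5)[OF B EB EB] EB unfolding E2_def by auto
  note inB = subsetD[OF E2(2)]
  have c2: "coeffs_in A (N e)" "coeffs_in A (D e)" if "e \<in> E2" for e using cN cD inB that by auto
  have c1: "coeffs_in A (N e)" "coeffs_in A (D e)" if "e \<in> E" for e using c2 E2(3) that by auto
  define sA where "sA e e' = N e * D e' * D (e + e') + N e' * D e * D (e + e') - N (e + e') * D e * D e'" for e e'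
  define mA where "mA e e' = N e * N e' * D (e * e') - N (e * e') * D e * D e'" for e e'
  \<comment> \<open>The fraction picked for a real constant need not have constant numerator and
    denominator; \<open>iA\<close> forces it to specialize to the right value.\<close>
  define iA where "iA e = N e - [:e:] * D e" for e
  \<comment> \<open>\<open>D\<close> keeps the denominators nonzero, \<open>N e * D e\<close> has
    the sign of the fraction, and the other three families vanish at \<open>y\<close>.\<close>
  define S where "S = D ` E2 \<union> (\<lambda>e. N e * D e) ` E2 \<union> (\<lambda>(e, e'). sA e e') ` (E \<times> E) \<union>
    (\<lambda>(e, e'). mA e e') ` (E \<times> E) \<union> iA ` (E \<inter> A)"
  have S_fin: "finite S" unfolding S_def using E E2 by auto
  have S_in: "coeffs_in A q" if "q \<in> S" for q
  proof -
    show ?thesis using that unfolding S_def sA_def mA_def iA_def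
      by (auto intro!: coeffs_in_poly_ops[OF A] intro: c1 c2 E2(4,5) simp del: mult_pCons_left)
  qed
  have m3: "\<forall>\<^sub>F \<phi> in near A. map_poly \<phi> (p * q * r) = map_poly \<phi> p * map_poly \<phi> q * map_poly \<phi> r"
    if "coeffs_in A p" "coeffs_in A q" "coeffs_in A r" for p q r
    using ev_map_poly_mult[OF A that(1,2)] ev_map_poly_mult[OF A coeffs_in_poly_ops(7)[OF A that(1,2)] that(3)]
    by eventually_elim simp
  have ev_s: "\<forall>\<^sub>F \<phi> in near A. \<forall>e\<in>E. \<forall>e'\<in>E. map_poly \<phi> (sA e e') =
      map_poly \<phi> (N e) * map_poly \<phi> (D e') * map_poly \<phi> (D (e + e')) +
      map_poly \<phi> (N e') * map_poly \<phi> (D e) * map_poly \<phi> (D (e + e')) -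
      map_poly \<phi> (N (e + e')) * map_poly \<phi> (D e) * map_poly \<phi> (D e')"
  proof (intro eventually_ball_finite E(1) ballI)
    fix e e' assume e: "e \<in> E" "e' \<in> E"
    have c: "coeffs_in A (N e)" "coeffs_in A (N e')" "coeffs_in A (N (e + e'))" "coeffs_in A (D e)"
       "coeffs_in A (D e')" "coeffs_in A (D (e + e'))"
      using e c1 c2 E2(4,5) by auto
    have p: "coeffs_in A (N e * D e' * D (e + e'))" "coeffs_in A (N e' * D e * D (e + e'))"
      "coeffs_in A (N (e + e') * D e * D e')" using c by (auto intro!: coeffs_in_poly_ops[OF A])
    from m3[OF c(1,5,6)] m3[OF c(2,4,6)] m3[OF c(3,4,5)] ev_map_poly_add[OF A p(1,2)]
      ev_map_poly_diff[OF A coeffs_in_poly_ops(5)[OF A p(1,2)] p(3)]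
    show "\<forall>\<^sub>F \<phi> in near A. map_poly \<phi> (sA e e') =
      map_poly \<phi> (N e) * map_poly \<phi> (D e') * map_poly \<phi> (D (e + e')) +
      map_poly \<phi> (N e') * map_poly \<phi> (D e) * map_poly \<phi> (D (e + e')) -
      map_poly \<phi> (N (e + e')) * map_poly \<phi> (D e) * map_poly \<phi> (D e')"
      by eventually_elim (simp only: sA_def)
  qed
  have ev_m: "\<forall>\<^sub>F \<phi> in near A. \<forall>e\<in>E. \<forall>e'\<in>E. map_poly \<phi> (mA e e') =
      map_poly \<phi> (N e) * map_poly \<phi> (N e') * map_poly \<phi> (D (e * e')) -
      map_poly \<phi> (N (e * e')) * map_poly \<phi> (D e) * map_poly \<phi> (D e')"
  proof (intro eventually_ball_finite E(1) ballI)
    fix e e' assume e: "e \<in> E" "e' \<in> E"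
    have c: "coeffs_in A (N e)" "coeffs_in A (N e')" "coeffs_in A (N (e * e'))" "coeffs_in A (D e)"
       "coeffs_in A (D e')" "coeffs_in A (D (e * e'))"
      using e c1 c2 E2(4,5) by auto
    have p: "coeffs_in A (N e * N e' * D (e * e'))" "coeffs_in A (N (e * e') * D e * D e')"
      using c by (auto intro!: coeffs_in_poly_ops[OF A])
    from m3[OF c(1,2,6)] m3[OF c(3,4,5)] ev_map_poly_diff[OF A p(1,2)]
    show "\<forall>\<^sub>F \<phi> in near A. map_poly \<phi> (mA e e') =
      map_poly \<phi> (N e) * map_poly \<phi> (N e') * map_poly \<phi> (D (e * e')) -
      map_poly \<phi> (N (e * e')) * map_poly \<phi> (D e) * map_poly \<phi> (D e')"
      by eventually_elim (simp only: mA_def)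
  qed
  have ev_p: "\<forall>\<^sub>F \<phi> in near A. \<forall>e\<in>E. map_poly \<phi> (N e * D e) = map_poly \<phi> (N e) * map_poly \<phi> (D e)"
    by (intro eventually_ball_finite E(1) ballI ev_map_poly_mult[OF A] cN cD EB)
  have ev_i: "\<forall>\<^sub>F \<phi> in near A. \<forall>e\<in>E \<inter> A. map_poly \<phi> (iA e) = map_poly \<phi> (N e) - [:\<phi> e:] * map_poly \<phi> (D e)"
  proof (intro eventually_ball_finite ballI)
    show "finite (E \<inter> A)" using E by simp
    fix e assume e: "e \<in> E \<inter> A"
    then have c: "coeffs_in A (N e)" "coeffs_in A (D e)" "coeffs_in A [:e:]"
      by (auto intro!: cN cD EB coeffs_in_poly_ops[OF A])
    from ev_map_poly_mult[OF A c(3,2)] ev_map_poly_diff[OF A c(1) coeffs_in_poly_ops(7)[OF A c(3,2)]] ev_0[OF A]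
    show "\<forall>\<^sub>F \<phi> in near A. map_poly \<phi> (iA e) = map_poly \<phi> (N e) - [:\<phi> e:] * map_poly \<phi> (D e)"
      by eventually_elim (simp only: iA_def map_poly_pCons map_poly_0)
  qed
  have ev_\<iota>': "\<forall>\<^sub>F \<phi> in near A. \<forall>r\<in>{r. \<iota> r \<in> E}. \<phi> (\<iota> r) = r"
  proof (rule eventually_ball_finite)
    show "finite {r. \<iota> r \<in> E}" using finite_vimageI[OF E(1) inj_\<iota>] by (simp add: vimage_def)
    show "\<forall>r\<in>{r. \<iota> r \<in> E}. \<forall>\<^sub>F \<phi> in near A. \<phi> (\<iota> r) = r" using ev_\<iota> sfieldD(1)[OF A] by blast
  qed
  have ev_t: "\<forall>\<^sub>F \<phi> in near A. \<exists>t. \<forall>q\<in>S. same_sign (poly (map_poly \<phi> q) t) (poly q y)"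
    using y S_fin S_in unfolding specializable_def by blast
  have "\<forall>\<^sub>F \<phi> in near A. \<exists>\<psi>. local_hom E \<psi>"
    using ev_s ev_m ev_i ev_\<iota>' ev_t ev_p
  proof eventually_elim
    case (elim \<phi>)
    then obtain t where t: "\<And>q. q \<in> S \<Longrightarrow> same_sign (poly (map_poly \<phi> q) t) (poly q y)" by blast
    define n d where "n e = poly (map_poly \<phi> (N e)) t" and "d e = poly (map_poly \<phi> (D e)) t" for e
    have d0: "d e \<noteq> 0" if "e \<in> E2" for e
      using t[of "D e"] D0[OF inB[OF that]] that same_sign_eq_0_iff unfolding S_def d_def by blast
    have zero: "poly (map_poly \<phi> q) t = 0" if "q \<in> S" "poly q y = 0" for q
      using t[OF that(1)] that(2) same_sign_eq_0_iff by blast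
    define \<psi> where "\<psi> e = n e / d e" for e
    have "local_hom E \<psi>" unfolding local_hom_def
    proof (intro conjI ballI allI impI)
      fix e e' assume e: "e \<in> E" "e' \<in> E"
      then have dn: "d e \<noteq> 0" "d e' \<noteq> 0" "d (e + e') \<noteq> 0" "d (e * e') \<noteq> 0" using d0 E2 by blast+
      have v: "poly (N e) y = e * poly (D e) y" "poly (N e') y = e' * poly (D e') y"
         "poly (N (e + e')) y = (e + e') * poly (D (e + e')) y" "poly (N (e * e')) y = (e * e') * poly (D (e * e')) y"
        using e E2(3,4,5) by (blast intro: val inB)+
      have "sA e e' \<in> S" "mA e e' \<in> S" using e unfolding S_def by auto
      moreover have "poly (sA e e') y = 0" "poly (mA e e') y = 0"
        unfolding sA_def mA_def poly_add poly_diff poly_mult v by (simp_all add: algebra_simps)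
      ultimately have "poly (map_poly \<phi> (sA e e')) t = 0" "poly (map_poly \<phi> (mA e e')) t = 0"
        using zero by blast+
      then have "n e * d e' * d (e + e') + n e' * d e * d (e + e') - n (e + e') * d e * d e' = 0"
         "n e * n e' * d (e * e') - n (e * e') * d e * d e' = 0"
        unfolding elim(1)[rule_format, OF e] elim(2)[rule_format, OF e] poly_add poly_diff poly_mult n_def d_def by blast+
      then show "\<psi> (e + e') = \<psi> e + \<psi> e'" "\<psi> (e * e') = \<psi> e * \<psi> e'"
        unfolding \<psi>_def using fraction_add[OF dn(1-3)] fraction_mult[OF dn(1,2,4)] by blast+
    next
      fix e assume e: "e \<in> E" "e > 0"
      have "N e * D e \<in> S" using e E2 unfolding S_def by auto
      have dp: "poly (D e) y \<noteq> 0" using D0 EB e by blast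
      then have "poly (N e * D e) y > 0" using e val[OF EB[OF e(1)]] by (auto simp: mult.assoc zero_less_mult_iff neq_iff)
      then have "poly (map_poly \<phi> (N e * D e)) t > 0" using t[OF \<open>N e * D e \<in> S\<close>] unfolding same_sign_def by blast
      then have "n e * d e > 0" using elim(6) e(1) by (simp add: n_def d_def)
      then show "\<psi> e > 0" unfolding \<psi>_def by (simp add: zero_less_mult_iff zero_less_divide_iff)
    next
      fix r assume "\<iota> r \<in> E"
      then have r: "\<iota> r \<in> E \<inter> A" "\<phi> (\<iota> r) = r" using sfieldD(1)[OF A] elim(4) by auto
      have "iA (\<iota> r) \<in> S" using r unfolding S_def by blast
      moreover have "poly (iA (\<iota> r)) y = 0" using val[OF EB, of "\<iota> r"] r unfolding iA_def by simp
      ultimately have "poly (map_poly \<phi> (iA (\<iota> r))) t = 0" using zero by blast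
      then have "n (\<iota> r) - r * d (\<iota> r) = 0" using elim(3) r by (simp add: n_def d_def)
      then show "\<psi> (\<iota> r) = r" unfolding \<psi>_def using d0[of "\<iota> r"] r E2(3) by (auto simp: field_simps)
    qed
    then show ?case by blast
  qed
  then show "\<exists>\<psi>. local_hom E \<psi>" using eventually_happens'[OF good_near[OF good]] by blast
qed

definition maximal_good :: "'r set \<Rightarrow> bool" where
  "maximal_good A \<longleftrightarrow> good A \<and> (\<forall>B. good B \<longrightarrow> A \<subseteq> B \<longrightarrow> B = A)"

lemma maximal_good_specializable:
  assumes "maximal_good A" "specializable A y"
  shows "y \<in> A"
proof -
  have g: "good A" and A: "sfield A" using assms(1) by (auto simp: maximal_good_def good_def)
  have "simple_ext A y = A"
    using good_simple_ext[OF g assms(2)] simple_ext_superset(1)[OF A] assms(1) unfolding maximal_good_def by blast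
  then show ?thesis using simple_ext_superset(2)[OF A] by blast
qed

lemma good_base: "good (range \<iota>)"
proof -
  have "sfield (range \<iota>)" unfolding sfield_def
    by (auto simp flip: \<iota>_add \<iota>_mult \<iota>_minus \<iota>_inverse)
  moreover have "local_hom E (inv_into UNIV \<iota>)" if "E \<subseteq> range \<iota>" for E
    unfolding local_hom_def
  proof (intro conjI ballI allI impI)
    fix x y assume "x \<in> E" "y \<in> E"
    then obtain r s where "x = \<iota> r" "y = \<iota> s" using \<open>E \<subseteq> range \<iota>\<close> by blast
    then show "inv_into UNIV \<iota> (x + y) = inv_into UNIV \<iota> x + inv_into UNIV \<iota> y" "inv_into UNIV \<iota> (x * y) = inv_into UNIV \<iota> x * inv_into UNIV \<iota> y"
      by (simp_all add: inj_\<iota> flip: \<iota>_add \<iota>_mult)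
  next
    fix x assume x: "x \<in> E" "x > 0"
    then obtain r where r: "x = \<iota> r" using \<open>E \<subseteq> range \<iota>\<close> by blast
    have "\<not> r \<le> 0"
    proof
      assume "r \<le> 0"
      then have "\<iota> (- r) \<ge> 0" using \<iota>_pos[of "- r"] \<iota>_0 by (cases "r = 0") auto
      then show False using x r by (simp add: \<iota>_minus)
    qed
    then show "inv_into UNIV \<iota> x > 0" using r by (simp add: inj_\<iota>)
  qed (simp add: inj_\<iota>)
  ultimately show ?thesis unfolding good_def by blast
qed

text \<open>Goodness is tested on finite sets only, and a finite subset of the union of a chain
  already lies in one member.\<close>

lemma maximal_good_exists: "\<exists>A. maximal_good A"
proof -
  let ?S = "{A. good A}"
  have "\<exists>A\<in>?S. \<forall>B\<in>?S. A \<subseteq> B \<longrightarrow> B = A"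
  proof (rule subset_Zorn_nonempty)
    show "?S \<noteq> {}" using good_base by blast
    fix C assume C: "C \<noteq> {}" "subset.chain ?S C"
    have g: "good A" if "A \<in> C" for A
      using subsetD[OF conjunct1[OF C(2)[unfolded subset_chain_def]] that] by simp
    then have f: "sfield A" if "A \<in> C" for A using that by (simp add: good_def)
    have common: "\<exists>A\<in>C. x \<in> A \<and> y \<in> A" if xy: "x \<in> \<Union>C" "y \<in> \<Union>C" for x y
    proof -
      obtain A B where AB: "A \<in> C" "B \<in> C" "x \<in> A" "y \<in> B" using xy by blast
      then have "A \<subseteq> B \<or> B \<subseteq> A" using C(2) unfolding subset_chain_def by simp
      then show ?thesis using AB by (meson subsetD)
    qed
    have "sfield (\<Union>C)" unfolding sfield_def
    proof (intro conjI ballI)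
      show "range \<iota> \<subseteq> \<Union>C" using C(1) f sfieldD(1) by blast
    next
      fix x y assume "x \<in> \<Union>C" "y \<in> \<Union>C"
      then obtain A where "A \<in> C" "x \<in> A" "y \<in> A" using common by blast
      then show "x + y \<in> \<Union>C" "x * y \<in> \<Union>C" using sfieldD(4,5)[OF f] by blast+
    next
      fix x assume "x \<in> \<Union>C"
      then show "- x \<in> \<Union>C" "inverse x \<in> \<Union>C" using sfieldD(6,7)[OF f] by blast+
    qed
    moreover have "\<exists>\<phi>. local_hom E \<phi>" if E: "finite E" "E \<subseteq> \<Union>C" for E
    proof -
      obtain A where "A \<in> C" "E \<subseteq> A" using finite_subset_Union_chain[OF E C] by blast
      then show ?thesis using g E(1) unfolding good_def by blast
    qed
    ultimately show "\<Union>C \<in> ?S" by (simp add: good_def)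
  qed
  then show ?thesis unfolding maximal_good_def by blast
qed

section \<open>Specializing an element outside a subfield\<close>

lemma near_finite_ball:
  "finite S \<Longrightarrow> (\<And>q. q \<in> S \<Longrightarrow> \<forall>\<^sub>F \<phi> in near A. P \<phi> q) \<Longrightarrow> \<forall>\<^sub>F \<phi> in near A. \<forall>q\<in>S. P \<phi> q"
  by (rule eventually_ball_finite) auto

definition nonzero_derivatives :: "'r poly set \<Rightarrow> 'r poly set" where
  "nonzero_derivatives S = (\<Union>q\<in>S. (\<lambda>k. (pderiv ^^ k) q) ` UNIV) - {0}"

lemma degree_pderiv_iter: "degree ((pderiv ^^ k) (q :: 'r poly)) = degree q - k"
  by (induction k) (auto simp: degree_pderiv)

lemma finite_nonzero_derivatives: "finite S \<Longrightarrow> finite (nonzero_derivatives S)"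
proof -
  assume S: "finite S"
  have "(pderiv ^^ k) q = 0" if "k > degree q" for k and q :: "'r poly"
    using that
  proof (induction k)
    case (Suc k)
    then have "degree ((pderiv ^^ k) q) = 0" by (simp add: degree_pderiv_iter)
    then show ?case by (simp add: pderiv_eq_0_iff)
  qed simp
  then have "nonzero_derivatives S \<subseteq> (\<Union>q\<in>S. (\<lambda>k. (pderiv ^^ k) q) ` {..degree q})"
    unfolding nonzero_derivatives_def by (auto simp: image_iff not_less) (metis atMost_iff not_le)
  then show ?thesis by (rule finite_subset) (use S in auto)
qed

text \<open>Since all roots of the derivatives lie in \<open>A\<close>, they are kept away from
  \<open>y\<close> by end points in \<open>A\<close>, whose images under \<open>\<phi>\<close> bound
  a real interval of constant signs.\<close>

lemma specialization_interval:
  assumes A: "sfield A" and S: "finite S" "\<And>q. q \<in> S \<Longrightarrow> coeffs_in A q"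
    and roots: "\<forall>q\<in>nonzero_derivatives S. \<forall>t. poly q t = 0 \<longrightarrow> t \<in> A"
    and y: "y \<notin> A" "a \<in> A" "b \<in> A" "a < y" "y < b"
  shows "\<exists>c\<in>A. \<exists>d\<in>A. c < y \<and> y < d \<and> (\<forall>q\<in>nonzero_derivatives S. \<forall>t. c < t \<longrightarrow> t < d \<longrightarrow> poly q t \<noteq> 0) \<and>
    (\<forall>\<^sub>F \<phi> in near A. \<phi> c < \<phi> d \<and> (\<forall>q\<in>S. \<forall>t. \<phi> c < t \<longrightarrow> t < \<phi> d \<longrightarrow> same_sign (poly (map_poly \<phi> q) t) (poly q y)))"
proof -
  have "0 \<notin> nonzero_derivatives S" by (simp add: nonzero_derivatives_def)
  then have "\<exists>c\<in>A. \<exists>d\<in>A. c < y \<and> y < d \<and> (\<forall>q\<in>nonzero_derivatives S. \<forall>t. c < t \<longrightarrow> t < d \<longrightarrow> poly q t \<noteq> 0)"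
    by (rule root_free_interval[OF finite_nonzero_derivatives[OF S(1)] _ _ y]) (use roots in blast)
  then obtain c d where cd: "c \<in> A" "d \<in> A" "c < y" "y < d"
    and free: "\<forall>q\<in>nonzero_derivatives S. \<forall>t. c < t \<longrightarrow> t < d \<longrightarrow> poly q t \<noteq> 0"
    by blast
  have "\<forall>\<^sub>F \<phi> in near A. \<forall>q\<in>S. \<forall>t. \<phi> c < t \<longrightarrow> t < \<phi> d \<longrightarrow> same_sign (poly (map_poly \<phi> q) t) (poly q y)"
  proof (rule near_finite_ball[OF S(1)])
    fix q assume q: "q \<in> S"
    have "poly ((pderiv ^^ k) q) t \<noteq> 0" if "(pderiv ^^ k) q \<noteq> 0" "c < t" "t < d" for k t
    proof -
      have "(pderiv ^^ k) q \<in> nonzero_derivatives S" using that(1) q unfolding nonzero_derivatives_def by blast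
      then show ?thesis using free that by blast
    qed
    then show "\<forall>\<^sub>F \<phi> in near A. \<forall>t. \<phi> c < t \<longrightarrow> t < \<phi> d \<longrightarrow> same_sign (poly (map_poly \<phi> q) t) (poly q y)"
      by (rule specialization_sign[OF A S(2)[OF q] cd])
  qed
  moreover have "\<forall>\<^sub>F \<phi> in near A. \<phi> c < \<phi> d" using cd by (intro ev_less[OF A]) auto
  ultimately have "\<forall>\<^sub>F \<phi> in near A. \<phi> c < \<phi> d \<and> (\<forall>q\<in>S. \<forall>t. \<phi> c < t \<longrightarrow> t < \<phi> d \<longrightarrow> same_sign (poly (map_poly \<phi> q) t) (poly q y))"
    by eventually_elim blast
  then show ?thesis using cd free by blast
qed

lemma coeffs_in_nonzero_derivatives:
  assumes A: "sfield A" and S: "\<And>q. q \<in> S \<Longrightarrow> coeffs_in A q" and q: "q \<in> nonzero_derivatives S"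
  shows "coeffs_in A q" "q \<noteq> 0" "\<exists>p\<in>S. degree q \<le> degree p"
proof -
  obtain p k where p: "p \<in> S" "q = (pderiv ^^ k) p" "q \<noteq> 0" using q unfolding nonzero_derivatives_def by blast
  show "coeffs_in A q" unfolding p(2) by (rule coeffs_in_pderiv_iter[OF coeffs_in_poly_ops(9)[OF A] S[OF p(1)]])
  show "q \<noteq> 0" by fact
  have "degree q \<le> degree p" unfolding p(2) by (simp add: degree_pderiv_iter)
  then show "\<exists>p\<in>S. degree q \<le> degree p" using p(1) by blast
qed

text \<open>\<open>closed\<close> makes \<open>y\<close> transcendental over \<open>A\<close>, so no
  nontrivial equation restricts the real point and any point of the interval serves.\<close>

lemma specializable_transcendental:
  assumes A: "sfield A" and closed: "\<forall>q t. coeffs_in A q \<longrightarrow> q \<noteq> 0 \<longrightarrow> poly q t = 0 \<longrightarrow> t \<in> A"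
    and y: "y \<notin> A" "a \<in> A" "b \<in> A" "a < y" "y < b"
  shows "specializable A y"
  unfolding specializable_def
proof (intro allI impI)
  fix S assume S: "finite S" "\<forall>q\<in>S. coeffs_in A q"
  then have S2: "coeffs_in A q" if "q \<in> S" for q using that by blast
  have r: "\<forall>q\<in>nonzero_derivatives S. \<forall>t. poly q t = 0 \<longrightarrow> t \<in> A"
    using closed coeffs_in_nonzero_derivatives(1,2)[OF A S2] by blast
  obtain c d where "\<forall>\<^sub>F \<phi> in near A. \<phi> c < \<phi> d \<and> (\<forall>q\<in>S. \<forall>t. \<phi> c < t \<longrightarrow> t < \<phi> d \<longrightarrow> same_sign (poly (map_poly \<phi> q) t) (poly q y))"
    using specialization_interval[OF A S(1) S2 r y] by blast
  then show "\<forall>\<^sub>F \<phi> in near A. \<exists>t. \<forall>q\<in>S. same_sign (poly (map_poly \<phi> q) t) (poly q y)"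
  proof eventually_elim
    case (elim \<phi>)
    then show ?case by (intro exI[of _ "(\<phi> c + \<phi> d) / 2"]) (auto simp: field_simps)
  qed
qed

text \<open>Modulo \<open>p\<close> every polynomial of \<open>S\<close> may be replaced by its
  remainder, whose roots lie in \<open>A\<close> by \<open>low\<close> unless it is zero. The
  derivative of \<open>p\<close> is included to make \<open>p\<close> change sign across
  \<open>y\<close>; the specialized \<open>p\<close> inherits the sign change and so has a real root
  \<open>t\<close>, at which the specialized polynomials agree with their remainders.\<close>

lemma specializable_algebraic:
  assumes A: "sfield A" and p: "coeffs_in A p" "p \<noteq> 0" "poly p y = 0"
    and low: "\<forall>q t. coeffs_in A q \<longrightarrow> q \<noteq> 0 \<longrightarrow> degree q < degree p \<longrightarrow> poly q t = 0 \<longrightarrow> t \<in> A"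
    and y: "y \<notin> A" "a \<in> A" "b \<in> A" "a < y" "y < b"
  shows "specializable A y"
  unfolding specializable_def
proof (intro allI impI)
  fix S assume S: "finite S" "\<forall>q\<in>S. coeffs_in A q"
  have dp: "degree p > 0"
  proof (rule ccontr)
    assume "\<not> degree p > 0"
    then obtain c where "p = [:c:]" by (auto elim: degree_eq_zeroE)
    then show False using p by simp
  qed
  \<comment> \<open>Splitting off a linear factor over \<open>A\<close> would leave a polynomial of
    smaller degree that still has the root \<open>y\<close>, against \<open>low\<close>.\<close>
  have p_ne: "poly p c \<noteq> 0" if "c \<in> A" for c
  proof
    assume "poly p c = 0"
    have lin: "coeffs_in A [:-c, 1:]"
      using sfieldD(2,3)[OF A] sfieldD(6)[OF A that] by (auto simp: coeffs_in_def coeff_pCons split: nat.split)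
    obtain u r where ur: "coeffs_in A u" "p = u * [:-c, 1:] + r" "r = 0 \<or> degree r < degree [:-c, 1:]"
      using coeffs_in_division[OF A lin _ p(1)] by fastforce
    then have "degree r = 0" by auto
    then obtain k where "r = [:k:]" by (auto elim: degree_eq_zeroE)
    then have pu: "p = u * [:-c, 1:]" using ur(2) \<open>poly p c = 0\<close> by simp
    then have "u \<noteq> 0" using p(2) by auto
    then have "degree u < degree p" unfolding pu by (subst degree_mult_eq) auto
    moreover have "poly u y = 0" using p(3) that y unfolding pu by auto
    ultimately show False using low ur(1) \<open>u \<noteq> 0\<close> y(1) by blast
  qed
  have "\<forall>q. \<exists>u r. q \<in> S \<longrightarrow> coeffs_in A u \<and> coeffs_in A r \<and> q = u * p + r \<and> (r = 0 \<or> degree r < degree p)"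
    using coeffs_in_division[OF A p(1,2)] S(2) by blast
  then obtain u r where ur: "\<And>q. q \<in> S \<Longrightarrow> coeffs_in A (u q) \<and> coeffs_in A (r q) \<and> q = u q * p + r q \<and> (r q = 0 \<or> degree (r q) < degree p)"
    by metis
  define S' where "S' = insert (pderiv p) (r ` S)"
  have S'_fin: "finite S'" unfolding S'_def using S(1) by simp
  have S'_ops: "coeffs_in A q \<and> degree q < degree p" if q: "q \<in> S'" for q
  proof -
    consider "q = pderiv p" | q' where "q' \<in> S" "q = r q'" using q unfolding S'_def by blast
    then show ?thesis
    proof cases
      case 1
      then show ?thesis using coeffs_in_poly_ops(9)[OF A p(1)] dp by (simp add: degree_pderiv)
    next
      case 2
      then show ?thesis using ur[OF 2(1)] dp by (metis degree_0)
    qed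
  qed
  then have S': "\<And>q. q \<in> S' \<Longrightarrow> coeffs_in A q" "\<And>q. q \<in> S' \<Longrightarrow> degree q < degree p" by blast+
  have roots: "\<forall>q\<in>nonzero_derivatives S'. \<forall>t. poly q t = 0 \<longrightarrow> t \<in> A"
  proof
    fix q assume q: "q \<in> nonzero_derivatives S'"
    note c = coeffs_in_nonzero_derivatives[OF A S'(1) q]
    obtain p' where "p' \<in> S'" "degree q \<le> degree p'" using c(3) by blast
    then have "degree q < degree p" using S'(2)[of p'] by simp
    then show "\<forall>t. poly q t = 0 \<longrightarrow> t \<in> A" using low c(1,2) by blast
  qed
  obtain c d where cd: "c \<in> A" "d \<in> A" "c < y" "y < d"
    and free: "\<forall>q\<in>nonzero_derivatives S'. \<forall>t. c < t \<longrightarrow> t < d \<longrightarrow> poly q t \<noteq> 0"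
    and ev: "\<forall>\<^sub>F \<phi> in near A. \<phi> c < \<phi> d \<and> (\<forall>q\<in>S'. \<forall>t. \<phi> c < t \<longrightarrow> t < \<phi> d \<longrightarrow> same_sign (poly (map_poly \<phi> q) t) (poly q y))"
    using specialization_interval[OF A S'_fin S'(1) roots y] by blast
  have "pderiv p = (pderiv ^^ 0) (pderiv p)" "pderiv p \<noteq> 0" using dp by (auto simp: pderiv_eq_0_iff)
  then have "pderiv p \<in> nonzero_derivatives S'" unfolding nonzero_derivatives_def S'_def by blast
  then have "poly p c * poly p d < 0"
    using free cd p(3) p_ne by (intro sign_change_at_root[of c y d]) auto
  then have change: "poly p c < 0 \<and> poly p d > 0 \<or> poly p c > 0 \<and> poly p d < 0" by (auto simp: mult_less_0_iff)
  have ev_q: "\<forall>\<^sub>F \<phi> in near A. \<forall>q\<in>S. map_poly \<phi> q = map_poly \<phi> (u q) * map_poly \<phi> p + map_poly \<phi> (r q)"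
  proof (rule near_finite_ball[OF S(1)])
    fix q assume "q \<in> S"
    note h = ur[OF this]
    have c: "coeffs_in A (u q)" "coeffs_in A (r q)" "coeffs_in A (u q * p)"
      using h p coeffs_in_poly_ops(7)[OF A] by auto
    from ev_map_poly_add[OF A c(3,2)] ev_map_poly_mult[OF A c(1) p(1)]
    have "\<forall>\<^sub>F \<phi> in near A. map_poly \<phi> (u q * p + r q) = map_poly \<phi> (u q) * map_poly \<phi> p + map_poly \<phi> (r q)"
      by eventually_elim simp
    then show "\<forall>\<^sub>F \<phi> in near A. map_poly \<phi> q = map_poly \<phi> (u q) * map_poly \<phi> p + map_poly \<phi> (r q)"
      using h by simp
  qed
  from ev ev_q ev_poly_same_sign[OF A p(1) cd(1)] ev_poly_same_sign[OF A p(1) cd(2)]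
  show "\<forall>\<^sub>F \<phi> in near A. \<exists>t. \<forall>q\<in>S. same_sign (poly (map_poly \<phi> q) t) (poly q y)"
  proof eventually_elim
    case (elim \<phi>)
    define P where "P = map_poly \<phi> p"
    have "poly P (\<phi> c) < 0 \<and> poly P (\<phi> d) > 0 \<or> poly P (\<phi> c) > 0 \<and> poly P (\<phi> d) < 0"
      using change elim(3,4) unfolding P_def same_sign_def by blast
    then obtain t where t: "\<phi> c < t" "t < \<phi> d" "poly P t = 0"
      using poly_IVT_pos[of "\<phi> c" "\<phi> d" P] poly_IVT_neg[of "\<phi> c" "\<phi> d" P] elim(1) by blast
    have "same_sign (poly (map_poly \<phi> q) t) (poly q y)" if q: "q \<in> S" for q
    proof -
      have "same_sign (poly (map_poly \<phi> (r q)) t) (poly (r q) y)"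
        using elim(1) t q unfolding S'_def by blast
      moreover have "poly (map_poly \<phi> q) t = poly (map_poly \<phi> (r q)) t"
        using elim(2) q t(3) by (simp add: P_def)
      moreover have "poly q y = poly (r q) y"
        using arg_cong[OF conjunct1[OF conjunct2[OF conjunct2[OF ur[OF q]]]], of "\<lambda>q. poly q y"] p(3) by simp
      ultimately show ?thesis by simp
    qed
    then show ?case by blast
  qed
qed

theorem good_UNIV: "good UNIV"
proof -
  obtain A where max: "maximal_good A" using maximal_good_exists by blast
  then have good: "good A" and A: "sfield A" by (auto simp: maximal_good_def good_def)
  have closed: "\<forall>q t. coeffs_in A q \<longrightarrow> q \<noteq> 0 \<longrightarrow> poly q t = 0 \<longrightarrow> t \<in> A"
  proof (intro allI impI, rule ccontr)
    fix q t assume q: "coeffs_in A q" "q \<noteq> 0" "poly q t = 0" and t: "t \<notin> A"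
    \<comment> \<open>The degree is minimized over all roots outside \<open>A\<close>, not just for
      one of them, so that every nonzero polynomial of smaller degree has all its roots in
      \<open>A\<close>.\<close>
    define bad where "bad q \<longleftrightarrow> coeffs_in A q \<and> q \<noteq> 0 \<and> (\<exists>t. t \<notin> A \<and> poly q t = 0)" for q
    have "bad q" unfolding bad_def using q t by blast
    then obtain p where "bad p" and min: "\<And>q. bad q \<Longrightarrow> degree p \<le> degree q"
      using ex_has_least_nat[of bad q degree] by blast
    then obtain y where y: "coeffs_in A p" "p \<noteq> 0" "y \<notin> A" "poly p y = 0" unfolding bad_def by blast
    have y0: "y \<noteq> 0" using y(3) sfieldD(2)[OF A] by auto
    obtain z where z: "z = y \<or> z = inverse y" "z \<notin> A" "\<exists>a\<in>A. a < z" "\<exists>b\<in>A. z < b"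
      using bounded_or_inverse_bounded[OF A y(3)] by blast
    \<comment> \<open>Passing to the inverse must not raise the degree: the reflected polynomial has
      the inverse as a root and at most the same degree.\<close>
    obtain p' where p': "coeffs_in A p'" "p' \<noteq> 0" "poly p' z = 0" "degree p' \<le> degree p"
    proof (cases "z = y")
      case True then show ?thesis using that[of p] y by simp
    next
      case False
      then have "z = inverse y" using z by blast
      then have "poly (reflect_poly p) z = 0" using y(4) y0 by (simp add: poly_reflect_poly_nz)
      then show ?thesis
        using that[of "reflect_poly p"] y coeffs_in_poly_ops(10)[OF A y(1)] degree_reflect_poly_le[of p] by simp
    qed
    have "\<forall>q t. coeffs_in A q \<longrightarrow> q \<noteq> 0 \<longrightarrow> degree q < degree p' \<longrightarrow> poly q t = 0 \<longrightarrow> t \<in> A"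
    proof (intro allI impI, rule ccontr)
      fix q t assume h: "coeffs_in A q" "q \<noteq> 0" "degree q < degree p'" "poly q t = 0" "t \<notin> A"
      then have "bad q" unfolding bad_def by blast
      then show False using min[of q] p'(4) h(3) by simp
    qed
    then have "specializable A z"
      using specializable_algebraic[OF A p'(1-3) _ z(2)] z(3,4) by blast
    then show False using maximal_good_specializable[OF max] z(2) by blast
  qed
  have "A = UNIV"
  proof (rule ccontr)
    assume "A \<noteq> UNIV"
    then obtain y where "y \<notin> A" by blast
    then obtain z where z: "z \<notin> A" "\<exists>a\<in>A. a < z" "\<exists>b\<in>A. z < b"
      using bounded_or_inverse_bounded[OF A] by blast
    then have "specializable A z" using specializable_transcendental[OF A closed] by blast
    then show False using maximal_good_specializable[OF max] z(1) by blast
  qed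
  then show ?thesis using good by simp
qed

end

section \<open>Realizing prime cones by real points\<close>

definition pconst :: "real \<Rightarrow> ('n::finite) rpoly" where
  "pconst c = Poly_Mapping.single 0 c"

definition pvar :: "'n \<Rightarrow> ('n::finite) rpoly" where
  "pvar i = Poly_Mapping.single (Poly_Mapping.single i 1) 1"

abbreviation monomial_value :: "('i \<Rightarrow> 'a::comm_monoid_mult) \<Rightarrow> ('i::finite \<Rightarrow>\<^sub>0 nat) \<Rightarrow> 'a" where
  "monomial_value x m \<equiv> (\<Prod>i\<in>UNIV. x i ^ Poly_Mapping.lookup m i)"

lemma poly_mapping_sum_singles:
  "p = (\<Sum>m\<in>Poly_Mapping.keys p. Poly_Mapping.single m (Poly_Mapping.lookup p m))"
  by (rule poly_mapping_eqI) (auto simp: lookup_sum lookup_single when_def in_keys_iff)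

lemma prod_single: "finite I \<Longrightarrow> (\<Prod>i\<in>I. Poly_Mapping.single (f i) (1::'a::comm_semiring_1)) = Poly_Mapping.single (sum f I) 1"
  by (induction I rule: finite_induct) (auto simp: mult_single)

lemma single_power: "Poly_Mapping.single (m :: 'b::comm_monoid_add) (1::'a::comm_semiring_1) ^ k = Poly_Mapping.single (\<Sum>_<k. m) 1"
  by (induction k) (auto simp: mult_single lessThan_Suc)

lemma single_eq_pconst_pvar:
  fixes m :: "'n::finite \<Rightarrow>\<^sub>0 nat"
  shows "Poly_Mapping.single m c = pconst c * monomial_value pvar m"
proof -
  have "(\<Sum>i\<in>UNIV. \<Sum>_<Poly_Mapping.lookup m i. Poly_Mapping.single i 1) = m"
    by (rule poly_mapping_eqI) (simp add: lookup_sum lookup_single when_def mult_delta_right)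
  then have "monomial_value pvar m = Poly_Mapping.single m 1"
    unfolding pvar_def single_power by (subst prod_single) simp_all
  then show ?thesis by (simp add: pconst_def mult_single)
qed

lemma rpoly_eq_sum:
  fixes p :: "('n::finite) rpoly"
  shows "p = (\<Sum>m\<in>Poly_Mapping.keys p. pconst (Poly_Mapping.lookup p m) * monomial_value pvar m)"
  by (subst single_eq_pconst_pvar[symmetric]) (rule poly_mapping_sum_singles)

lemma peval_add: "peval (p + q) x = peval p x + peval q x"
  unfolding peval_def
  by (rule setsum_keys_plus_distrib) (auto simp: algebra_simps)

lemma peval_0: "peval 0 x = 0" by (simp add: peval_def)

lemma peval_uminus: "peval (- p) x = - peval p x"
  using peval_add[of p "-p" x] by (simp add: peval_0)

lemma peval_diff: "peval (p - q) x = peval p x - peval q x"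
  using peval_add[of p "-q" x] by (simp add: peval_uminus)

lemma peval_sum: "peval (sum f I) x = (\<Sum>i\<in>I. peval (f i) x)"
  by (induction I rule: infinite_finite_induct) (auto simp: peval_0 peval_add)

lemma peval_single: "peval (Poly_Mapping.single m c) x = c * monomial_value (($) x) m"
  by (cases "c = 0") (simp_all add: peval_def)

lemma peval_mult: "peval (p * q) x = peval p x * peval q x"
proof -
  have s: "peval (Poly_Mapping.single m c * Poly_Mapping.single n d) x =
    peval (Poly_Mapping.single m c) x * peval (Poly_Mapping.single n d) x" for m n c d
    by (simp add: mult_single peval_single lookup_add power_add prod.distrib)
  have "peval (p * q) x = peval ((\<Sum>m\<in>Poly_Mapping.keys p. Poly_Mapping.single m (Poly_Mapping.lookup p m)) *
      (\<Sum>m\<in>Poly_Mapping.keys q. Poly_Mapping.single m (Poly_Mapping.lookup q m))) x"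
    using poly_mapping_sum_singles[of p] poly_mapping_sum_singles[of q] by simp
  also have "\<dots> = peval (\<Sum>m\<in>Poly_Mapping.keys p. Poly_Mapping.single m (Poly_Mapping.lookup p m)) x *
      peval (\<Sum>m\<in>Poly_Mapping.keys q. Poly_Mapping.single m (Poly_Mapping.lookup q m)) x"
    unfolding sum_product peval_sum by (simp only: s)
  finally show ?thesis by (simp flip: poly_mapping_sum_singles)
qed

lemma peval_1: "peval 1 x = 1"
  using peval_single[of 0 1 x] by simp

lemma peval_power: "peval (p ^ k) x = peval p x ^ k"
  by (induction k) (auto simp: peval_1 peval_mult)

definition realizable :: "('n::finite) rpoly set \<Rightarrow> 'n rpoly set \<Rightarrow> bool" where
  "realizable P S \<longleftrightarrow> (\<exists>x. \<forall>p\<in>S. p \<in> P \<longleftrightarrow> peval p x \<ge> 0)"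

text \<open>A type cannot depend on a given prime cone. As every instance of the claim is refuted by a
  single closed term if it is refuted at all, it suffices to treat a cone that is chosen once and for
  all to be a counterexample if there is one.\<close>

definition critical_cone :: "('n::finite) rpoly set" where
  "critical_cone = (SOME P. prime_cone P \<and>
     ((\<exists>(P' :: 'n rpoly set) S. prime_cone P' \<and> finite S \<and> \<not> realizable P' S) \<longrightarrow> (\<exists>S. finite S \<and> \<not> realizable P S)))"

text \<open>Real points supply prime cones, on which the choice of \<open>critical_cone\<close>
  falls back when there is no counterexample.\<close>

lemma prime_cone_point: "prime_cone {p. peval p x \<ge> 0}"
  unfolding prime_cone_def precone_def
  by (auto simp: peval_add peval_mult peval_uminus peval_1)

lemma critical_cone_ex: "\<exists>P :: ('n::finite) rpoly set. prime_cone P \<and>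
     ((\<exists>(P' :: 'n rpoly set) S. prime_cone P' \<and> finite S \<and> \<not> realizable P' S) \<longrightarrow> (\<exists>S. finite S \<and> \<not> realizable P S))"
  using prime_cone_point by blast

lemma critical_cone: "prime_cone critical_cone"
  unfolding critical_cone_def by (rule conjunct1[OF someI_ex[OF critical_cone_ex]])

lemma critical_cone_critical:
  assumes "\<And>S :: ('n::finite) rpoly set. finite S \<Longrightarrow> realizable critical_cone S"
    and "prime_cone (P :: 'n rpoly set)" "finite S"
  shows "realizable P S"
proof (rule ccontr)
  assume "\<not> realizable P S"
  then have "\<exists>(P' :: 'n rpoly set) S. prime_cone P' \<and> finite S \<and> \<not> realizable P' S" using assms by blast
  moreover have "(\<exists>(P' :: 'n rpoly set) S. prime_cone P' \<and> finite S \<and> \<not> realizable P' S) \<longrightarrow>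
      (\<exists>S :: 'n rpoly set. finite S \<and> \<not> realizable critical_cone S)"
    unfolding critical_cone_def by (rule conjunct2[OF someI_ex[OF critical_cone_ex]])
  ultimately show False using assms(1) by blast
qed

lemma prime_coneD:
  assumes "prime_cone P"
  shows "p \<in> P \<Longrightarrow> q \<in> P \<Longrightarrow> p + q \<in> P" "p \<in> P \<Longrightarrow> q \<in> P \<Longrightarrow> p * q \<in> P"
    "p \<in> P \<or> - p \<in> P" "- 1 \<notin> P"
    "p * q \<in> P \<Longrightarrow> - (p * q) \<in> P \<Longrightarrow> p \<in> P \<and> - p \<in> P \<or> q \<in> P \<and> - q \<in> P"
    "0 \<in> P"
  using assms cone_0[of P] by (simp_all add: prime_cone_def precone_def)

lemmas critical_cone_add = prime_coneD(1)[OF critical_cone]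
  and critical_cone_mult = prime_coneD(2)[OF critical_cone]
  and critical_cone_total = prime_coneD(3)[OF critical_cone]
  and critical_cone_minus_1 = prime_coneD(4)[OF critical_cone]
  and critical_cone_prime = prime_coneD(5)[OF critical_cone]
  and critical_cone_0 = prime_coneD(6)[OF critical_cone]

section \<open>The ordered residue domain of the critical cone\<close>

definition residue_rel :: "('n::finite) rpoly \<Rightarrow> 'n rpoly \<Rightarrow> bool" where
  "residue_rel p q \<longleftrightarrow> p - q \<in> critical_cone \<and> q - p \<in> critical_cone"

text \<open>Multiplication by \<open>r\<close> respects the relation because \<open>r\<close> or
  \<open>- r\<close> lies in the cone.\<close>

lemma residue_rel_mult_left:
  assumes "residue_rel p q" shows "residue_rel (r * p) (r * q)"
proof -
  have *: "s * p - s * q \<in> critical_cone \<and> s * q - s * p \<in> critical_cone" if "s \<in> critical_cone" for s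
    using assms critical_cone_mult[OF that, of "p - q"] critical_cone_mult[OF that, of "q - p"]
    by (simp add: residue_rel_def right_diff_distrib)
  show ?thesis using *[of r] *[of "- r"] critical_cone_total[of r]
    unfolding residue_rel_def by auto
qed

lemma equivp_residue_rel: "equivp (residue_rel :: ('n::finite) rpoly \<Rightarrow> _)"
proof (rule equivpI)
  show "reflp (residue_rel :: 'n rpoly \<Rightarrow> _)" by (auto intro!: reflpI simp: residue_rel_def critical_cone_0)
  show "symp (residue_rel :: 'n rpoly \<Rightarrow> _)" by (auto intro!: sympI simp: residue_rel_def)
  show "transp (residue_rel :: 'n rpoly \<Rightarrow> _)"
  proof (rule transpI)
    fix p q r :: "'n rpoly" assume "residue_rel p q" "residue_rel q r"
    then show "residue_rel p r"
      using critical_cone_add[of "p - q" "q - r"] critical_cone_add[of "r - q" "q - p"] by (simp add: residue_rel_def)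
  qed
qed

\<comment> \<open>The polynomial ring modulo the support of the cone, to be ordered by the cone.
  Being a type, it can be passed to \<open>fract\<close> and \<open>real_closure\<close>.\<close>
quotient_type (overloaded) 'n residue = "('n::finite) rpoly" / residue_rel
  morphisms rep_residue Residue
  by (rule equivp_residue_rel)

instantiation residue :: (finite) linordered_idom
begin

lift_definition zero_residue :: "'a residue" is 0 .
lift_definition one_residue :: "'a residue" is 1 .
lift_definition uminus_residue :: "'a residue \<Rightarrow> 'a residue" is uminus
  by (simp add: residue_rel_def)
lift_definition plus_residue :: "'a residue \<Rightarrow> 'a residue \<Rightarrow> 'a residue" is plus
  subgoal for p q r s
    using critical_cone_add[of "p - q" "r - s"] critical_cone_add[of "q - p" "s - r"]
    by (simp add: residue_rel_def algebra_simps)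
  done
lift_definition minus_residue :: "'a residue \<Rightarrow> 'a residue \<Rightarrow> 'a residue" is minus
  subgoal for p q r s
    using critical_cone_add[of "p - q" "s - r"] critical_cone_add[of "q - p" "r - s"]
    by (simp add: residue_rel_def algebra_simps)
  done
lift_definition times_residue :: "'a residue \<Rightarrow> 'a residue \<Rightarrow> 'a residue" is times
  subgoal for p q r s
    using residue_rel_mult_left[of r s p] residue_rel_mult_left[of p q s]
      equivp_transp[OF equivp_residue_rel] by (metis mult.commute)
  done
lift_definition less_eq_residue :: "'a residue \<Rightarrow> 'a residue \<Rightarrow> bool" is "\<lambda>p q. q - p \<in> critical_cone"
  subgoal for p q r s
    using critical_cone_add[of "r - p" "p - q"] critical_cone_add[of "r - q" "s - r"]
      critical_cone_add[of "s - q" "q - p"] critical_cone_add[of "s - p" "r - s"]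
    by (auto simp: residue_rel_def)
  done
definition less_residue :: "'a residue \<Rightarrow> 'a residue \<Rightarrow> bool" where
  "less_residue x y \<longleftrightarrow> x \<le> y \<and> \<not> y \<le> x"
definition abs_residue :: "'a residue \<Rightarrow> 'a residue" where
  "abs_residue x = (if x < 0 then - x else x)"
definition sgn_residue :: "'a residue \<Rightarrow> 'a residue" where
  "sgn_residue x = (if x = 0 then 0 else if 0 < x then 1 else - 1)"

lemma residue_antisym: "x = y" if "x \<le> y" "y \<le> x" for x y :: "'a residue"
  using that by transfer (simp add: residue_rel_def)

lemma residue_no_zero_divisors: "x = 0 \<or> y = 0" if "x * y = 0" for x y :: "'a residue"
  using that by transfer (simp add: residue_rel_def critical_cone_prime)

lemma residue_rel_refl: "residue_rel p p"
  by (simp add: residue_rel_def critical_cone_0)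

instance
proof
  fix x y z :: "'a residue"
  show "x + y + z = x + (y + z)" by transfer (simp add: add.assoc residue_rel_refl)
  show "x + y = y + x" by transfer (simp add: add.commute residue_rel_refl)
  show "0 + x = x" "- x + x = 0" "x - y = x + - y" "1 * x = x" "x + y - x = y" "0 * x = 0" "x * 0 = 0"
    by (transfer; simp add: residue_rel_refl)+
  show "x - y - z = x - (y + z)" by transfer (simp add: diff_diff_add residue_rel_refl)
  show "x * y * z = x * (y * z)" by transfer (simp add: mult.assoc residue_rel_refl)
  show "x * y = y * x" by transfer (simp add: mult.commute residue_rel_refl)
  show "(x + y) * z = x * z + y * z" by transfer (simp add: distrib_right residue_rel_refl)
  show "(0::'a residue) \<noteq> 1" by transfer (simp add: residue_rel_def critical_cone_minus_1)
  show "x < y \<longleftrightarrow> x \<le> y \<and> \<not> y \<le> x" by (rule less_residue_def)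
  show "x \<le> x" by transfer (simp add: critical_cone_0)
  show "x \<le> z" if "x \<le> y" "y \<le> z" using that
  proof transfer
    fix p q r :: "'a rpoly" assume "q - p \<in> critical_cone" "r - q \<in> critical_cone"
    then show "r - p \<in> critical_cone" using critical_cone_add[of "q - p" "r - q"] by simp
  qed
  show "x = y" if "x \<le> y" "y \<le> x" using that by (rule residue_antisym)
  show "x \<le> y \<or> y \<le> x"
  proof transfer
    fix p q :: "'a rpoly" show "q - p \<in> critical_cone \<or> p - q \<in> critical_cone"
      using critical_cone_total[of "q - p"] by simp
  qed
  show "z + x \<le> z + y" if "x \<le> y" using that by transfer simp
  show "z * x < z * y" if "x < y" "0 < z"
  proof -
    have h: "x \<le> y" "0 \<le> z" "x \<noteq> y" "z \<noteq> 0" using that by (auto simp: less_residue_def)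
    have "z * x \<le> z * y" using h(1,2)
    proof transfer
      fix p q r :: "'a rpoly" assume "q - p \<in> critical_cone" "r - 0 \<in> critical_cone"
      then show "r * q - r * p \<in> critical_cone" using critical_cone_mult[of r "q - p"] by (simp add: right_diff_distrib)
    qed
    moreover have "z * x \<noteq> z * y"
    proof
      assume "z * x = z * y"
      then have "z * (x - y) = 0" by transfer (simp add: right_diff_distrib residue_rel_def)
      then have "x - y = 0" using residue_no_zero_divisors h(4) by blast
      then have "x = y" by transfer (simp add: residue_rel_def)
      then show False using h(3) by blast
    qed
    ultimately show ?thesis unfolding less_residue_def using residue_antisym by blast
  qed
  show "\<bar>x\<bar> = (if x < 0 then - x else x)" by (rule abs_residue_def)
  show "sgn x = (if x = 0 then 0 else if 0 < x then 1 else - 1)" by (rule sgn_residue_def)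
qed

end

lemma Residue_add: "Residue (p + q) = Residue p + Residue q" by (simp add: plus_residue.abs_eq)
lemma Residue_mult: "Residue (p * q) = Residue p * Residue q" by (simp add: times_residue.abs_eq)
lemma Residue_1: "Residue 1 = 1" by (simp add: one_residue_def)
lemma Residue_nonneg_iff: "Residue p \<ge> 0 \<longleftrightarrow> p \<in> critical_cone"
  by (simp add: zero_residue_def less_eq_residue.abs_eq)

text \<open>The value at the generic point, whose coordinates are the classes of the variables. The
  cone consists exactly of the polynomials that are nonnegative there.\<close>

definition generic_value :: "('n::finite) rpoly \<Rightarrow> 'n residue fract real_closure" where
  "generic_value p = to_rc (Fract (Residue p) 1)"

lemma generic_value_add: "generic_value (p + q) = generic_value p + generic_value q"
  unfolding generic_value_def by (simp add: Residue_add flip: to_rc_add)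

lemma generic_value_mult: "generic_value (p * q) = generic_value p * generic_value q"
  unfolding generic_value_def by (simp add: Residue_mult flip: to_rc_mult)

lemma generic_value_1: "generic_value 1 = 1"
  unfolding generic_value_def by (simp add: Residue_1 One_fract_def[symmetric] to_rc_1)

lemma generic_value_0: "generic_value 0 = 0" using generic_value_add[of 0 0] by simp

lemma generic_value_sum: "generic_value (sum f I) = (\<Sum>i\<in>I. generic_value (f i))"
  by (induction I rule: infinite_finite_induct) (auto simp: generic_value_0 generic_value_add)

lemma generic_value_power: "generic_value (p ^ k) = generic_value p ^ k"
  by (induction k) (auto simp: generic_value_1 generic_value_mult)

lemma generic_value_prod: "generic_value (prod f I) = (\<Prod>i\<in>I. generic_value (f i))"
  by (induction I rule: infinite_finite_induct) (auto simp: generic_value_1 generic_value_mult)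

lemma to_rc_nonneg_iff: "to_rc x \<ge> 0 \<longleftrightarrow> x \<ge> 0"
proof
  assume h: "to_rc x \<ge> 0"
  show "x \<ge> 0"
  proof (rule ccontr)
    assume "\<not> x \<ge> 0"
    then have "to_rc (- x) \<ge> 0" "x \<noteq> 0" by (auto intro: to_rc_nonneg)
    moreover have "to_rc (- x) + to_rc x = to_rc 0" by (simp flip: to_rc_add)
    moreover have "to_rc (0 :: 'a) = 0" using to_rc_add[of "0::'a" 0] by simp
    ultimately have "to_rc x = to_rc 0" using h by (simp add: add_nonneg_eq_0_iff)
    then show False using \<open>x \<noteq> 0\<close> by (simp add: to_rc_eq_iff)
  qed
qed (rule to_rc_nonneg)

lemma generic_value_nonneg_iff: "generic_value p \<ge> 0 \<longleftrightarrow> p \<in> critical_cone"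
  unfolding generic_value_def to_rc_nonneg_iff
  by (simp add: zero_le_Fract_iff Residue_nonneg_iff)

text \<open>Local homomorphisms carry over only finite arithmetic, so the value is spelled out as an
  expression in the coordinates and the real constants.\<close>

lemma generic_value_expand:
  "generic_value p = (\<Sum>m\<in>Poly_Mapping.keys p. generic_value (pconst (Poly_Mapping.lookup p m)) *
     monomial_value (\<lambda>i. generic_value (pvar i)) m)"
  by (subst rpoly_eq_sum[of p])
    (simp only: generic_value_sum generic_value_mult generic_value_prod generic_value_power)

interpretation generic: real_closed_ext "\<lambda>r. generic_value (pconst r :: ('n::finite) rpoly)"
proof
  fix x y :: real
  show "generic_value (pconst (x + y) :: 'n rpoly) = generic_value (pconst x) + generic_value (pconst y)"
    by (simp add: pconst_def single_add flip: generic_value_add)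
  show "generic_value (pconst (x * y) :: 'n rpoly) = generic_value (pconst x) * generic_value (pconst y)"
    by (simp add: pconst_def mult_single flip: generic_value_mult)
  show "generic_value (pconst 1 :: 'n rpoly) = 1"
    by (simp add: pconst_def generic_value_1)
qed (rule real_closure_IVT)

section \<open>Real points from the generic point\<close>

context real_closed_ext begin

lemma ev_power: 
  assumes "sfield A" "x \<in> A"
  shows "\<forall>\<^sub>F \<phi> in near A. \<phi> (x ^ k) = \<phi> x ^ k"
proof (induction k)
  case 0 then show ?case using ev_1[OF assms(1)] by simp
next
  case (Suc k)
  have "x ^ k \<in> A" by (induction k) (auto simp: assms intro!: sfieldD[OF assms(1)])
  from ev_mult[OF assms(2) this] Suc show ?case by eventually_elim simp
qed

lemma ev_prod:
  assumes "finite I"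
  shows "\<forall>\<^sub>F \<phi> in near UNIV. \<phi> (prod f I) = (\<Prod>i\<in>I. \<phi> (f i))"
  using assms
proof (induction I)
  case empty then show ?case using ev_1[of UNIV] good_UNIV by (simp add: good_def)
next
  case (insert i I)
  have "\<forall>\<^sub>F \<phi> in near UNIV. \<phi> (f i * prod f I) = \<phi> (f i) * \<phi> (prod f I)" by (intro ev_mult) auto
  then show ?case using insert.IH by eventually_elim (use insert(1,2) in simp)
qed

end

text \<open>A local homomorphism respecting enough arithmetic maps the generic coordinates to a real
  point at which each \<open>p\<close> of \<open>S\<close> takes the value
  \<open>\<phi> (generic_value p)\<close>. Signs are preserved, and the sign of
  \<open>generic_value p\<close> decides membership in the cone.\<close>

lemma realizable_critical_cone:
  assumes "finite (S :: ('n::finite) rpoly set)"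
  shows "realizable critical_cone S"
proof -
  have A: "generic.sfield (UNIV :: 'n residue fract real_closure set)"
    by (rule conjunct1[OF generic.good_UNIV[unfolded generic.good_def]])
  let ?near = "generic.near (UNIV :: 'n residue fract real_closure set)"
  define point where "point \<phi> = ((\<chi> i. \<phi> (generic_value (pvar i))) :: real ^ 'n)" for \<phi> :: "'n residue fract real_closure \<Rightarrow> real"
  have ev: "\<forall>\<^sub>F \<phi> in ?near. \<phi> (generic_value p) = peval p (point \<phi>)" for p :: "'n rpoly"
  proof -
    let ?K = "Poly_Mapping.keys p"
    let ?v = "\<lambda>i. generic_value (pvar i)"
    let ?c = "\<lambda>m. generic_value (pconst (Poly_Mapping.lookup p m) :: 'n rpoly)"
    have "\<forall>\<^sub>F \<phi> in ?near. \<phi> (\<Sum>m\<in>?K. ?c m * monomial_value ?v m) = (\<Sum>m\<in>?K. \<phi> (?c m * monomial_value ?v m))"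
      by (rule generic.ev_sum[OF A]) auto
    moreover have "\<forall>\<^sub>F \<phi> in ?near. \<forall>m\<in>?K. \<phi> (?c m * monomial_value ?v m) = Poly_Mapping.lookup p m * monomial_value (($) (point \<phi>)) m"
    proof (intro eventually_ball_finite ballI)
      fix m
      have "\<forall>\<^sub>F \<phi> in ?near. \<phi> (?c m * monomial_value ?v m) = \<phi> (?c m) * \<phi> (monomial_value ?v m)"
        by (rule generic.ev_mult) auto
      moreover have "\<forall>\<^sub>F \<phi> in ?near. \<phi> (?c m) = Poly_Mapping.lookup p m" by (rule generic.ev_\<iota>) simp
      moreover have "\<forall>\<^sub>F \<phi> in ?near. \<phi> (monomial_value ?v m) = (\<Prod>i\<in>UNIV. \<phi> (?v i ^ Poly_Mapping.lookup m i))"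
        by (rule generic.ev_prod) simp
      moreover have "\<forall>\<^sub>F \<phi> in ?near. \<forall>i\<in>UNIV. \<phi> (?v i ^ Poly_Mapping.lookup m i) = \<phi> (?v i) ^ Poly_Mapping.lookup m i"
        by (intro eventually_ball_finite ballI generic.ev_power[OF A]) auto
      ultimately show "\<forall>\<^sub>F \<phi> in ?near. \<phi> (?c m * monomial_value ?v m) = Poly_Mapping.lookup p m * monomial_value (($) (point \<phi>)) m"
        by eventually_elim (simp add: point_def)
    qed simp
    ultimately show ?thesis
      by eventually_elim (simp add: generic_value_expand[of p] peval_def)
  qed
  have "\<forall>\<^sub>F \<phi> in ?near. \<forall>p\<in>S. \<phi> (generic_value p) = peval p (point \<phi>)"
    using assms ev by (intro eventually_ball_finite) auto
  moreover have "\<forall>\<^sub>F \<phi> in ?near. \<forall>p\<in>S. same_sign (\<phi> (generic_value p)) (generic_value p)"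
    using assms by (intro eventually_ball_finite) (auto intro!: generic.ev_same_sign[OF A])
  ultimately have "\<forall>\<^sub>F \<phi> in ?near. \<forall>p\<in>S. p \<in> critical_cone \<longleftrightarrow> peval p (point \<phi>) \<ge> 0"
  proof eventually_elim
    case (elim \<phi>)
    show ?case
    proof
      fix p assume p: "p \<in> S"
      then have "same_sign (peval p (point \<phi>)) (generic_value p)" using elim by metis
      then have "peval p (point \<phi>) \<ge> 0 \<longleftrightarrow> generic_value p \<ge> 0" unfolding same_sign_def by (meson not_less)
      then show "p \<in> critical_cone \<longleftrightarrow> peval p (point \<phi>) \<ge> 0" by (simp add: generic_value_nonneg_iff)
    qed
  qed
  then obtain \<phi> where "\<forall>p\<in>S. p \<in> critical_cone \<longleftrightarrow> peval p (point \<phi>) \<ge> 0"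
    using eventually_happens'[OF generic.good_near[OF generic.good_UNIV]] by blast
  then show ?thesis unfolding realizable_def by blast
qed

theorem prime_cone_realizable:
  fixes P :: "('n::finite) rpoly set"
  assumes "prime_cone P" "finite S"
  shows "realizable P S"
  by (rule critical_cone_critical[OF realizable_critical_cone assms])

section \<open>Positivstellensatz and forward invariance\<close>

lemma SOS_add: "p \<in> SOS \<Longrightarrow> q \<in> SOS \<Longrightarrow> p + q \<in> SOS"
  unfolding SOS_def by clarify (metis map_append sum_list_append)

lemma SOS_square: "p * p \<in> SOS"
  unfolding SOS_def by (auto intro!: exI[of _ "[p]"] simp: power2_eq_square)

lemma SOS_0: "0 \<in> SOS" using SOS_square[of 0] by simp
lemma SOS_1: "1 \<in> SOS" using SOS_square[of 1] by simp

lemma SOS_mult: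
  assumes "p \<in> SOS" "q \<in> SOS" shows "p * q \<in> SOS"
proof -
  have *: "r ^ 2 * (\<Sum>q\<leftarrow>qs. q ^ 2) \<in> SOS" for r :: "'a rpoly" and qs
  proof (induction qs)
    case (Cons a qs)
    have "r ^ 2 * (\<Sum>q\<leftarrow>a # qs. q ^ 2) = (r * a) * (r * a) + r ^ 2 * (\<Sum>q\<leftarrow>qs. q ^ 2)"
      by (simp add: algebra_simps power2_eq_square)
    then show ?case using Cons SOS_square SOS_add by metis
  qed (simp add: SOS_0)
  obtain ps qs where "p = (\<Sum>q\<leftarrow>ps. q ^ 2)" "q = (\<Sum>q\<leftarrow>qs. q ^ 2)" using assms by (auto simp: SOS_def)
  moreover have "(\<Sum>q\<leftarrow>ps. q ^ 2) * (\<Sum>q\<leftarrow>qs. q ^ 2) \<in> SOS"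
    by (induction ps) (auto simp: SOS_0 ring_distribs intro!: SOS_add *)
  ultimately show ?thesis by simp
qed

lemma SOS_nonneg: "p \<in> SOS \<Longrightarrow> peval p x \<ge> 0"
proof -
  have "peval (\<Sum>q\<leftarrow>qs. q ^ 2) x \<ge> 0" for qs
    by (induction qs) (auto simp: peval_0 peval_add peval_power)
  then show "p \<in> SOS \<Longrightarrow> peval p x \<ge> 0" by (auto simp: SOS_def)
qed

lemma row_times_add: "row_times v (p + q) = row_times v p + row_times v q"
  by (simp add: row_times_def distrib_left sum.distrib)

lemma row_times_mult: "r * row_times v p = row_times v (\<chi> j. r * p $ j)"
  by (simp add: row_times_def sum_distrib_left algebra_simps)

lemma peval_row_times: "peval (row_times v p) x = peval_vec v x \<bullet> peval_vec p x"
  by (simp add: row_times_def peval_sum peval_mult peval_vec_def inner_vec_def)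

lemma peval_vec_eq_0_iff: "peval_vec v x = 0 \<longleftrightarrow> (\<forall>j. peval (v $ j) x = 0)"
  by (auto simp: peval_vec_def vec_eq_iff)

text \<open>The elements \<open>t - s * l\<close>, together with the ideal generated by
  \<open>b\<close> and the components of \<open>v\<close>, form the precone expressing
  \<open>l \<le> 0\<close> and the equalities. A certificate amounts to an element
  \<open>- (l ^ (2 * a))\<close> of it; without one, some prime cone avoids all these elements, and
  a point realizing it contradicts the assumption.\<close>

theorem positivstellensatz:
  fixes b l :: "('n::finite) rpoly" and v :: "'n rpoly ^ ('m::finite)"
  assumes "\<And>x. peval b x = 0 \<Longrightarrow> peval_vec v x = 0 \<Longrightarrow> peval l x \<ge> 0"
  shows "\<exists>a s t p q. s \<in> SOS \<and> t \<in> SOS \<and> s * l - (t + b * p + row_times v q) - l ^ (2 * a) = 0"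
proof (rule ccontr)
  assume none: "\<not> ?thesis"
  define T where "T = {t - s * l + b * p + row_times v q | t s p q. s \<in> SOS \<and> t \<in> SOS}"
  have TI: "t - s * l + b * p + row_times v q \<in> T" if "s \<in> SOS" "t \<in> SOS" for t s p q
    using that unfolding T_def by blast
  have row0: "row_times v 0 = 0" by (simp add: row_times_def)
  have T: "precone T" unfolding precone_def
  proof (intro conjI ballI allI)
    fix y z assume "y \<in> T" "z \<in> T"
    then obtain t s p q t' s' p' q' where h: "s \<in> SOS" "t \<in> SOS" "y = t - s * l + b * p + row_times v q"
      "s' \<in> SOS" "t' \<in> SOS" "z = t' - s' * l + b * p' + row_times v q'" unfolding T_def by blast
    have "y + z = (t + t') - (s + s') * l + b * (p + p') + row_times v (q + q')"
      by (simp add: h row_times_add algebra_simps)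
    then show "y + z \<in> T" using TI SOS_add h by metis
    \<comment> \<open>The product splits into a part free of the equalities, where
      \<open>l * l\<close> is absorbed as a square, a multiple of \<open>b\<close>, and multiples of
      the two \<open>row_times\<close> terms.\<close>
    have "y * z = (t * t' + s * s' * (l * l)) - (s * t' + t * s') * l +
        b * (p * z + (t - s * l) * p' + row_times v q * p') +
        (z - b * p') * row_times v q + (t - s * l) * row_times v q'"
      by (simp add: h algebra_simps)
    also have "\<dots> = (t * t' + s * s' * (l * l)) - (s * t' + t * s') * l +
        b * (p * z + (t - s * l) * p' + row_times v q * p') +
        row_times v ((\<chi> j. (z - b * p') * q $ j) + (\<chi> j. (t - s * l) * q' $ j))"
      by (simp only: row_times_mult row_times_add add.assoc)
    also have "\<dots> \<in> T" by (intro TI SOS_add SOS_mult SOS_square h)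
    finally show "y * z \<in> T" .
  next
    fix y show "y * y \<in> T" using TI[OF SOS_0 SOS_square, of y 0 0] by (simp add: row0)
  qed
  \<comment> \<open>Even powers are squares and hence lie in \<open>T\<close>, as
    \<open>prime_cone_extend\<close> requires of \<open>M\<close>.\<close>
  define M where "M = range (\<lambda>a::nat. l ^ (2 * a))"
  have M_sq: "l ^ (2 * a) = l ^ a * l ^ a" for a by (simp add: mult_2 power_add)
  obtain P where P: "prime_cone P" "T \<subseteq> P" and PM: "\<And>m. m \<in> M \<Longrightarrow> - m \<notin> P"
  proof (rule prime_cone_extend[OF T])
    show "M \<subseteq> T" unfolding M_def using cone_square[OF T] by (auto simp: M_sq)
    show "1 \<in> M" unfolding M_def by (rule range_eqI[of _ _ 0]) simp
    show "m * n \<in> M" if "m \<in> M" "n \<in> M" for m n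
    proof -
      obtain a c where "m = l ^ (2 * a)" "n = l ^ (2 * c)" using \<open>m \<in> M\<close> \<open>n \<in> M\<close> by (auto simp: M_def)
      then have "m * n = l ^ (2 * (a + c))" by (simp add: power_add distrib_left)
      then show ?thesis unfolding M_def by blast
    qed
    show "- m \<notin> T" if "m \<in> M" for m
    proof
      assume "- m \<in> T"
      then obtain t s p q where h: "s \<in> SOS" "t \<in> SOS" "- m = t - s * l + b * p + row_times v q"
        unfolding T_def by blast
      obtain a where a: "m = l ^ (2 * a)" using \<open>m \<in> M\<close> by (auto simp: M_def)
      have "s * l - (t + b * p + row_times v q) - m = - (t - s * l + b * p + row_times v q) - m"
        by (simp add: algebra_simps)
      also have "\<dots> = 0" by (simp flip: h(3))
      finally show False using none h(1,2) a by blast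
    qed
  qed blast
  have bP: "b \<in> P" "- b \<in> P" "- l \<in> P"
    using TI[OF SOS_0 SOS_0, of 1 0] TI[OF SOS_0 SOS_0, of "-1" 0] TI[OF SOS_1 SOS_0, of 0 0] P(2)
    by (auto simp: row0)
  have vP: "v $ j \<in> P" "- v $ j \<in> P" for j
  proof -
    have ax: "row_times v (axis j c) = v $ j * c" for c
      by (simp add: row_times_def axis_def if_distrib cong: if_cong)
    show "v $ j \<in> P" "- v $ j \<in> P"
      using TI[OF SOS_0 SOS_0, of 0 "axis j 1"] TI[OF SOS_0 SOS_0, of 0 "axis j (- 1)"] P(2)
      by (auto simp: ax)
  qed
  have lP: "l \<notin> P"
  proof
    assume "l \<in> P"
    then have "l * (- l) \<in> P" using bP(3) by (intro prime_coneD(2)[OF P(1)])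
    moreover have "l * l \<in> M" unfolding M_def by (rule range_eqI[of _ _ 1]) (simp add: power2_eq_square)
    ultimately show False using PM[of "l * l"] by simp
  qed
  \<comment> \<open>Both signs of each equality are listed, so that membership in \<open>P\<close>
    forces vanishing at the point.\<close>
  define S where "S = {b, - b, l} \<union> range (($) v) \<union> range (\<lambda>j. - v $ j)"
  have "finite S" by (simp add: S_def)
  then obtain x where x: "\<And>p. p \<in> S \<Longrightarrow> p \<in> P \<longleftrightarrow> peval p x \<ge> 0"
    using prime_cone_realizable[OF P(1)] unfolding realizable_def by blast
  have "peval b x = 0" using x[of b] x[of "- b"] bP by (simp add: S_def peval_uminus)
  moreover have "peval (v $ j) x = 0" for j
    using x[of "v $ j"] x[of "- v $ j"] vP[of j] by (simp add: S_def peval_uminus)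
  ultimately have "peval l x \<ge> 0" using assms by (simp add: peval_vec_eq_0_iff)
  then show False using x[of l] lP by (simp add: S_def)
qed

lemma mem_quadratic_module:
  assumes "s \<in> SOS"
  shows "s + b * p + row_times (lie_g g b) q \<in> quadratic_module {} (equality_set g b)"
proof -
  let ?v = "lie_g g b"
  let ?G = "equality_set g b"
  \<comment> \<open>\<open>equality_set\<close> is a set: components of \<open>lie_g g b\<close>
    that coincide with each other or with \<open>b\<close> give a single element, so the
    coefficients belonging to it are added up.\<close>
  define c where "c r = (if r = b then p else 0) + (\<Sum>j | ?v $ j = r. q $ j)" for r
  have fin: "finite ?G" by (simp add: equality_set_def)
  have "(\<Sum>r\<in>?G. c r * r) = (\<Sum>r\<in>?G. (if r = b then p else 0) * r) + (\<Sum>r\<in>?G. \<Sum>j | j \<in> UNIV \<and> ?v $ j = r. q $ j * ?v $ j)"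
    by (simp add: c_def distrib_right sum.distrib sum_distrib_right)
  also have "(\<Sum>r\<in>?G. (if r = b then p else 0) * r) = (\<Sum>r\<in>?G. if r = b then p * r else 0)"
    by (intro sum.cong) auto
  also have "\<dots> = b * p"
    using fin by (simp add: sum.delta) (simp add: equality_set_def mult.commute)
  also have "(\<Sum>r\<in>?G. \<Sum>j | j \<in> UNIV \<and> ?v $ j = r. q $ j * ?v $ j) = (\<Sum>j\<in>UNIV. q $ j * ?v $ j)"
    by (rule sum.group) (auto simp: equality_set_def)
  also have "\<dots> = row_times ?v q" by (simp add: row_times_def mult.commute)
  finally have "s + b * p + row_times ?v q = s + (\<Sum>r\<in>{}. 0 * r) + (\<Sum>r\<in>?G. c r * r)" by simp
  then show ?thesis using assms unfolding quadratic_module_def by fastforce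
qed

text \<open>From left to right, the Positivstellensatz provides an \<open>h1\<close> that is a sum
  of squares outright. Conversely, at a violating point the equalities reduce \<open>h1\<close> and
  \<open>h2\<close> to their square parts, and the identity equates a nonpositive number with a
  positive even power.\<close>

theorem criterion_iff_certificate: "CBF_criterion f g b \<longleftrightarrow> has_certificate f g b"
proof
  assume "CBF_criterion f g b"
  then have "\<And>x. peval b x = 0 \<Longrightarrow> peval_vec (lie_g g b) x = 0 \<Longrightarrow> peval (lie_f f b) x \<ge> 0"
    unfolding CBF_criterion_def assoc_set_def by (auto simp: not_less)
  then obtain a s t p q where h: "s \<in> SOS" "t \<in> SOS"
    "s * lie_f f b - (t + b * p + row_times (lie_g g b) q) - lie_f f b ^ (2 * a) = 0"
    using positivstellensatz by blast
  have s: "s = s + b * 0 + row_times (lie_g g b) 0" by (simp add: row_times_def)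
  show "has_certificate f g b" unfolding has_certificate_def
  proof (intro exI conjI)
    show "s \<in> SOS" "t \<in> SOS" by fact+
    show "s \<in> quadratic_module {} (equality_set g b)" using mem_quadratic_module[OF h(1)] s by metis
    show "t + b * p + row_times (lie_g g b) q \<in> quadratic_module {} (equality_set g b)"
      by (rule mem_quadratic_module[OF h(2)])
    show "s = s + b * 0 + row_times (lie_g g b) 0" by (rule s)
    show "t + b * p + row_times (lie_g g b) q = t + b * p + row_times (lie_g g b) q" ..
    show "s * lie_f f b - (t + b * p + row_times (lie_g g b) q) - lie_f f b ^ (2 * a) = 0" by (rule h(3))
  qed
next
  assume "has_certificate f g b"
  then obtain a s1 s2 p10 p20 p1 p2 h1 h2 where h: "s1 \<in> SOS" "s2 \<in> SOS"
     "h1 = s1 + b * p10 + row_times (lie_g g b) p1" "h2 = s2 + b * p20 + row_times (lie_g g b) p2"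
     "h1 * lie_f f b - h2 - (lie_f f b) ^ (2 * a) = 0"
    unfolding has_certificate_def by blast
  show "CBF_criterion f g b" unfolding CBF_criterion_def
  proof
    assume "\<exists>x\<in>assoc_set g b. peval (lie_f f b) x < 0"
    then obtain x where x: "peval b x = 0" "peval_vec (lie_g g b) x = 0" "peval (lie_f f b) x < 0"
      by (auto simp: assoc_set_def)
    have v: "peval h1 x = peval s1 x" "peval h2 x = peval s2 x"
      by (simp_all add: h(3,4) peval_add peval_mult peval_row_times x)
    have "peval (h1 * lie_f f b - h2 - (lie_f f b) ^ (2 * a)) x = 0" by (simp only: h(5) peval_0)
    then have "peval s1 x * peval (lie_f f b) x - peval s2 x = (peval (lie_f f b) x ^ a)\<^sup>2"
      by (simp add: peval_diff peval_mult peval_power v power_mult mult.commute)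
    moreover have "(peval (lie_f f b) x ^ a)\<^sup>2 > 0" using x(3) by simp
    moreover have "peval s1 x * peval (lie_f f b) x \<le> 0" using SOS_nonneg[OF h(1)] x(3)
      by (simp add: mult_nonneg_nonpos)
    ultimately show False using SOS_nonneg[OF h(2), of x] by linarith
  qed
qed

section \<open>Lie derivatives and forward invariance\<close>

lemma peval_pdiff:
  "peval (pdiff i p) x = (\<Sum>m\<in>Poly_Mapping.keys p. Poly_Mapping.lookup p m *
     (real (Poly_Mapping.lookup m i) * x $ i ^ (Poly_Mapping.lookup m i - 1) *
       (\<Prod>j\<in>UNIV - {i}. x $ j ^ Poly_Mapping.lookup m j)))"
proof -
  have "monomial_value (($) x) (m - Poly_Mapping.single i 1) =
     x $ i ^ (Poly_Mapping.lookup m i - 1) * (\<Prod>j\<in>UNIV - {i}. x $ j ^ Poly_Mapping.lookup m j)" for m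
    by (subst prod.remove[of UNIV i]) (auto simp: lookup_minus lookup_single when_def intro!: prod.cong)
  then show ?thesis unfolding pdiff_def peval_sum peval_single by (simp add: algebra_simps)
qed

lemma has_derivative_peval:
  "(peval p has_derivative (\<lambda>h. \<Sum>i\<in>UNIV. peval (pdiff i p) x * h $ i)) (at x)"
proof -
  have "((\<lambda>x. \<Sum>m\<in>Poly_Mapping.keys p. Poly_Mapping.lookup p m * (\<Prod>i\<in>UNIV. x $ i ^ Poly_Mapping.lookup m i)) has_derivative
    (\<lambda>h. \<Sum>m\<in>Poly_Mapping.keys p. Poly_Mapping.lookup p m * (\<Sum>i\<in>UNIV.
       (of_nat (Poly_Mapping.lookup m i) * h $ i * x $ i ^ (Poly_Mapping.lookup m i - 1)) *
       (\<Prod>j\<in>UNIV - {i}. x $ j ^ Poly_Mapping.lookup m j)))) (at x)"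
    by (intro has_derivative_sum has_derivative_mult_right has_derivative_prod has_derivative_power
        bounded_linear.has_derivative[OF bounded_linear_vec_nth] has_derivative_ident)
  moreover have "(\<Sum>m\<in>Poly_Mapping.keys p. Poly_Mapping.lookup p m * (\<Sum>i\<in>UNIV.
       (of_nat (Poly_Mapping.lookup m i) * h $ i * x $ i ^ (Poly_Mapping.lookup m i - 1)) *
       (\<Prod>j\<in>UNIV - {i}. x $ j ^ Poly_Mapping.lookup m j))) = (\<Sum>i\<in>UNIV. peval (pdiff i p) x * h $ i)" for h
    unfolding peval_pdiff sum_distrib_left sum_distrib_right
    by (subst sum.swap) (simp add: algebra_simps)
  ultimately show ?thesis unfolding peval_def[abs_def] by simp
qed

lemma peval_lie_f: "peval (lie_f f b) x = (\<Sum>i\<in>UNIV. peval (pdiff i b) x * peval_vec f x $ i)"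
  by (simp add: lie_f_def peval_sum peval_mult peval_vec_def)

lemma peval_lie_g: "peval_vec (lie_g g b) x \<bullet> u = (\<Sum>i\<in>UNIV. peval (pdiff i b) x * (peval_mat g x *v u) $ i)"
proof -
  have "peval_vec (lie_g g b) x \<bullet> u = (\<Sum>j\<in>UNIV. \<Sum>i\<in>UNIV. peval (pdiff i b) x * (peval (g $ i $ j) x * u $ j))"
    by (simp add: inner_vec_def peval_vec_def lie_g_def peval_sum peval_mult sum_distrib_right mult.assoc)
  also have "\<dots> = (\<Sum>i\<in>UNIV. \<Sum>j\<in>UNIV. peval (pdiff i b) x * (peval (g $ i $ j) x * u $ j))" by (rule sum.swap)
  finally show ?thesis by (simp add: matrix_vector_mult_def peval_mat_def sum_distrib_left)
qed

text \<open>No regularity of the feedback or of \<open>\<kappa>\<close> is needed: wherever \<open>b < 0\<close>, the constraint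
  forces \<open>b\<close> to be strictly increasing along solutions.\<close>

lemma input_constraint_forward_invariant:
  assumes \<kappa>: "extended_class_K \<kappa>" and k: "\<And>x. input_constraint f g b \<kappa> x (k x)"
  shows "forward_invariant (\<lambda>x. peval_vec f x + peval_mat g x *v k x) (safe_set b)"
  unfolding forward_invariant_def
proof (intro allI impI ballI)
  fix T and x :: "real \<Rightarrow> real ^ 'a" and t1
  let ?F = "\<lambda>x. peval_vec f x + peval_mat g x *v k x"
  assume sol: "(\<forall>t\<in>{0..T}. (x has_vector_derivative ?F (x t)) (at t within {0..T})) \<and> x 0 \<in> safe_set b"
    and t1: "t1 \<in> {0..T}"
  define \<beta> where "\<beta> t = peval b (x t)" for t
  define \<beta>' where "\<beta>' t = peval (lie_f f b) (x t) + peval_vec (lie_g g b) (x t) \<bullet> k (x t)" for t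
  have der: "(\<beta> has_derivative (\<lambda>h. h * \<beta>' t)) (at t within {0..T})" if "t \<in> {0..T}" for t
  proof -
    have "(x has_derivative (\<lambda>h. h *\<^sub>R ?F (x t))) (at t within {0..T})"
      using sol that unfolding has_vector_derivative_def by blast
    from has_derivative_compose[OF this has_derivative_peval[of b "x t"]]
    have "(\<beta> has_derivative (\<lambda>h. \<Sum>i\<in>UNIV. peval (pdiff i b) (x t) * (h *\<^sub>R ?F (x t)) $ i)) (at t within {0..T})"
      unfolding \<beta>_def by simp
    moreover have "(\<Sum>i\<in>UNIV. peval (pdiff i b) (x t) * (h *\<^sub>R ?F (x t)) $ i) = h * \<beta>' t" for h
      unfolding \<beta>'_def peval_lie_f peval_lie_g
      by (simp add: algebra_simps sum.distrib sum_distrib_left)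
    ultimately show ?thesis by simp
  qed
  have inc: "\<beta>' t > 0" if "\<beta> t < 0" for t
  proof -
    have "\<kappa> (\<beta> t) < 0" using that \<kappa> strict_monoD[of \<kappa> "\<beta> t" 0] by (simp add: extended_class_K_def)
    then show ?thesis using k[of "x t"] unfolding input_constraint_def \<beta>_def \<beta>'_def by linarith
  qed
  show "x t1 \<in> safe_set b"
  proof (rule ccontr)
    assume "x t1 \<notin> safe_set b"
    then have neg: "\<beta> t1 < 0" by (simp add: safe_set_def \<beta>_def)
    have cont: "continuous_on {0..t1} \<beta>"
    proof (rule has_derivative_continuous_on)
      fix t assume "t \<in> {0..t1}"
      then show "(\<beta> has_derivative (\<lambda>h. h * \<beta>' t)) (at t within {0..t1})"
        using t1 by (intro has_derivative_subset[OF der]) auto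
    qed
    \<comment> \<open>The maximum \<open>t0\<close> of this compact set is the last time up to
      \<open>t1\<close> with \<open>b\<close> nonnegative. After it \<open>b\<close> is negative,
      hence increasing, and cannot reach the negative value at \<open>t1\<close>.\<close>
    define Z where "Z = {t\<in>{0..t1}. \<beta> t \<in> {0..}}"
    have "compact Z"
    proof -
      have "closed Z" unfolding Z_def
        using continuous_closed_preimage[OF cont closed_atLeastAtMost closed_atLeast[of 0]] by (simp add: vimage_def Int_def)
      moreover have "bounded Z" unfolding Z_def by (rule bounded_subset[of "{0..t1}"]) auto
      ultimately show ?thesis by (simp add: compact_eq_bounded_closed)
    qed
    moreover have "0 \<in> Z" using sol t1 by (auto simp: Z_def \<beta>_def safe_set_def)
    ultimately obtain t0 where t0: "t0 \<in> Z" "\<And>t. t \<in> Z \<Longrightarrow> t \<le> t0"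
      using compact_attains_sup[of Z] by blast
    have lt: "t0 < t1" using t0(1) neg by (auto simp: Z_def less_le)
    have "(\<beta> has_derivative (\<lambda>h. h * \<beta>' t)) (at t within {t0..t1})" if "t0 \<le> t" "t \<le> t1" for t
      using that t0(1) t1 by (intro has_derivative_subset[OF der]) (auto simp: Z_def)
    then obtain \<xi> where \<xi>: "\<xi> \<in> {t0<..<t1}" "\<beta> t1 - \<beta> t0 = (t1 - t0) * \<beta>' \<xi>"
      using mvt_simple[OF lt, of \<beta> "\<lambda>t h. h * \<beta>' t"] by auto
    have "\<beta> \<xi> < 0"
    proof (rule ccontr)
      assume "\<not> \<beta> \<xi> < 0"
      then have "\<xi> \<in> Z" using \<xi>(1) t0(1) by (auto simp: Z_def)
      then show False using t0(2) \<xi>(1) by fastforce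
    qed
    then have "(t1 - t0) * \<beta>' \<xi> > 0" using inc lt by simp
    moreover have "\<beta> t0 \<ge> 0" using t0(1) by (simp add: Z_def)
    ultimately show False using \<xi>(2) neg by linarith
  qed
qed

text \<open>The input enters linearly, so either it has no influence at \<open>x\<close>, or a
  suitable multiple of the value of \<open>lie_g g b\<close> turns the constraint into an equality.
  The feedback \<open>k\<close> is then chosen point by point.\<close>

lemma is_CBF_verified:
  assumes "is_CBF f g b"
  shows "verified_forward_invariant f g b"
proof -
  obtain \<kappa> where \<kappa>: "extended_class_K \<kappa>"
    "\<And>x. (SUP u. ereal (peval (lie_f f b) x + peval_vec (lie_g g b) x \<bullet> u + \<kappa> (peval b x))) \<ge> 0"
    using assms unfolding is_CBF_def by blast
  have "\<exists>u. input_constraint f g b \<kappa> x u" for x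
  proof (cases "peval_vec (lie_g g b) x = 0")
    case True
    then have "peval (lie_f f b) x + \<kappa> (peval b x) \<ge> 0" using \<kappa>(2)[of x] by simp
    then show ?thesis using True by (auto simp: input_constraint_def)
  next
    case False
    let ?v = "peval_vec (lie_g g b) x"
    let ?c = "- \<kappa> (peval b x) - peval (lie_f f b) x"
    have "?v \<bullet> ((?c / (?v \<bullet> ?v)) *\<^sub>R ?v) = ?c" using False by simp
    then show ?thesis unfolding input_constraint_def by (metis order_refl)
  qed
  then obtain k where "\<And>x. input_constraint f g b \<kappa> x (k x)" by metis
  then show ?thesis
    using \<kappa>(1) input_constraint_forward_invariant unfolding verified_forward_invariant_def by blast
qed

text \<open>The adopted equivalence of \<open>is_CBF\<close> with the criterion fails for some data,
  so it is a hypothesis of the first conjunct; the second conjunct records what holds for all data.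
  Since \<open>is_CBF\<close> implies forward invariance, the left-hand side of the first
  equivalence amounts to \<open>is_CBF\<close>.\<close>

theorem theorem1:
  fixes f :: "('n::finite) rpoly ^ 'n"
    and g :: "'n rpoly ^ ('m::finite) ^ 'n"
    and b :: "'n rpoly"
  shows "((is_CBF f g b \<longleftrightarrow> CBF_criterion f g b) \<longrightarrow>
            (is_CBF f g b \<and> verified_forward_invariant f g b \<longleftrightarrow> has_certificate f g b))
         \<and> (CBF_criterion f g b \<longleftrightarrow> has_certificate f g b)"
  using criterion_iff_certificate[of f g b] is_CBF_verified[of f g b] by blast

end
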